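(* Let $d>1$ be a squarefree integer, let $u=a+b\sqrt d$ be the fundamental unit of $\mathbb{Q}(\sqrt d)$, and let $v=(a+b\sqrt d)^{1/3}$, $v'=(a-b\sqrt d)^{1/3}$ be the real cube roots. Put $t=v+v'$ and $F=\mathbb{Q}(\sqrt{-3d})$, and let $M$ be the ring class field of the order $\mathbb{Z}[\sqrt{-3d}]$ in $F$. Suppose that $3\nmid d$ and $v\in M$. Then the fields $E=\mathbb{Q}(t)$ and $F$ have the same discriminant.
   Context: All fields are subfields of $\mathbb{C}$. The fundamental unit is the fundamental unit of the full ring of integers of $\mathbb{Q}(\sqrt d)$, so $a,b$ are rational numbers that may be half-integers when $d\equiv 1 \pmod 4$. The ring class field of an order $\mathcal{O}$ of conductor $f$ in an imaginary quadratic field $F$ is the abelian extension of $F$ corresponding, by class field theory, to the group of fractional ideals prime to $f$ modulo the subgroup generated by the principal ideals $\alpha\mathcal{O}_F$ with $\alpha\equiv k \pmod{f\mathcal{O}_F}$ for some integer $k$ coprime to $f$. Its Galois group over $F$ is isomorphic to the class group of $\mathcal{O}$. *)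

theory Defs
  imports
    "Jordan_Normal_Form.Determinant"
    "HOL-Computational_Algebra.Squarefree"
    "HOL-Algebra.Algebra"
    "HOL-Algebra.Algebraic_Closure_Type"
begin

text \<open>
  All fields are subfields of the complex numbers. The complex numbers are turned into a
  HOL-Algebra ring, a field is given by its carrier set, and its ring structure is the restriction.
\<close>

abbreviation CC :: "complex ring" where
  "CC \<equiv> ring_of_type_algebra"

abbreviation sub_CC :: "complex set \<Rightarrow> complex ring" where
  "sub_CC K \<equiv> CC\<lparr>carrier := K\<rparr>"

text \<open>The field \<open>\<rat>(x)\<close>; a subfield generated by a set always contains the prime field.\<close>

definition Q_adjoin :: "complex \<Rightarrow> complex set" where
  "Q_adjoin x = generate_field CC {x}"

definition ring_of_integers :: "complex set \<Rightarrow> complex ring" (\<open>\<O>\<close>) where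
  "\<O> K = sub_CC {x \<in> K. algebraic_int x}"


section \<open>The discriminant of a number field\<close>

text \<open>Field embeddings, taken extensional so that each one is counted once.\<close>

definition embeddings :: "complex set \<Rightarrow> (complex \<Rightarrow> complex) set" where
  "embeddings K = Ring.ring_hom (sub_CC K) CC \<inter> extensional K"

definition integral_basis :: "complex set \<Rightarrow> complex list \<Rightarrow> bool" where
  "integral_basis K ws \<longleftrightarrow>
     bij_betw (\<lambda>c. \<Sum>i<length ws. of_int (c i) * ws ! i)
       ({..<length ws} \<rightarrow>\<^sub>E (UNIV :: int set)) (carrier (\<O> K))"

text \<open>
  \<open>det (\<sigma>\<^sub>i \<omega>\<^sub>j)\<^sup>2\<close> for an integral basis \<open>\<omega>\<close> and the embeddings \<open>\<sigma>\<close> in any order. For a number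
  field this is an integer that does not depend on the choices.
\<close>

definition field_discriminant :: "complex set \<Rightarrow> int" where
  "field_discriminant K =
     (THE D. \<exists>ws \<sigma>s. integral_basis K ws \<and> distinct \<sigma>s \<and> set \<sigma>s = embeddings K \<and>
        of_int D = (det (mat (length \<sigma>s) (length ws) (\<lambda>(i, j). (\<sigma>s ! i) (ws ! j))))\<^sup>2)"


section \<open>Units of real quadratic fields\<close>

text \<open>The fundamental unit of \<open>\<rat>(\<surd>d)\<close> in its usual normalisation, as the generator exceeding 1.\<close>

definition is_fundamental_unit :: "int \<Rightarrow> real \<Rightarrow> bool" where
  "is_fundamental_unit d u \<longleftrightarrow>
     (let U = Units (\<O> (Q_adjoin (complex_of_real (sqrt (of_int d))))) in
      u > 1 \<and> complex_of_real u \<in> U \<and>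
      (\<forall>w \<in> U. \<exists>n :: int. w = complex_of_real (u powi n) \<or> w = - complex_of_real (u powi n)))"


section \<open>Abelian extensions and the Artin map\<close>

definition galois_group :: "complex set \<Rightarrow> complex set \<Rightarrow> (complex \<Rightarrow> complex) monoid" where
  "galois_group F M =
     (BijGroup M)\<lparr>carrier :=
        {\<sigma> \<in> Bij M. \<sigma> \<in> Ring.ring_hom (sub_CC M) (sub_CC M) \<and> (\<forall>x\<in>F. \<sigma> x = x)}\<rparr>"

text \<open>Finite abelian extensions \<open>M\<close> of \<open>F\<close>.\<close>

definition abelian_extension :: "complex set \<Rightarrow> complex set \<Rightarrow> bool" where
  "abelian_extension F M \<longleftrightarrow>
     subfield F CC \<and> subfield M CC \<and> F \<subseteq> M \<and> ring.finite_dimension CC F M \<and>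
     {x \<in> M. \<forall>\<sigma> \<in> carrier (galois_group F M). \<sigma> x = x} = F \<and>
     comm_group (galois_group F M)"

text \<open>Nonzero prime ideals of the ring of integers.\<close>

definition primes_of :: "complex set \<Rightarrow> complex set set" where
  "primes_of K = {P. primeideal P (\<O> K) \<and> P \<noteq> {0}}"

definition primes_above :: "complex set \<Rightarrow> complex set \<Rightarrow> complex set \<Rightarrow> complex set set" where
  "primes_above F M P = {Q \<in> primes_of M. Q \<inter> F = P}"

text \<open>The exponent of \<open>Q\<close> in the factorisation of the extended ideal \<open>P\<O>\<^sub>M\<close>.\<close>

definition ramification_index :: "complex set \<Rightarrow> complex set \<Rightarrow> complex set \<Rightarrow> nat" where
  "ramification_index M P Q =
     (GREATEST e. genideal (\<O> M) P \<subseteq> (ideal_prod (\<O> M) Q ^^ e) (carrier (\<O> M)))"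

definition unramified_at :: "complex set \<Rightarrow> complex set \<Rightarrow> complex set \<Rightarrow> bool" where
  "unramified_at F M P \<longleftrightarrow> (\<forall>Q \<in> primes_above F M P. ramification_index M P Q = 1)"

definition ideal_norm :: "complex set \<Rightarrow> complex set \<Rightarrow> nat" where
  "ideal_norm F P = card (carrier (\<O> F Quot P))"

text \<open>
  The Artin symbol of a prime \<open>P\<close> of \<open>F\<close>, for \<open>M\<close> abelian over \<open>F\<close> and unramified at \<open>P\<close>. As the
  Galois group is abelian, the Frobenius elements of all primes above \<open>P\<close> agree.
\<close>

definition artin_symbol :: "complex set \<Rightarrow> complex set \<Rightarrow> complex set \<Rightarrow> complex \<Rightarrow> complex" where
  "artin_symbol F M P =
     (THE \<sigma>. \<sigma> \<in> carrier (galois_group F M) \<and>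
        (\<forall>Q \<in> primes_above F M P. \<forall>x \<in> carrier (\<O> M). \<sigma> x - x ^ ideal_norm F P \<in> Q))"

text \<open>Nonzero fractional ideals: subsets that some nonzero algebraic integer scales to an ideal.\<close>

definition fractional_ideal :: "complex set \<Rightarrow> complex set \<Rightarrow> bool" where
  "fractional_ideal F I \<longleftrightarrow>
     I \<noteq> {0} \<and> (\<exists>c \<in> carrier (\<O> F). c \<noteq> 0 \<and> ideal ((\<lambda>x. c * x) ` I) (\<O> F))"

definition coprime_ideal :: "complex set \<Rightarrow> nat \<Rightarrow> complex set \<Rightarrow> bool" where
  "coprime_ideal F f A \<longleftrightarrow>
     ideal A (\<O> F) \<and> A \<noteq> {0} \<and> A <+>\<^bsub>\<O> F\<^esub> PIdl\<^bsub>\<O> F\<^esub> (of_nat f) = carrier (\<O> F)"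

text \<open>
  The group of fractional ideals prime to \<open>f\<close>, that is of the quotients \<open>A B\<^sup>-\<^sup>1\<close> of integral ideals
  prime to \<open>f\<close>. The constant \<^const>\<open>ideal_prod\<close> only uses the operations of its ring argument, so
  over \<^term>\<open>CC\<close> it is the product of arbitrary additive subgroups of the complex numbers.
\<close>

definition fractional_ideal_group :: "complex set \<Rightarrow> nat \<Rightarrow> complex set monoid" where
  "fractional_ideal_group F f =
     \<lparr>carrier = {I. fractional_ideal F I \<and>
        (\<exists>A B. coprime_ideal F f A \<and> coprime_ideal F f B \<and> ideal_prod CC I B = A)},
      monoid.mult = ideal_prod CC,
      one = carrier (\<O> F)\<rparr>"

text \<open>
  The subgroup generated by the principal ideals \<open>\<alpha>\<O>\<^sub>F\<close> with \<open>\<alpha> \<equiv> k\<close> modulo \<open>f\<O>\<^sub>F\<close> for an integer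
  \<open>k\<close> prime to \<open>f\<close>. The condition \<open>\<alpha> \<noteq> 0\<close> is only needed for \<open>f = 1\<close>.
\<close>

definition ring_class_subgroup :: "complex set \<Rightarrow> nat \<Rightarrow> complex set set" where
  "ring_class_subgroup F f =
     generate (fractional_ideal_group F f)
       {PIdl\<^bsub>\<O> F\<^esub> \<alpha> | \<alpha> (k :: int). \<alpha> \<in> carrier (\<O> F) \<and> \<alpha> \<noteq> 0 \<and> coprime k (int f) \<and>
          \<alpha> - of_int k \<in> PIdl\<^bsub>\<O> F\<^esub> (of_nat f)}"

text \<open>The conductor of an order \<open>R\<close> in a quadratic field \<open>F\<close>: the index of \<open>R\<close> in \<open>\<O>\<^sub>F\<close>.\<close>

definition conductor :: "complex set \<Rightarrow> complex set \<Rightarrow> nat" where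
  "conductor F R = card (a_rcosets\<^bsub>\<O> F\<^esub> R)"

text \<open>
  \<open>M\<close> is the ring class field of the order \<open>R\<close> in the imaginary quadratic field \<open>F\<close>: the abelian
  extension of \<open>F\<close>, unramified at all primes not dividing the conductor \<open>f\<close>, for which the kernel
  of the Artin map on the fractional ideals prime to \<open>f\<close> is the subgroup above. Here \<open>\<Phi>\<close> is the
  Artin map, the only homomorphism with the prescribed values at the primes. The infinite place of
  \<open>F\<close> is complex and imposes no condition. That exactly one such \<open>M\<close> exists is a theorem of class
  field theory.
\<close>

definition is_ring_class_field :: "complex set \<Rightarrow> complex set \<Rightarrow> complex set \<Rightarrow> bool" where
  "is_ring_class_field F R M \<longleftrightarrow>
     (let f = conductor F R;
          I = fractional_ideal_group F f;
          G = galois_group F M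
      in abelian_extension F M \<and>
         (\<forall>P \<in> primes_of F. of_nat f \<notin> P \<longrightarrow> unramified_at F M P) \<and>
         (\<exists>\<Phi> \<in> hom I G.
            (\<forall>P \<in> primes_of F. of_nat f \<notin> P \<longrightarrow> \<Phi> P = artin_symbol F M P) \<and>
            kernel I G \<Phi> = ring_class_subgroup F f))"

end

theory Submission
  imports Defs "Jordan_Normal_Form.Char_Poly"
begin

text \<open>
  Write \<open>u\<close>, \<open>u'\<close> for the fundamental unit and its conjugate and \<open>N = u u' = v v' = \<plusminus>1\<close>. As
  \<open>3 \<nmid> d\<close>, the unit \<open>u\<^sup>8\<close> is congruent to 1 modulo 3, which suggests replacing \<open>v\<close> by
  \<open>v\<^sup>8 = u\<^sup>3 v\<^sup>-\<^sup>1\<close>. The element \<open>\<theta> = (1 + v\<^sup>8 + v'\<^sup>8) / 3\<close> of \<open>E\<close> satisfies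
  \<open>27 (\<theta>\<^sup>3 - \<theta>\<^sup>2) = d e\<^sup>2\<close>, where \<open>u\<^sup>4 - u'\<^sup>4 = e \<surd>d\<close> and \<open>3 | e\<close>.

  If \<open>e = 3 c\<close> with \<open>3 \<nmid> c\<close>, then \<open>\<theta>\<close> has valuation \<open>-1/3\<close> above 3, and with
  \<open>\<kappa> = \<surd>(-3d)\<close> the integer \<open>y = 3 d \<theta> / \<kappa>\<close> satisfies \<open>y\<^sup>3 + \<kappa> y\<^sup>2 = \<kappa> c\<^sup>2 d\<^sup>2\<close>.
  Hence \<open>\<kappa>\<close> lies in \<open>Q\<^sup>2\<close> for every prime \<open>Q\<close> of \<open>M\<close> above 3. But the conductor is 1 or 2, so
  \<open>M / F\<close> is unramified at the prime above 3, a contradiction.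

  So \<open>9 | e\<close> and \<open>\<theta>\<close> is integral. Let \<open>1, \<rho>\<close> be the standard integral basis of \<open>\<rat>(\<surd>d)\<close> and
  \<open>\<rho>'\<close> the conjugate of \<open>\<rho>\<close>. As \<open>u\<close> is a unit, 3 is the only prime that can divide the index of
  the lattice spanned by \<open>1\<close>, \<open>v + v'\<close> and \<open>\<rho> v + \<rho>' v'\<close> in the integers of \<open>E\<close>; replacing \<open>1\<close> by \<open>\<theta>\<close> gives an integral basis of \<open>E\<close>, of discriminant \<open>-3 (\<rho> - \<rho>')\<^sup>2\<close>.
  This is \<open>-3d\<close> or \<open>-12d\<close> according to \<open>d\<close> modulo 4, as is the discriminant of \<open>F\<close>.
\<close>

text \<open>The exponent 8 serves two ends. As 3 is unramified in \<open>Q(sqrt d)\<close>, the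
  integers modulo 3 form a field with 9 elements or a product of two fields with 3 elements, so 8
  kills their units; and 8 is -1 modulo 3, so \<open>v ^ 8 = N u ^ 3 v'\<close> differs from
  \<open>v'\<close> only by a unit of the quadratic field. With \<open>w = v ^ 8\<close> one has
  \<open>v' ^ 8 = 1 / w\<close> and \<open>\<theta> = (1 + w + w ^ 2) / (3 w)\<close>, the analogue
  of the extra integer \<open>(1 + x + x ^ 2) / 3\<close> of a pure cubic field with
  \<open>x ^ 3\<close> congruent to 1 modulo 9. The equation of \<open>y\<close> is of Eisenstein
  type at the prime of \<open>F\<close> above 3, where \<open>\<kappa>\<close> is a uniformiser;
  this is why \<open>3 d \<theta>\<close> is divided by \<open>\<kappa>\<close>. Two definitions
  shape the rest. \<open>ramification_index\<close> is a greatest exponent, so a lower bound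
  requires that 3 lies in only finitely many powers of \<open>Q\<close>; finiteness of the residues
  modulo 3 and Nakayama's lemma supply this. \<open>field_discriminant\<close> is a definite
  description, so its independence of the basis and of the order of the embeddings has to be
  established.\<close>

hide_const (open) Polynomials.lead_coeff Polynomials.degree up_ring.coeff up_ring.monom

section \<open>Algebraic integers\<close>

lemma CC_simps [simp]:
  "carrier CC = UNIV" "x \<otimes>\<^bsub>CC\<^esub> y = x * y" "x \<oplus>\<^bsub>CC\<^esub> y = x + y" "\<one>\<^bsub>CC\<^esub> = 1" "\<zero>\<^bsub>CC\<^esub> = 0"
  by (simp_all add: ring_of_type_algebra_def)

interpretation CC: cring CC
  by (rule cring_from_type_algebra)

lemma CC_a_inv [simp]: "\<ominus>\<^bsub>CC\<^esub> x = - x"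
  by (rule CC.minus_equality) auto

lemma CC_m_inv [simp]: "x \<noteq> 0 \<Longrightarrow> inv\<^bsub>CC\<^esub> x = inverse x"
  by (rule CC.comm_inv_char) auto

interpretation ZM: Modules.module "\<lambda>(c::int) (x::complex). of_int c * x"
  by unfold_locales (auto simp: algebra_simps)

declare ZM.scale_scale [simp del] \<comment> \<open>loops with \<open>of_int_mult\<close>\<close>

lemma span_mult:
  assumes "x \<in> ZM.span S" "\<And>s. s \<in> S \<Longrightarrow> c * s \<in> ZM.span T"
  shows "c * x \<in> ZM.span T"
  using assms(1)
proof (induction rule: ZM.span_induct_alt)
  case base
  show ?case by (simp add: ZM.span_zero)
next
  case (step k a y)
  have "of_int k * (c * a) + c * y \<in> ZM.span T"
    by (intro ZM.span_add ZM.span_scale assms(2) step)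
  then show ?case by (simp add: algebra_simps)
qed

text \<open>Determinant trick: multiplication by \<open>x\<close> acts on the generators through an
  integer matrix \<open>A\<close>, so the vector of generators is an eigenvector for
  \<open>x\<close>, and the monic integer polynomial \<open>char_poly A\<close> vanishes at
  \<open>x\<close>. The assumption on 1 keeps this vector from being zero.\<close>

lemma algebraic_int_if_stable_module:
  assumes fin: "finite S" and one: "1 \<in> ZM.span S"
    and stable: "\<And>s. s \<in> S \<Longrightarrow> x * s \<in> ZM.span S"
  shows "algebraic_int x"
proof -
  obtain ws where ws: "set ws = S" "distinct ws"
    using finite_distinct_list[OF fin] by blast
  let ?n = "length ws"
  have "\<exists>u. \<forall>i<?n. x * ws ! i = (\<Sum>v\<in>S. of_int (u i v) * v)"
  proof -
    have "\<forall>i. \<exists>u. i < ?n \<longrightarrow> x * ws ! i = (\<Sum>v\<in>S. of_int (u v) * v)"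
    proof
      fix i
      have "i < ?n \<Longrightarrow> x * ws ! i \<in> range (\<lambda>u. \<Sum>v\<in>S. of_int (u v) * v)"
        using stable[of "ws ! i"] ws nth_mem unfolding ZM.span_finite[OF fin] by blast
      then show "\<exists>u. i < ?n \<longrightarrow> x * ws ! i = (\<Sum>v\<in>S. of_int (u v) * v)" by auto
    qed
    then show ?thesis by metis
  qed
  then obtain u where u: "\<And>i. i < ?n \<Longrightarrow> x * ws ! i = (\<Sum>v\<in>S. of_int (u i v) * v)" by blast
  have sum_ws: "(\<Sum>v\<in>S. g v) = (\<Sum>j<?n. g (ws ! j))" for g :: "complex \<Rightarrow> complex"
    using ws sum.reindex_bij_betw[OF bij_betw_nth[OF ws(2) refl ws(1)[symmetric]], of g] by simp
  define A where "A = mat ?n ?n (\<lambda>(i, j). u i (ws ! j))"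
  have A: "A \<in> carrier_mat ?n ?n" by (simp add: A_def)
  define w where "w = vec_of_list ws"
  have w: "w \<in> carrier_vec ?n" by (auto simp: w_def intro: carrier_vecI)
  let ?A = "map_mat of_int A :: complex mat"
  have "?A *\<^sub>v w = x \<cdot>\<^sub>v w"
  proof (rule eq_vecI)
    show "dim_vec (?A *\<^sub>v w) = dim_vec (x \<cdot>\<^sub>v w)" using w by (simp add: A_def)
    fix i assume "i < dim_vec (x \<cdot>\<^sub>v w)"
    then have i: "i < ?n" using w by simp
    show "(?A *\<^sub>v w) $ i = (x \<cdot>\<^sub>v w) $ i"
      using i u[OF i] by (simp add: A_def w_def scalar_prod_def sum_ws vec_of_list_index atLeast0LessThan)
  qed
  moreover have "w \<noteq> 0\<^sub>v ?n"
  proof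
    assume w0: "w = 0\<^sub>v ?n"
    have "s = 0" if "s \<in> S" for s
      using that ws(1) w0 by (metis in_set_conv_nth index_zero_vec(1) vec_of_list_index w_def)
    then have "ZM.span S \<subseteq> {0}"
      by (intro ZM.span_minimal) (auto simp: ZM.subspace_def)
    with one show False by auto
  qed
  ultimately have "eigenvalue ?A x"
    using w by (auto simp: eigenvalue_def eigenvector_def A_def)
  then have "poly (char_poly ?A) x = 0"
    using eigenvalue_root_char_poly[of ?A ?n x] A by simp
  then have "poly (map_poly of_int (char_poly A)) x = 0"
    using of_int_hom.char_poly_hom[OF A] by metis
  moreover have "lead_coeff (char_poly A) = 1"
    using degree_monic_char_poly[OF A] by simp
  ultimately show ?thesis
    unfolding algebraic_int_altdef_ipoly by blast
qed

text \<open>The condition \<open>n > 0\<close> puts \<open>x ^ 0\<close> among the generators, so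
  that their span contains 1, as the determinant trick requires.\<close>

lemma algebraic_int_power_in_span:
  fixes x :: complex
  assumes "algebraic_int x"
  obtains n where "n > 0" "x ^ n \<in> ZM.span ((\<lambda>i. x ^ i) ` {..<n})"
proof -
  obtain p where p: "poly (map_poly of_int p) x = 0" "lead_coeff p = 1"
    using assms unfolding algebraic_int_altdef_ipoly by blast
  let ?n = "degree p"
  have "0 = (\<Sum>i\<le>?n. of_int (coeff p i) * x ^ i)"
    using p(1) by (simp add: poly_altdef coeff_map_poly degree_map_poly)
  also have "\<dots> = (\<Sum>i<?n. of_int (coeff p i) * x ^ i) + x ^ ?n"
    using p(2) by (simp add: lessThan_Suc_atMost[symmetric])
  finally have "x ^ ?n = - (\<Sum>i<?n. of_int (coeff p i) * x ^ i)"
    by (simp add: eq_neg_iff_add_eq_0 add.commute)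
  also have "\<dots> \<in> ZM.span ((\<lambda>i. x ^ i) ` {..<?n})"
    by (intro ZM.span_neg ZM.span_sum ZM.span_scale ZM.span_base) auto
  finally have "x ^ ?n \<in> ZM.span ((\<lambda>i. x ^ i) ` {..<?n})" .
  moreover have "?n > 0"
  proof (rule ccontr)
    assume "\<not> ?n > 0"
    with calculation have "(1::complex) \<in> ZM.span {}" by simp
    then show False by simp
  qed
  ultimately show thesis using that by blast
qed

text \<open>The monomials \<open>x ^ i * y ^ j\<close> with small exponents span a module stable
  under both \<open>x\<close> and \<open>y\<close>, hence under their sum and product; this is how
  closure of the algebraic integers under both operations is obtained.\<close>

lemma algebraic_int_common_module:
  fixes x y :: complex
  assumes "algebraic_int x" "algebraic_int y"
  obtains S where "finite S" "1 \<in> ZM.span S"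
    "\<And>s. s \<in> ZM.span S \<Longrightarrow> x * s \<in> ZM.span S" "\<And>s. s \<in> ZM.span S \<Longrightarrow> y * s \<in> ZM.span S"
proof -
  obtain n where n: "n > 0" "x ^ n \<in> ZM.span ((\<lambda>i. x ^ i) ` {..<n})"
    using algebraic_int_power_in_span[OF assms(1)] .
  obtain m where m: "m > 0" "y ^ m \<in> ZM.span ((\<lambda>i. y ^ i) ` {..<m})"
    using algebraic_int_power_in_span[OF assms(2)] .
  define S where "S = (\<lambda>(i, j). x ^ i * y ^ j) ` ({..<n} \<times> {..<m})"
  have inS: "x ^ i * y ^ j \<in> ZM.span S" if "i < n" "j < m" for i j
    using that by (auto simp: S_def intro: ZM.span_base)
  show thesis
  proof (rule that)
    show "finite S" by (simp add: S_def)
    show "1 \<in> ZM.span S" using inS[of 0 0] n m by simp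
    show "x * s \<in> ZM.span S" if "s \<in> ZM.span S" for s
    proof (rule span_mult[OF that])
      fix s assume "s \<in> S"
      then obtain i j where ij: "i < n" "j < m" "s = x ^ i * y ^ j" by (auto simp: S_def)
      show "x * s \<in> ZM.span S"
      proof (cases "Suc i < n")
        case True
        then show ?thesis using inS[of "Suc i" j] ij by (simp add: mult.assoc)
      next
        case False
        then have "Suc i = n" using ij by simp
        then have "x * s = y ^ j * x ^ n" using ij by auto
        also have "\<dots> \<in> ZM.span S"
          by (rule span_mult[OF n(2)]) (use ij inS in \<open>auto simp: mult.commute\<close>)
        finally show ?thesis .
      qed
    qed
    show "y * s \<in> ZM.span S" if "s \<in> ZM.span S" for s
    proof (rule span_mult[OF that])
      fix s assume "s \<in> S"
      then obtain i j where ij: "i < n" "j < m" "s = x ^ i * y ^ j" by (auto simp: S_def)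
      show "y * s \<in> ZM.span S"
      proof (cases "Suc j < m")
        case True
        then show ?thesis using inS[of i "Suc j"] ij by (simp add: mult_ac)
      next
        case False
        then have "Suc j = m" using ij by simp
        then have "y * s = x ^ i * y ^ m" using ij by auto
        also have "\<dots> \<in> ZM.span S"
          by (rule span_mult[OF m(2)]) (use ij inS in auto)
        finally show ?thesis .
      qed
    qed
  qed
qed

lemma algebraic_int_add [intro]:
  fixes x y :: complex
  assumes "algebraic_int x" "algebraic_int y"
  shows "algebraic_int (x + y)"
proof (rule algebraic_int_common_module[OF assms])
  fix S assume "finite S" "1 \<in> ZM.span S"
    "\<And>s. s \<in> ZM.span S \<Longrightarrow> x * s \<in> ZM.span S" "\<And>s. s \<in> ZM.span S \<Longrightarrow> y * s \<in> ZM.span S"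
  then show ?thesis
    by (intro algebraic_int_if_stable_module[of S]) (auto simp: ring_distribs intro: ZM.span_add ZM.span_base)
qed

lemma algebraic_int_mult [intro]:
  fixes x y :: complex
  assumes "algebraic_int x" "algebraic_int y"
  shows "algebraic_int (x * y)"
proof (rule algebraic_int_common_module[OF assms])
  fix S assume "finite S" "1 \<in> ZM.span S"
    "\<And>s. s \<in> ZM.span S \<Longrightarrow> x * s \<in> ZM.span S" "\<And>s. s \<in> ZM.span S \<Longrightarrow> y * s \<in> ZM.span S"
  then show ?thesis
    by (intro algebraic_int_if_stable_module[of S]) (auto simp: mult.assoc intro: ZM.span_base)
qed

lemma algebraic_int_diff [intro]:
  fixes x y :: complex
  shows "algebraic_int x \<Longrightarrow> algebraic_int y \<Longrightarrow> algebraic_int (x - y)"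
  using algebraic_int_add[of x "- y"] by auto

lemma algebraic_int_of_int [simp, intro]: "algebraic_int (of_int n :: complex)"
  by (intro int_imp_algebraic_int) auto

lemma algebraic_int_1 [simp, intro]: "algebraic_int (1 :: complex)"
  by (intro int_imp_algebraic_int) auto

lemma algebraic_int_power [intro]:
  fixes x :: complex
  shows "algebraic_int x \<Longrightarrow> algebraic_int (x ^ n)"
  by (induction n) auto

lemma algebraic_int_of_power:
  fixes x :: complex
  assumes "algebraic_int (x ^ n)" "n > 0"
  shows "algebraic_int x"
  by (rule algebraic_int_root[OF assms(1), of "monom 1 n"])
    (use assms(2) in \<open>auto simp: poly_monom degree_monom_eq\<close>)

lemma algebraic_int_rat:
  assumes "algebraic_int (of_rat q :: complex)"
  obtains n where "q = of_int n"
proof -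
  have "(of_rat q :: complex) \<in> \<int>"
    using rational_algebraic_int_is_int[OF assms] by simp
  then obtain n where "(of_rat q :: complex) = of_int n" by (auto elim: Ints_cases)
  then have "(of_rat q :: complex) = of_rat (of_int n)" by simp
  then show thesis using that of_rat_eq_iff by blast
qed

lemma algebraic_int_poly:
  fixes x :: complex
  assumes "poly (map_poly of_int p) x = 0" "lead_coeff p = 1"
  shows "algebraic_int x"
  using assms algebraic_int_altdef_ipoly by blast

section \<open>Simple extensions of the rationals\<close>

lemma
  assumes "subfield K CC"
  shows subfield_0: "0 \<in> K" and subfield_1: "1 \<in> K"
    and subfield_minus: "x \<in> K \<Longrightarrow> - x \<in> K"
    and subfield_add: "x \<in> K \<Longrightarrow> y \<in> K \<Longrightarrow> x + y \<in> K"
    and subfield_mult: "x \<in> K \<Longrightarrow> y \<in> K \<Longrightarrow> x * y \<in> K"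
  using subringE[OF subfieldE(1)[OF assms]] by auto

lemma subfield_diff: "subfield K CC \<Longrightarrow> x \<in> K \<Longrightarrow> y \<in> K \<Longrightarrow> x - y \<in> K"
  using subfield_add[of K x "- y"] subfield_minus[of K y] by simp

lemma subfield_inverse:
  assumes "subfield K CC" "x \<in> K"
  shows "inverse x \<in> K"
  using CC.subfield_m_inv(1)[OF assms(1), of x] assms by (cases "x = 0") auto

lemma subfield_divide: "subfield K CC \<Longrightarrow> x \<in> K \<Longrightarrow> y \<in> K \<Longrightarrow> x / y \<in> K"
  by (simp add: divide_inverse subfield_mult subfield_inverse)

lemma subfield_power: "subfield K CC \<Longrightarrow> x \<in> K \<Longrightarrow> x ^ n \<in> K"
  by (induction n) (auto simp: subfield_1 subfield_mult)

lemma subfield_of_nat: "subfield K CC \<Longrightarrow> of_nat n \<in> K"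
  by (induction n) (auto simp: subfield_0 subfield_1 subfield_add)

lemma subfield_of_int: "subfield K CC \<Longrightarrow> of_int n \<in> K"
  by (cases n rule: int_cases2) (auto simp: subfield_of_nat subfield_minus)

lemma subfield_numeral: "subfield K CC \<Longrightarrow> numeral n \<in> K"
  using subfield_of_nat[of K "numeral n"] by simp

lemma subfield_of_rat: "subfield K CC \<Longrightarrow> of_rat q \<in> K"
  by (cases q) (auto simp: of_rat_rat subfield_divide subfield_of_int)

lemmas subfield_closed = subfield_0 subfield_1 subfield_minus subfield_add subfield_mult subfield_diff
  subfield_inverse subfield_divide subfield_power subfield_of_nat subfield_of_int subfield_of_rat subfield_numeral

section \<open>Rational polynomials evaluated at a complex number\<close>

definition rat_eval :: "complex \<Rightarrow> rat poly \<Rightarrow> complex" where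
  "rat_eval x q = poly (map_poly of_rat q) x"

lemma rat_eval_0 [simp]: "rat_eval x 0 = 0"
  by (simp add: rat_eval_def)

lemma rat_eval_pCons [simp]: "rat_eval x (pCons c q) = of_rat c + x * rat_eval x q"
  by (simp add: rat_eval_def of_rat_hom.map_poly_pCons_hom)

lemma rat_eval_1 [simp]: "rat_eval x 1 = 1"
  by (simp add: one_pCons)

lemma rat_eval_add [simp]: "rat_eval x (p + q) = rat_eval x p + rat_eval x q"
  by (induction p q rule: poly_induct2) (auto simp: of_rat_add algebra_simps)

lemma rat_eval_smult [simp]: "rat_eval x (smult c q) = of_rat c * rat_eval x q"
  by (induction q) (auto simp: of_rat_mult algebra_simps)

lemma rat_eval_mult [simp]: "rat_eval x (p * q) = rat_eval x p * rat_eval x q"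
  by (induction p) (auto simp: algebra_simps)

lemma rat_eval_minus [simp]: "rat_eval x (- q) = - rat_eval x q"
  by (induction q) (auto simp: of_rat_minus algebra_simps)

lemma rat_eval_diff [simp]: "rat_eval x (p - q) = rat_eval x p - rat_eval x q"
  by (simp only: diff_conv_add_uminus rat_eval_add rat_eval_minus)

lemma subfield_rat_eval: "subfield K CC \<Longrightarrow> x \<in> K \<Longrightarrow> rat_eval x q \<in> K"
  by (induction q) (auto simp: subfield_closed)

lemma subfield_Q_adjoin: "subfield (Q_adjoin x) CC"
  unfolding Q_adjoin_def by (intro field.generate_field_is_subfield field_from_type_algebra) auto

lemma Q_adjoin_self: "x \<in> Q_adjoin x"
  unfolding Q_adjoin_def by (auto intro: generate_field.incl)

text \<open>A polynomial \<open>q\<close> not divisible by \<open>p\<close> is coprime to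
  \<open>p\<close>, and a Bezout identity evaluated at \<open>x\<close> would read 0 = 1.\<close>

lemma rat_eval_eq_0_iff:
  assumes "Factorial_Ring.irreducible p" "rat_eval x p = 0"
  shows "rat_eval x q = 0 \<longleftrightarrow> p dvd q"
proof
  assume q: "rat_eval x q = 0"
  show "p dvd q"
  proof (rule ccontr)
    assume "\<not> p dvd q"
    then have "Rings.coprime p q"
      using assms(1) by (intro prime_elem_imp_coprime irreducible_imp_prime_elem_gcd)
    then have "fst (bezout_coefficients p q) * p + snd (bezout_coefficients p q) * q = 1"
      using bezout_coefficients_fst_snd[of p q] by simp
    then have "rat_eval x (fst (bezout_coefficients p q) * p + snd (bezout_coefficients p q) * q) = 1"
      by simp
    then show False using q assms(2) by simp
  qed
next
  assume "p dvd q"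
  then show "rat_eval x q = 0" using assms(2) by (auto elim!: dvdE)
qed

text \<open>Only inverses need an argument: a nonzero value of \<open>q\<close> is inverted by the
  Bezout coefficient of \<open>q\<close> in an identity with \<open>p\<close>, evaluated at
  \<open>x\<close>.\<close>

lemma Q_adjoin_eq:
  assumes "Factorial_Ring.irreducible p" "rat_eval x p = 0"
  shows "Q_adjoin x = range (rat_eval x)"
proof
  show "range (rat_eval x) \<subseteq> Q_adjoin x"
    using subfield_rat_eval[OF subfield_Q_adjoin Q_adjoin_self] by auto
  have "z \<in> range (rat_eval x)" if "z \<in> generate_field CC {x}" for z
    using that
  proof induction
    case one
    show ?case by (rule range_eqI[of _ _ 1]) simp
  next
    case (incl h)
    then show ?case by (intro range_eqI[of _ _ "[:0, 1:]"]) simp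
  next
    case (a_inv h)
    then obtain q where "h = rat_eval x q" by auto
    then show ?case by (intro range_eqI[of _ _ "- q"]) simp
  next
    case (m_inv h)
    then obtain q where q: "h = rat_eval x q" by auto
    have "h \<noteq> 0" using m_inv by simp
    then have "\<not> p dvd q" using rat_eval_eq_0_iff[OF assms] q by blast
    then have "Rings.coprime p q"
      using assms(1) by (intro prime_elem_imp_coprime irreducible_imp_prime_elem_gcd)
    then have "fst (bezout_coefficients p q) * p + snd (bezout_coefficients p q) * q = 1"
      using bezout_coefficients_fst_snd[of p q] by simp
    then have "rat_eval x (fst (bezout_coefficients p q) * p + snd (bezout_coefficients p q) * q) = 1"
      by simp
    then have "rat_eval x (snd (bezout_coefficients p q)) * h = 1"
      using q assms(2) by simp
    then have "inverse h = rat_eval x (snd (bezout_coefficients p q))"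
      using \<open>h \<noteq> 0\<close> by (simp add: field_simps)
    then show ?case using \<open>h \<noteq> 0\<close> by simp
  next
    case (eng_add h1 h2)
    then obtain p q where "h1 = rat_eval x p" "h2 = rat_eval x q" by auto
    then show ?case by (intro range_eqI[of _ _ "p + q"]) simp
  next
    case (eng_mult h1 h2)
    then obtain p q where "h1 = rat_eval x p" "h2 = rat_eval x q" by auto
    then show ?case by (intro range_eqI[of _ _ "p * q"]) simp
  qed
  then show "Q_adjoin x \<subseteq> range (rat_eval x)"
    unfolding Q_adjoin_def by blast
qed

section \<open>Embeddings of simple extensions\<close>

lemma embeddingsD:
  assumes "\<sigma> \<in> embeddings K"
  shows "x \<in> K \<Longrightarrow> y \<in> K \<Longrightarrow> \<sigma> (x + y) = \<sigma> x + \<sigma> y"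
    "x \<in> K \<Longrightarrow> y \<in> K \<Longrightarrow> \<sigma> (x * y) = \<sigma> x * \<sigma> y"
    "\<sigma> 1 = 1" "\<sigma> \<in> extensional K"
  using assms by (auto simp: embeddings_def ring_hom_def)

lemma
  assumes "\<sigma> \<in> embeddings K" and K: "subfield K CC"
  shows embedding_0: "\<sigma> 0 = 0"
    and embedding_of_int: "\<sigma> (of_int n) = of_int n"
    and embedding_of_rat: "\<sigma> (of_rat q) = of_rat q"
proof -
  note \<sigma> = embeddingsD[OF assms(1)]
  show 0: "\<sigma> 0 = 0" using \<sigma>(1)[of 0 0] subfield_0[OF K] by simp
  have minus: "\<sigma> (- x) = - \<sigma> x" if "x \<in> K" for x
    using \<sigma>(1)[of x "- x"] that subfield_minus[OF K] 0 by (simp add: eq_neg_iff_add_eq_0 add.commute)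
  have nat: "\<sigma> (of_nat n) = of_nat n" for n
    by (induction n) (auto simp: 0 \<sigma>(1,3) subfield_closed[OF K])
  show int: "\<sigma> (of_int n) = of_int n" for n
    by (cases n rule: int_cases2) (auto simp: nat minus subfield_closed[OF K])
  show "\<sigma> (of_rat q) = of_rat q"
  proof (cases q)
    case (Fract a b)
    have "\<sigma> (of_int b * of_rat q) = of_int b * \<sigma> (of_rat q)"
      using \<sigma>(2)[of "of_int b" "of_rat q"] int subfield_closed[OF K] by simp
    moreover have "of_int b * of_rat q = (of_int a :: complex)"
      using Fract by (simp add: of_rat_rat)
    ultimately have "of_int b * \<sigma> (of_rat q) = of_int a" using int by simp
    then show ?thesis using Fract by (simp add: of_rat_rat field_simps)
  qed
qed

lemma embedding_rat_eval:
  assumes "\<sigma> \<in> embeddings K" "subfield K CC" "x \<in> K"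
  shows "\<sigma> (rat_eval x q) = rat_eval (\<sigma> x) q"
  by (induction q)
    (use assms in \<open>auto simp: embedding_0 embeddingsD(1,2)[OF assms(1)] embedding_of_rat subfield_closed
      subfield_rat_eval\<close>)

lemma embedding_sum:
  assumes "\<sigma> \<in> embeddings K" "subfield K CC" "\<And>i. i \<in> I \<Longrightarrow> f i \<in> K"
  shows "(\<Sum>i\<in>I. f i) \<in> K \<and> \<sigma> (\<Sum>i\<in>I. f i) = (\<Sum>i\<in>I. \<sigma> (f i))"
  using assms(3)
  by (induction I rule: infinite_finite_induct)
    (auto simp: embedding_0[OF assms(1,2)] embeddingsD(1)[OF assms(1)] subfield_closed[OF assms(2)])

lemma algebraic_int_embedding:
  assumes "\<sigma> \<in> embeddings K" "subfield K CC" "x \<in> K" "algebraic_int x"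
  shows "algebraic_int (\<sigma> x)"
proof -
  obtain p where p: "poly (map_poly of_int p) x = 0" "lead_coeff p = 1"
    using assms(4) unfolding algebraic_int_altdef_ipoly by blast
  have eq: "poly (map_poly of_int q) z = rat_eval z (map_poly of_int q)" for q :: "int poly" and z
    by (induction q) (auto simp: map_poly_pCons)
  have "poly (map_poly of_int p) (\<sigma> x) = \<sigma> (poly (map_poly of_int p) x)"
    using embedding_rat_eval[OF assms(1-3)] by (simp add: eq)
  then have "poly (map_poly of_int p) (\<sigma> x) = 0"
    using p embedding_0[OF assms(1,2)] by simp
  then show ?thesis using p(2) algebraic_int_poly by blast
qed

lemma embedding_exists:
  assumes p: "Factorial_Ring.irreducible p" "rat_eval x p = 0" and r: "rat_eval r p = 0"
  obtains \<sigma> where "\<sigma> \<in> embeddings (Q_adjoin x)" "\<sigma> x = r"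
proof -
  \<comment> \<open>The representing polynomial is an arbitrary choice; two choices differ by a
    multiple of \<open>p\<close>, which vanishes at \<open>r\<close> as well. The value
    \<open>undefined\<close> makes the map extensional.\<close>
  define \<sigma> where "\<sigma> z = (if z \<in> Q_adjoin x then rat_eval r (SOME q. rat_eval x q = z) else undefined)" for z
  have \<sigma>: "\<sigma> (rat_eval x q) = rat_eval r q" for q
  proof -
    define q' where "q' = (SOME q'. rat_eval x q' = rat_eval x q)"
    have "rat_eval x q' = rat_eval x q" unfolding q'_def by (rule someI) simp
    then have "p dvd q' - q" using rat_eval_eq_0_iff[OF p, of "q' - q"] by simp
    then have "rat_eval r (q' - q) = 0" using r by (auto elim!: dvdE simp del: rat_eval_diff)
    moreover have "\<sigma> (rat_eval x q) = rat_eval r q'"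
      using subfield_rat_eval[OF subfield_Q_adjoin Q_adjoin_self] by (simp add: \<sigma>_def q'_def)
    ultimately show ?thesis by simp
  qed
  have "\<sigma> \<in> embeddings (Q_adjoin x)"
    unfolding embeddings_def
  proof (intro IntI ring_hom_memI)
    show "\<sigma> \<in> extensional (Q_adjoin x)" by (auto simp: \<sigma>_def extensional_def)
    show "\<sigma> \<one>\<^bsub>sub_CC (Q_adjoin x)\<^esub> = \<one>\<^bsub>CC\<^esub>" using \<sigma>[of 1] by simp
    fix y z assume "y \<in> carrier (sub_CC (Q_adjoin x))" "z \<in> carrier (sub_CC (Q_adjoin x))"
    then obtain q1 q2 where "y = rat_eval x q1" "z = rat_eval x q2"
      unfolding Q_adjoin_eq[OF p] by auto
    then show "\<sigma> (y \<otimes>\<^bsub>sub_CC (Q_adjoin x)\<^esub> z) = \<sigma> y \<otimes>\<^bsub>CC\<^esub> \<sigma> z"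
      "\<sigma> (y \<oplus>\<^bsub>sub_CC (Q_adjoin x)\<^esub> z) = \<sigma> y \<oplus>\<^bsub>CC\<^esub> \<sigma> z"
      using \<sigma>[of "q1 * q2"] \<sigma>[of "q1 + q2"] by (auto simp: \<sigma>)
  qed auto
  moreover have "\<sigma> x = r" using \<sigma>[of "[:0, 1:]"] by simp
  ultimately show thesis using that by blast
qed

text \<open>An embedding is determined by its value at \<open>x\<close>, which must be a root of
  \<open>p\<close>. The order of the roots is prescribed so that the rows of the determinants below
  become explicit.\<close>

lemma embeddings_Q_adjoin:
  assumes p: "Factorial_Ring.irreducible p" "rat_eval x p = 0"
    and rs: "distinct rs" "set rs = {r. rat_eval r p = 0}"
  obtains \<sigma>s where "distinct \<sigma>s" "set \<sigma>s = embeddings (Q_adjoin x)" "map (\<lambda>\<sigma>. \<sigma> x) \<sigma>s = rs"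
proof -
  define g where "g r = (SOME \<sigma>. \<sigma> \<in> embeddings (Q_adjoin x) \<and> \<sigma> x = r)" for r
  have g: "g r \<in> embeddings (Q_adjoin x)" "g r x = r" if "r \<in> set rs" for r
  proof -
    have "\<exists>\<sigma>. \<sigma> \<in> embeddings (Q_adjoin x) \<and> \<sigma> x = r"
      using embedding_exists[OF p, of r] that rs(2) by blast
    then have "g r \<in> embeddings (Q_adjoin x) \<and> g r x = r"
      unfolding g_def by (rule someI_ex)
    then show "g r \<in> embeddings (Q_adjoin x)" "g r x = r" by auto
  qed
  have "\<sigma> \<in> g ` set rs" if \<sigma>: "\<sigma> \<in> embeddings (Q_adjoin x)" for \<sigma>
  proof -
    note eval = embedding_rat_eval[OF _ subfield_Q_adjoin Q_adjoin_self]
    have "rat_eval (\<sigma> x) p = 0"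
      using eval[OF \<sigma>, of p] p(2) embedding_0[OF \<sigma> subfield_Q_adjoin] by simp
    then have r: "\<sigma> x \<in> set rs" using rs(2) by simp
    have "\<sigma> = g (\<sigma> x)"
    proof (rule extensionalityI[OF embeddingsD(4)[OF \<sigma>] embeddingsD(4)[OF g(1)[OF r]]])
      fix z assume "z \<in> Q_adjoin x"
      then obtain q where "z = rat_eval x q" unfolding Q_adjoin_eq[OF p] by auto
      then show "\<sigma> z = g (\<sigma> x) z" using eval[OF \<sigma>] eval[OF g(1)[OF r]] g(2)[OF r] by simp
    qed
    then show ?thesis using r by blast
  qed
  moreover have "inj_on g (set rs)" using g(2) by (metis inj_onI)
  moreover have "map (\<lambda>\<sigma>. \<sigma> x) (map g rs) = rs" using g(2) by (auto intro: map_idI)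
  ultimately show thesis
    using g(1) rs(1) by (intro that[of "map g rs"]) (auto simp: distinct_map)
qed

text \<open>A proper factorisation in degree 2 or 3 has a linear factor and with it a rational
  root.\<close>

lemma irreducible_if_no_root:
  fixes p :: "rat poly"
  assumes "degree p \<ge> 1" "degree p \<le> 3" "degree p > 1 \<Longrightarrow> \<forall>x. poly p x \<noteq> 0"
  shows "Factorial_Ring.irreducible p"
proof (rule Factorial_Ring.irreducibleI)
  show "p \<noteq> 0" "\<not> p dvd 1" using assms(1) by (auto simp: is_unit_iff_degree)
  fix a b assume ab: "p = a * b"
  have nz: "a \<noteq> 0" "b \<noteq> 0" using ab assms(1) by auto
  have root: "\<exists>x. poly p x = 0" if deg: "degree c = 1" and dvd: "c dvd p" for c
  proof -
    obtain k l where "c = [:k, l:]" "l \<noteq> 0"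
      using degree1_coeffs[OF deg] by metis
    then have "poly c (- k / l) = 0" by simp
    then show ?thesis using dvd by (meson dvd_trans poly_eq_0_iff_dvd)
  qed
  have deg: "degree p = degree a + degree b" using ab nz by (simp add: degree_mult_eq)
  show "a dvd 1 \<or> b dvd 1"
  proof (rule ccontr)
    assume "\<not> (a dvd 1 \<or> b dvd 1)"
    then have "degree a > 0" "degree b > 0" using nz by (auto simp: is_unit_iff_degree)
    then have "degree a = 1 \<or> degree b = 1" "degree p > 1" using deg assms(2) by auto
    then show False using root[of a] root[of b] assms(3) ab by auto
  qed
qed

section \<open>Discriminants\<close>

lemma carrier_ring_of_integers [simp]: "carrier (\<O> K) = {x \<in> K. algebraic_int x}"
  by (simp add: ring_of_integers_def)

lemma int_sum_in_integers:
  assumes "subfield K CC" "\<And>i. i \<in> I \<Longrightarrow> w i \<in> K \<and> algebraic_int (w i)"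
  shows "(\<Sum>i\<in>I. of_int (c i) * w i) \<in> K \<and> algebraic_int (\<Sum>i\<in>I. of_int (c i) * w i)"
  using assms(2)
  by (induction I rule: infinite_finite_induct) (auto simp: subfield_closed[OF assms(1)])

lemma integral_basisI:
  assumes K: "subfield K CC"
    and ws: "\<And>i. i < length ws \<Longrightarrow> ws ! i \<in> K \<and> algebraic_int (ws ! i)"
    and gen: "\<And>z. z \<in> K \<Longrightarrow> algebraic_int z \<Longrightarrow> \<exists>c::nat \<Rightarrow> int. z = (\<Sum>i<length ws. of_int (c i) * ws ! i)"
    and indep: "\<And>(c::nat \<Rightarrow> int) i. (\<Sum>i<length ws. of_int (c i) * ws ! i) = 0 \<Longrightarrow> i < length ws \<Longrightarrow> c i = 0"
  shows "integral_basis K ws"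
  unfolding integral_basis_def
proof (intro bij_betwI')
  fix c c' :: "nat \<Rightarrow> int"
  assume c: "c \<in> {..<length ws} \<rightarrow>\<^sub>E UNIV" "c' \<in> {..<length ws} \<rightarrow>\<^sub>E UNIV"
  show "((\<Sum>i<length ws. of_int (c i) * ws ! i) = (\<Sum>i<length ws. of_int (c' i) * ws ! i)) = (c = c')"
  proof
    assume "(\<Sum>i<length ws. of_int (c i) * ws ! i) = (\<Sum>i<length ws. of_int (c' i) * ws ! i)"
    then have "(\<Sum>i<length ws. of_int (c i - c' i) * ws ! i) = 0"
      by (simp add: left_diff_distrib sum_subtractf)
    then have "c i = c' i" if "i < length ws" for i using indep[of "\<lambda>i. c i - c' i" i] that by auto
    then show "c = c'" using c by (intro PiE_ext) auto
  qed auto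
next
  fix c :: "nat \<Rightarrow> int"
  show "(\<Sum>i<length ws. of_int (c i) * ws ! i) \<in> carrier (\<O> K)"
    using int_sum_in_integers[OF K, of "{..<length ws}" "\<lambda>i. ws ! i" c] ws by auto
next
  fix z assume "z \<in> carrier (\<O> K)"
  then obtain c :: "nat \<Rightarrow> int" where "z = (\<Sum>i<length ws. of_int (c i) * ws ! i)" using gen by auto
  then show "\<exists>c\<in>{..<length ws} \<rightarrow>\<^sub>E (UNIV :: int set). z = (\<Sum>i<length ws. of_int (c i) * ws ! i)"
    by (intro bexI[of _ "restrict c {..<length ws}"]) auto
qed

lemma
  assumes "integral_basis K ws"
  shows integral_basis_span: "z \<in> K \<Longrightarrow> algebraic_int z \<Longrightarrow> \<exists>c::nat \<Rightarrow> int. z = (\<Sum>i<length ws. of_int (c i) * ws ! i)"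
    and integral_basis_nth: "i < length ws \<Longrightarrow> ws ! i \<in> K \<and> algebraic_int (ws ! i)"
    and integral_basis_unique: "(\<Sum>i<length ws. of_int (c i) * ws ! i) = (\<Sum>i<length ws. of_int (c' i) * ws ! i) \<Longrightarrow>
      i < length ws \<Longrightarrow> c i = (c' i :: int)"
proof -
  let ?I = "{..<length ws}"
  note bij = assms[unfolded integral_basis_def]
  show "\<exists>c::nat \<Rightarrow> int. z = (\<Sum>i<length ws. of_int (c i) * ws ! i)" if "z \<in> K" "algebraic_int z"
  proof -
    have "z \<in> (\<lambda>c. \<Sum>i<length ws. of_int (c i) * ws ! i) ` ({..<length ws} \<rightarrow>\<^sub>E (UNIV :: int set))"
      using that bij_betw_imp_surj_on[OF bij] by simp
    then show ?thesis by auto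
  qed
  show "ws ! i \<in> K \<and> algebraic_int (ws ! i)" if "i < length ws"
  proof -
    have "(\<Sum>j<length ws. of_int (restrict (\<lambda>j. if j = i then 1 else 0) ?I j) * ws ! j) \<in> carrier (\<O> K)"
      by (rule bij_betw_apply[OF bij]) auto
    also have "(\<Sum>j<length ws. of_int (restrict (\<lambda>j. if j = i then 1 else 0) ?I j) * ws ! j)
        = (\<Sum>j<length ws. if j = i then ws ! j else 0)"
      by (intro sum.cong) auto
    also have "\<dots> = ws ! i" using that by simp
    finally show ?thesis by simp
  qed
  show "c i = c' i"
    if eq: "(\<Sum>i<length ws. of_int (c i) * ws ! i) = (\<Sum>i<length ws. of_int (c' i) * ws ! i)" and "i < length ws"
  proof -
    have "restrict c ?I = restrict c' ?I"
      using eq by (intro inj_onD[OF bij_betw_imp_inj_on[OF bij]]) auto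
    then show ?thesis using that by (metis lessThan_iff restrict_apply')
  qed
qed

lemma integral_basis_change:
  assumes "integral_basis K ws" "integral_basis K ws'"
  obtains A :: "nat \<Rightarrow> nat \<Rightarrow> int"
    where "\<And>j. j < length ws' \<Longrightarrow> ws' ! j = (\<Sum>i<length ws. of_int (A i j) * ws ! i)"
proof -
  have "\<forall>j. \<exists>c::nat \<Rightarrow> int. j < length ws' \<longrightarrow> ws' ! j = (\<Sum>i<length ws. of_int (c i) * ws ! i)"
    using integral_basis_span[OF assms(1)] integral_basis_nth[OF assms(2)] by blast
  then obtain f :: "nat \<Rightarrow> nat \<Rightarrow> int"
    where "\<And>j. j < length ws' \<Longrightarrow> ws' ! j = (\<Sum>i<length ws. of_int (f j i) * ws ! i)" by metis
  then show thesis using that[of "\<lambda>i j. f j i"] by blast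
qed

text \<open>Substituting one expansion into the other writes \<open>ws' ! j\<close> in terms of
  \<open>ws'\<close> itself, and uniqueness of coordinates identifies the coefficients.\<close>

lemma integral_basis_change_inverse:
  assumes ws': "integral_basis K ws'"
    and A: "\<And>j. j < length ws' \<Longrightarrow> ws' ! j = (\<Sum>i<length ws. of_int (A i j) * ws ! i)"
    and B: "\<And>i. i < length ws \<Longrightarrow> ws ! i = (\<Sum>k<length ws'. of_int (B k i) * ws' ! k)"
    and "k < length ws'" "j < length ws'"
  shows "(\<Sum>i<length ws. B k i * A i j) = (if k = j then 1 else 0 :: int)"
proof -
  have "(\<Sum>k<length ws'. of_int (\<Sum>i<length ws. B k i * A i j) * ws' ! k)
      = (\<Sum>i<length ws. of_int (A i j) * (\<Sum>k<length ws'. of_int (B k i) * ws' ! k))"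
    by (simp add: sum_distrib_left sum_distrib_right mult_ac) (rule sum.swap)
  also have "\<dots> = ws' ! j" using A[OF \<open>j < _\<close>] B by simp
  also have "\<dots> = (\<Sum>k<length ws'. if k = j then ws' ! k else 0)" using \<open>j < _\<close> by simp
  also have "\<dots> = (\<Sum>k<length ws'. of_int (if k = j then 1 else 0) * ws' ! k)"
    by (intro sum.cong) auto
  finally have eq: "(\<Sum>k<length ws'. of_int (\<Sum>i<length ws. B k i * A i j) * ws' ! k)
      = (\<Sum>k<length ws'. of_int (if k = j then 1 else 0) * ws' ! k)" .
  show ?thesis by (rule integral_basis_unique[OF ws' eq \<open>k < _\<close>])
qed

text \<open>The two base change matrices are mutually inverse, so comparing traces gives equal size.\<close>

lemma integral_basis_length_unique:
  assumes ws: "integral_basis K ws" and ws': "integral_basis K ws'"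
  shows "length ws = length ws'"
proof -
  obtain A :: "nat \<Rightarrow> nat \<Rightarrow> int"
    where A: "\<And>j. j < length ws' \<Longrightarrow> ws' ! j = (\<Sum>i<length ws. of_int (A i j) * ws ! i)"
    using integral_basis_change[OF ws ws'] by blast
  obtain B :: "nat \<Rightarrow> nat \<Rightarrow> int"
    where B: "\<And>i. i < length ws \<Longrightarrow> ws ! i = (\<Sum>k<length ws'. of_int (B k i) * ws' ! k)"
    using integral_basis_change[OF ws' ws] by blast
  have "int (length ws') = (\<Sum>k<length ws'. \<Sum>i<length ws. B k i * A i k)"
    using integral_basis_change_inverse[OF ws' A B] by simp
  also have "\<dots> = (\<Sum>i<length ws. \<Sum>k<length ws'. A i k * B k i)"
    by (subst sum.swap) (simp add: mult.commute)
  also have "\<dots> = int (length ws)"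
    using integral_basis_change_inverse[OF ws B A] by simp
  finally show ?thesis by simp
qed

definition embedding_mat :: "(complex \<Rightarrow> complex) list \<Rightarrow> complex list \<Rightarrow> complex mat" where
  "embedding_mat \<sigma>s ws = mat (length \<sigma>s) (length ws) (\<lambda>(i, j). (\<sigma>s ! i) (ws ! j))"

text \<open>The Gram matrix does not depend on the order of the embeddings.\<close>

lemma det_embedding_mat_sq:
  assumes "distinct \<sigma>s" "length \<sigma>s = length ws"
  shows "(det (embedding_mat \<sigma>s ws))\<^sup>2 =
    det (mat (length ws) (length ws) (\<lambda>(i, j). \<Sum>\<sigma>\<in>set \<sigma>s. \<sigma> (ws ! i) * \<sigma> (ws ! j)))"
proof -
  let ?W = "embedding_mat \<sigma>s ws" and ?n = "length ws"
  have W: "?W \<in> carrier_mat ?n ?n" using assms(2) by (simp add: embedding_mat_def)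
  have "(det ?W)\<^sup>2 = det (transpose_mat ?W) * det ?W"
    using det_transpose[OF W] by (simp add: power2_eq_square)
  also have "\<dots> = det (transpose_mat ?W * ?W)"
    using W by (intro det_mult[symmetric, of _ ?n]) auto
  also have "transpose_mat ?W * ?W = mat ?n ?n (\<lambda>(i, j). \<Sum>\<sigma>\<in>set \<sigma>s. \<sigma> (ws ! i) * \<sigma> (ws ! j))"
  proof (rule eq_matI)
    fix i j assume "i < dim_row (mat ?n ?n (\<lambda>(i, j). \<Sum>\<sigma>\<in>set \<sigma>s. \<sigma> (ws ! i) * \<sigma> (ws ! j)))"
      "j < dim_col (mat ?n ?n (\<lambda>(i, j). \<Sum>\<sigma>\<in>set \<sigma>s. \<sigma> (ws ! i) * \<sigma> (ws ! j)))"
    then have ij: "i < ?n" "j < ?n" by auto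
    have "(transpose_mat ?W * ?W) $$ (i, j) = (\<Sum>k<length \<sigma>s. (\<sigma>s ! k) (ws ! i) * (\<sigma>s ! k) (ws ! j))"
      using ij assms(2) by (simp add: embedding_mat_def scalar_prod_def atLeast0LessThan)
    also have "\<dots> = (\<Sum>\<sigma>\<in>set \<sigma>s. \<sigma> (ws ! i) * \<sigma> (ws ! j))"
      by (rule sum.reindex_bij_betw[OF bij_betw_nth[OF assms(1) refl refl]])
    finally show "(transpose_mat ?W * ?W) $$ (i, j)
      = mat ?n ?n (\<lambda>(i, j). \<Sum>\<sigma>\<in>set \<sigma>s. \<sigma> (ws ! i) * \<sigma> (ws ! j)) $$ (i, j)" using ij by simp
  qed (auto simp: embedding_mat_def)
  finally show ?thesis .
qed

text \<open>The base change matrix and its inverse are both integral, so its determinant is 1 or -1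
  and drops out on squaring.\<close>

lemma det_embedding_mat_sq_basis_change:
  assumes K: "subfield K CC" and ws: "integral_basis K ws" and ws': "integral_basis K ws'"
    and \<sigma>s: "set \<sigma>s = embeddings K" "length \<sigma>s = length ws"
  shows "(det (embedding_mat \<sigma>s ws))\<^sup>2 = (det (embedding_mat \<sigma>s ws'))\<^sup>2"
proof -
  let ?n = "length ws"
  have n: "length ws' = ?n" using integral_basis_length_unique[OF ws ws'] by simp
  obtain A :: "nat \<Rightarrow> nat \<Rightarrow> int"
    where A: "\<And>j. j < length ws' \<Longrightarrow> ws' ! j = (\<Sum>i<length ws. of_int (A i j) * ws ! i)"
    using integral_basis_change[OF ws ws'] by blast
  obtain B :: "nat \<Rightarrow> nat \<Rightarrow> int"
    where B: "\<And>i. i < length ws \<Longrightarrow> ws ! i = (\<Sum>k<length ws'. of_int (B k i) * ws' ! k)"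
    using integral_basis_change[OF ws' ws] by blast
  define MA where "MA = mat ?n ?n (\<lambda>(i, j). A i j)"
  define MB where "MB = mat ?n ?n (\<lambda>(i, j). B i j)"
  have MA: "MA \<in> carrier_mat ?n ?n" and MB: "MB \<in> carrier_mat ?n ?n" by (auto simp: MA_def MB_def)
  have "MB * MA = 1\<^sub>m ?n"
    by (rule eq_matI)
      (use n integral_basis_change_inverse[OF ws' A B] in
        \<open>auto simp: MA_def MB_def scalar_prod_def atLeast0LessThan\<close>)
  then have "det MB * det MA = 1" using det_mult[OF MB MA] by simp
  then have "(det MA)\<^sup>2 = 1"
    using zmult_eq_1_iff[of "det MB" "det MA"] by auto
  moreover have "embedding_mat \<sigma>s ws' = embedding_mat \<sigma>s ws * map_mat of_int MA"
  proof (rule eq_matI)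
    fix i j assume "i < dim_row (embedding_mat \<sigma>s ws * map_mat of_int MA)"
      "j < dim_col (embedding_mat \<sigma>s ws * map_mat of_int MA)"
    then have ij: "i < ?n" "j < ?n" using \<sigma>s by (auto simp: embedding_mat_def MA_def)
    have \<sigma>: "\<sigma>s ! i \<in> embeddings K" using \<sigma>s ij by (metis nth_mem)
    have mem: "of_int (A k j) * ws ! k \<in> K" if "k \<in> {..<?n}" for k
      using integral_basis_nth[OF ws] that K by (auto simp: subfield_closed)
    have "(\<sigma>s ! i) (ws' ! j) = (\<Sum>k<?n. (\<sigma>s ! i) (of_int (A k j) * ws ! k))"
      using A[of j] ij n embedding_sum[OF \<sigma> K, of "{..<?n}" "\<lambda>k. of_int (A k j) * ws ! k"] mem by simp
    also have "\<dots> = (\<Sum>k<?n. (\<sigma>s ! i) (ws ! k) * of_int (A k j))"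
      using integral_basis_nth[OF ws]
      by (intro sum.cong refl)
        (auto simp: embeddingsD(2)[OF \<sigma>] embedding_of_int[OF \<sigma> K] subfield_closed[OF K] mult.commute)
    finally show "embedding_mat \<sigma>s ws' $$ (i, j) = (embedding_mat \<sigma>s ws * map_mat of_int MA) $$ (i, j)"
      using ij n \<sigma>s by (simp add: embedding_mat_def MA_def scalar_prod_def atLeast0LessThan)
  qed (use n in \<open>auto simp: embedding_mat_def MA_def\<close>)
  moreover have "det (embedding_mat \<sigma>s ws * map_mat of_int MA) = det (embedding_mat \<sigma>s ws) * det (map_mat of_int MA)"
    using \<sigma>s MA by (intro det_mult[of _ ?n]) (auto simp: embedding_mat_def)
  moreover have "det (map_mat of_int MA :: complex mat) = of_int (det MA)"
    by (rule of_int_hom.hom_det)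
  ultimately show ?thesis
    by (metis mult.right_neutral of_int_1 of_int_power power_mult_distrib)
qed

text \<open>This justifies the definite description: a competing value comes from another basis,
  which base change replaces by \<open>ws\<close>, and from another list of the same embeddings, on
  which the Gram determinant does not depend.\<close>

lemma field_discriminant_eqI:
  assumes K: "subfield K CC" and ws: "integral_basis K ws"
    and \<sigma>s: "distinct \<sigma>s" "set \<sigma>s = embeddings K" "length \<sigma>s = length ws"
    and D: "of_int D = (det (embedding_mat \<sigma>s ws))\<^sup>2"
  shows "field_discriminant K = D"
  unfolding field_discriminant_def embedding_mat_def[symmetric]
proof (rule the_equality)
  show "\<exists>ws \<sigma>s. integral_basis K ws \<and> distinct \<sigma>s \<and> set \<sigma>s = embeddings K \<and>
      of_int D = (det (embedding_mat \<sigma>s ws))\<^sup>2"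
    using assms by blast
  fix D'
  assume "\<exists>ws \<sigma>s. integral_basis K ws \<and> distinct \<sigma>s \<and> set \<sigma>s = embeddings K \<and>
      of_int D' = (det (embedding_mat \<sigma>s ws))\<^sup>2"
  then obtain ws' \<sigma>s' where ws': "integral_basis K ws'" and \<sigma>s': "distinct \<sigma>s'" "set \<sigma>s' = embeddings K"
    and D': "of_int D' = (det (embedding_mat \<sigma>s' ws'))\<^sup>2" by blast
  have n: "length ws = length ws'" by (rule integral_basis_length_unique[OF ws ws'])
  have m: "length \<sigma>s = length \<sigma>s'" using \<sigma>s \<sigma>s' by (metis distinct_card)
  have "(of_int D' :: complex) = (det (embedding_mat \<sigma>s' ws))\<^sup>2"
    using D' det_embedding_mat_sq_basis_change[OF K ws ws' \<sigma>s'(2)] m \<sigma>s(3) by simp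
  also have "\<dots> = (det (embedding_mat \<sigma>s ws))\<^sup>2"
    using det_embedding_mat_sq[OF \<sigma>s(1), of ws] det_embedding_mat_sq[OF \<sigma>s'(1), of ws] m \<sigma>s \<sigma>s'(2) by simp
  also have "\<dots> = of_int D" using D by simp
  finally show "D' = D" by simp
qed

lemma det_mat_2:
  "det (mat 2 2 f) = f (0, 0) * f (1, 1) - f (0, 1) * (f (1, 0) :: 'a :: comm_ring_1)"
proof -
  have "mat_delete (mat 2 2 f) 0 0 = mat 1 1 (\<lambda>_. f (1, 1))" "mat_delete (mat 2 2 f) 0 1 = mat 1 1 (\<lambda>_. f (1, 0))"
    by (auto simp: mat_delete_def)
  then show ?thesis
    using laplace_expansion_row[of "mat 2 2 f" 2 0]
    by (simp add: numeral_2_eq_2 lessThan_Suc cofactor_def det_single)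
qed

lemma det_mat_3:
  "det (mat 3 3 f) = f (0, 0) * (f (1, 1) * f (2, 2) - f (1, 2) * f (2, 1))
     - f (0, 1) * (f (1, 0) * f (2, 2) - f (1, 2) * f (2, 0))
     + f (0, 2) * (f (1, 0) * f (2, 1) - f (1, 1) * (f (2, 0) :: 'a :: comm_ring_1))"
proof -
  have *: "mat_delete (mat 3 3 f) 0 0 = mat 2 2 (\<lambda>(i, j). f (i + 1, j + 1))"
    "mat_delete (mat 3 3 f) 0 1 = mat 2 2 (\<lambda>(i, j). f (i + 1, if j = 0 then 0 else 2))"
    "mat_delete (mat 3 3 f) 0 2 = mat 2 2 (\<lambda>(i, j). f (i + 1, j))"
    by (auto simp: mat_delete_def less_Suc_eq numeral_2_eq_2 numeral_3_eq_3 intro!: eq_matI)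
  have "{..<3::nat} = {0, 1, 2}" by auto
  then have "det (mat 3 3 f) = f (0, 0) * det (mat_delete (mat 3 3 f) 0 0)
      - f (0, 1) * det (mat_delete (mat 3 3 f) 0 1) + f (0, 2) * det (mat_delete (mat 3 3 f) 0 2)"
    using laplace_expansion_row[of "mat 3 3 f" 3 0] by (simp add: cofactor_def)
  then show ?thesis unfolding * det_mat_2 by (simp add: numeral_2_eq_2 algebra_simps)
qed

section \<open>Quadratic fields\<close>

text \<open>If \<open>x = a / b\<close> in lowest terms, then \<open>b ^ 2\<close> divides
  \<open>m\<close>, so \<open>b\<close> is a unit.\<close>

lemma rat_sq_times_squarefree:
  fixes m n :: int and x :: rat
  assumes "squarefree m" "x\<^sup>2 * of_int m = of_int n"
  obtains k where "x = of_int k"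
proof -
  obtain a b where ab: "x = Rat.Fract a b" "b > 0" "Rings.coprime a b" by (cases x) auto
  then have x: "x = of_int a / of_int b" by (simp add: Fract_of_int_quotient)
  have "(of_int (a\<^sup>2 * m) :: rat) = of_int (n * b\<^sup>2)"
    using assms(2) ab by (simp add: x field_simps power_divide)
  then have "a\<^sup>2 * m = n * b\<^sup>2" by (simp only: of_int_eq_iff)
  then have "b\<^sup>2 dvd a\<^sup>2 * m" by simp
  moreover have "Rings.coprime (b\<^sup>2) (a\<^sup>2)" using ab by (simp add: coprime_commute)
  ultimately have "b\<^sup>2 dvd m" by (simp add: coprime_dvd_mult_right_iff)
  then have "b dvd 1" using squarefreeD[OF assms(1)] by blast
  then have "b = 1" using ab by simp
  then show thesis using that[of a] x by simp
qed

text \<open>The root is an argument because the conjugate of the generator is the same expression at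
  \<open>- s\<close>.\<close>

definition quadratic_generator :: "int \<Rightarrow> complex \<Rightarrow> complex" where
  "quadratic_generator m s = (if m mod 4 = 1 then (1 + s) / 2 else s)"

text \<open>The sign of \<open>m\<close> is free, so that the locale serves both
  \<open>Q(sqrt d)\<close> and the imaginary field \<open>F\<close>. Among squarefree integers, 1 is
  the only square.\<close>

locale quadratic_field =
  fixes m :: int and s :: complex
  assumes squarefree: "squarefree m" and neq_1: "m \<noteq> 1" and s_sq: "s\<^sup>2 = of_int m"
begin

abbreviation "K \<equiv> Q_adjoin s"
abbreviation "\<rho> \<equiv> quadratic_generator m s"

lemma no_rat_sqrt: "(x::rat)\<^sup>2 \<noteq> of_int m"
proof
  assume x: "x\<^sup>2 = of_int m"
  then obtain k where k: "x = of_int k"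
    using rat_sq_times_squarefree[of 1 x m] by auto
  then have "(of_int (k\<^sup>2) :: rat) = of_int m" using x by simp
  then have "k\<^sup>2 = m" by (simp only: of_int_eq_iff)
  then have "k dvd 1" using squarefreeD[OF squarefree, of k] by simp
  then have "k\<^sup>2 = 1" by (simp add: power2_eq_1_iff abs_if split: if_splits)
  then show False using \<open>k\<^sup>2 = m\<close> neq_1 by simp
qed

lemma irreducible: "Factorial_Ring.irreducible [:- of_int m, 0, 1 :: rat:]"
  using no_rat_sqrt by (intro irreducible_if_no_root) (auto simp: power2_eq_square algebra_simps)

lemma rat_eval_minpoly: "rat_eval s [:- of_int m, 0, 1:] = 0"
  using s_sq by (simp add: power2_eq_square of_rat_minus)

lemma K_subfield: "subfield K CC"
  by (rule subfield_Q_adjoin)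

lemma s_in_K: "s \<in> K"
  by (rule Q_adjoin_self)

lemma K_eq: "K = {of_rat p + of_rat q * s | p q. True}"
proof -
  have "\<exists>p q. rat_eval s r = of_rat p + of_rat q * s" for r
  proof (induction r)
    case 0
    show ?case by (intro exI[of _ 0]) simp
  next
    case (pCons c r)
    then obtain p q where "rat_eval s r = of_rat p + of_rat q * s" by blast
    then have "rat_eval s (pCons c r) = of_rat c + of_rat p * s + of_rat q * s\<^sup>2"
      by (simp add: power2_eq_square algebra_simps)
    then show ?case
      by (intro exI[of _ "c + q * of_int m"] exI[of _ p]) (simp add: s_sq of_rat_add of_rat_mult)
  qed
  moreover have "of_rat p + of_rat q * s \<in> K" for p q
    by (intro subfield_closed K_subfield s_in_K)
  ultimately show ?thesis
    using Q_adjoin_eq[OF irreducible rat_eval_minpoly] by (auto simp: image_iff)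
qed

lemma K_cases:
  assumes "z \<in> K"
  obtains p q where "z = of_rat p + of_rat q * s"
  using assms K_eq by auto

lemma rat_coeffs_eq_0:
  assumes "of_rat p + of_rat q * s = 0"
  shows "p = 0" "q = 0"
proof -
  have "[:- of_int m, 0, 1:] dvd [:p, q:]"
    using rat_eval_eq_0_iff[OF irreducible rat_eval_minpoly, of "[:p, q:]"] assms by (simp add: mult.commute)
  then have "[:p, q:] = 0"
    using dvd_imp_degree_le[of "[:- of_int m, 0, 1:]" "[:p, q:]"] by (cases "[:p, q:] = 0") (auto split: if_splits)
  then show "p = 0" "q = 0" by auto
qed

lemma conj_embedding:
  obtains \<sigma> where "\<sigma> \<in> embeddings K" "\<And>p q. \<sigma> (of_rat p + of_rat q * s) = of_rat p - of_rat q * s"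
proof -
  obtain \<sigma> where \<sigma>: "\<sigma> \<in> embeddings K" "\<sigma> s = - s"
    using embedding_exists[OF irreducible rat_eval_minpoly, of "- s"] s_sq
    by (auto simp: power2_eq_square of_rat_minus)
  have "\<sigma> (of_rat p + of_rat q * s) = of_rat p - of_rat q * s" for p q
    using \<sigma> s_in_K
    by (simp add: embeddingsD[OF \<sigma>(1)] embedding_of_rat[OF \<sigma>(1) K_subfield] subfield_closed[OF K_subfield])
  then show thesis using \<sigma> that by blast
qed

lemma algebraic_int_conj:
  assumes "algebraic_int (of_rat p + of_rat q * s)"
  shows "algebraic_int (of_rat p - of_rat q * s)"
proof -
  obtain \<sigma> where \<sigma>: "\<sigma> \<in> embeddings K" "\<And>p q. \<sigma> (of_rat p + of_rat q * s) = of_rat p - of_rat q * s"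
    using conj_embedding by blast
  have "of_rat p + of_rat q * s \<in> K" using K_eq by auto
  then show ?thesis using algebraic_int_embedding[OF \<sigma>(1) K_subfield _ assms] \<sigma>(2) by simp
qed

lemma algebraic_int_s: "algebraic_int s"
  by (rule algebraic_int_of_power[of _ 2]) (auto simp: s_sq)

lemma algebraic_int_generator: "algebraic_int \<rho>"
proof (cases "m mod 4 = 1")
  case True
  define k where "k = m div 4"
  have m: "m = 4 * k + 1" using True unfolding k_def by presburger
  have "((1 + s) / 2)\<^sup>2 - (1 + s) / 2 - of_int k = (s\<^sup>2 - of_int (4 * k + 1)) / 4"
    by (simp add: power2_eq_square field_simps)
  also have "\<dots> = 0" using s_sq m by simp
  finally have "poly (map_poly of_int [:- k, - 1, 1:]) ((1 + s) / 2) = 0"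
    by (simp add: power2_eq_square algebra_simps)
  then have "algebraic_int ((1 + s) / 2)" by (rule algebraic_int_poly) simp
  then show ?thesis using True by (simp add: quadratic_generator_def)
qed (auto simp: quadratic_generator_def algebraic_int_s)

lemma generator_in_K: "\<rho> \<in> K"
  by (auto simp: quadratic_generator_def intro!: subfield_closed K_subfield s_in_K)

text \<open>The trace \<open>2 * p\<close> and the norm \<open>p ^ 2 - q ^ 2 * m\<close> are
  rational algebraic integers, hence integers. Then \<open>(2 * q) ^ 2 * m\<close> is an integer,
  and squarefreeness of \<open>m\<close> rules out a denominator in \<open>2 * q\<close>.\<close>

lemma algebraic_int_half_coeffs:
  assumes "algebraic_int (of_rat p + of_rat q * s)"
  obtains A B N :: int where "2 * p = of_int A" "2 * q = of_int B" "A\<^sup>2 - m * B\<^sup>2 = 4 * N"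
proof -
  note conj = algebraic_int_conj[OF assms]
  have "algebraic_int (of_rat (2 * p) :: complex)"
    using algebraic_int_add[OF assms conj] by (simp add: of_rat_mult)
  then obtain A where A: "2 * p = of_int A" by (rule algebraic_int_rat)
  have "(of_rat p + of_rat q * s) * (of_rat p - of_rat q * s) = of_rat (p\<^sup>2) - of_rat (q\<^sup>2) * s\<^sup>2"
    by (simp add: power2_eq_square algebra_simps of_rat_mult)
  also have "\<dots> = of_rat (p\<^sup>2 - q\<^sup>2 * of_int m)"
    by (simp add: s_sq of_rat_diff of_rat_mult)
  finally have eq: "(of_rat p + of_rat q * s) * (of_rat p - of_rat q * s) = of_rat (p\<^sup>2 - q\<^sup>2 * of_int m)" .
  have "algebraic_int (of_rat (p\<^sup>2 - q\<^sup>2 * of_int m) :: complex)"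
    using algebraic_int_mult[OF assms conj] unfolding eq .
  then obtain N where N: "p\<^sup>2 - q\<^sup>2 * of_int m = of_int N" by (rule algebraic_int_rat)
  have pA: "p = of_int A / 2" using A by simp
  have "(2 * q)\<^sup>2 * of_int m = 4 * (p\<^sup>2 - of_int N)"
    using N by (simp add: power_mult_distrib algebra_simps)
  also have "\<dots> = of_int (A\<^sup>2 - 4 * N)" unfolding pA by (simp add: power_divide)
  finally have "(2 * q)\<^sup>2 * of_int m = of_int (A\<^sup>2 - 4 * N)" .
  then obtain B where B: "2 * q = of_int B"
    using rat_sq_times_squarefree[OF squarefree] by blast
  have "(of_int (B\<^sup>2 * m) :: rat) = of_int (A\<^sup>2 - 4 * N)"
    using \<open>(2 * q)\<^sup>2 * of_int m = of_int (A\<^sup>2 - 4 * N)\<close> B by simp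
  then have "B\<^sup>2 * m = A\<^sup>2 - 4 * N" by (simp only: of_int_eq_iff)
  then show thesis using that[OF A B, of N] by (simp add: mult.commute)
qed

text \<open>With \<open>z = (A + B * s) / 2\<close>, the condition that 4 divides
  \<open>A ^ 2 - m * B ^ 2\<close> decides the parities: if \<open>m\<close> is 1 modulo 4, then
  \<open>A\<close> and \<open>B\<close> have the same parity; if \<open>m\<close> is 2 or 3, both
  are even; the residue 0 is excluded by squarefreeness.\<close>

lemma algebraic_int_iff:
  assumes "z \<in> K"
  shows "algebraic_int z \<longleftrightarrow> (\<exists>i j::int. z = of_int i + of_int j * \<rho>)"
proof
  assume z: "algebraic_int z"
  obtain p q where pq: "z = of_rat p + of_rat q * s" using K_cases[OF assms] .
  obtain A B N :: int where AB: "2 * p = of_int A" "2 * q = of_int B" "A\<^sup>2 - m * B\<^sup>2 = 4 * N"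
    using algebraic_int_half_coeffs z unfolding pq by blast
  have pq': "p = of_int A / 2" "q = of_int B / 2" using AB by auto
  have m0: "m mod 4 \<noteq> 0"
  proof
    assume "m mod 4 = 0"
    then have "(2::int)\<^sup>2 dvd m" by (simp add: mod_eq_0_iff_dvd)
    then have "(2::int) dvd 1" using squarefreeD[OF squarefree] by blast
    then show False by simp
  qed
  have sq: "x\<^sup>2 mod 4 = (if even x then 0 else 1)" for x :: int
  proof (cases "even x")
    case True
    then obtain y where "x = 2 * y" by (elim evenE)
    then show ?thesis by (simp add: power_mult_distrib)
  next
    case False
    then obtain y where "x = 2 * y + 1" by (elim oddE)
    then have "x\<^sup>2 = 4 * (y\<^sup>2 + y) + 1" by (simp add: power2_eq_square algebra_simps)
    then show ?thesis using False by presburger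
  qed
  have "(A\<^sup>2 - m * B\<^sup>2) mod 4 = 0" using AB(3) by simp
  moreover have "(A\<^sup>2 mod 4 - (m mod 4) * (B\<^sup>2 mod 4)) mod 4 = (A\<^sup>2 - m * B\<^sup>2) mod 4"
    by (rule mod_diff_cong) (simp_all add: mod_mult_eq)
  ultimately have par: "(A\<^sup>2 mod 4 - (m mod 4) * (B\<^sup>2 mod 4)) mod 4 = 0" by simp
  show "\<exists>i j::int. z = of_int i + of_int j * \<rho>"
  proof (cases "m mod 4 = 1")
    case True
    have small: "x = y" if "(x - y) mod 4 = 0" "x = 0 \<or> x = 1" "y = 0 \<or> y = 1" for x y :: int
      using that by (elim disjE) simp_all
    have "(A\<^sup>2 mod 4 - B\<^sup>2 mod 4) mod 4 = 0" using par True by simp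
    then have "A\<^sup>2 mod 4 = B\<^sup>2 mod 4" by (rule small) (simp_all add: sq)
    then have "even A \<longleftrightarrow> even B" by (simp add: sq split: if_splits)
    then have "even (A - B)" by simp
    then obtain k where "A - B = 2 * k" by (elim evenE)
    then have "A = 2 * k + B" by simp
    then have "z = of_int (2 * k + B) / 2 + of_int B / 2 * s"
      using pq by (simp add: pq' of_rat_divide of_rat_add add_divide_distrib)
    also have "\<dots> = of_int k + of_int B * \<rho>"
      using True by (simp add: quadratic_generator_def add_divide_distrib ring_distribs)
    finally have "z = of_int k + of_int B * \<rho>" .
    then show ?thesis by blast
  next
    case False
    have m_cases: "m mod 4 = 2 \<or> m mod 4 = 3" using False m0 by presburger
    have small: "x = 0 \<and> y = 0"
      if "(x - r * y) mod 4 = 0" "r = 2 \<or> r = 3" "x = 0 \<or> x = 1" "y = 0 \<or> y = 1" for x y r :: int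
      using that by (elim disjE) simp_all
    have "A\<^sup>2 mod 4 = 0 \<and> B\<^sup>2 mod 4 = 0"
      by (rule small[OF par m_cases]) (simp_all add: sq)
    then have "even A \<and> even B" by (simp add: sq split: if_splits)
    then obtain k l where "A = 2 * k" "B = 2 * l" by (auto elim!: evenE)
    then have "z = of_int k + of_int l * \<rho>"
      using False pq by (simp add: pq' quadratic_generator_def)
    then show ?thesis by blast
  qed
next
  assume "\<exists>i j::int. z = of_int i + of_int j * \<rho>"
  then show "algebraic_int z" using algebraic_int_generator by auto
qed

lemma integral_basis: "integral_basis K [1, \<rho>]"
proof (rule integral_basisI[OF K_subfield])
  fix i assume "i < length [1, \<rho>]"
  then show "[1, \<rho>] ! i \<in> K \<and> algebraic_int ([1, \<rho>] ! i)"
    using generator_in_K algebraic_int_generator subfield_1[OF K_subfield] by (auto simp: less_Suc_eq)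
next
  fix z assume "z \<in> K" "algebraic_int z"
  then obtain i j where "z = of_int i + of_int j * \<rho>" using algebraic_int_iff by blast
  then show "\<exists>c::nat \<Rightarrow> int. z = (\<Sum>i<length [1, \<rho>]. of_int (c i) * [1, \<rho>] ! i)"
    by (intro exI[of _ "\<lambda>n. if n = 0 then i else j"]) simp
next
  fix c :: "nat \<Rightarrow> int" and i
  assume eq: "(\<Sum>i<length [1, \<rho>]. of_int (c i) * [1, \<rho>] ! i) = 0" and i: "i < length [1, \<rho>]"
  have eq: "of_int (c 0) + of_int (c 1) * \<rho> = 0" using eq by simp
  have "c 0 = 0 \<and> c 1 = 0"
  proof (cases "m mod 4 = 1")
    case True
    have "of_rat (of_int (c 0) + of_int (c 1) / 2) + of_rat (of_int (c 1) / 2) * s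
        = of_int (c 0) + of_int (c 1) * ((1 + s) / 2)"
      by (simp add: of_rat_add of_rat_divide add_divide_distrib ring_distribs)
    also have "\<dots> = 0" using eq True by (simp add: quadratic_generator_def)
    finally have "of_rat (of_int (c 0) + of_int (c 1) / 2) + of_rat (of_int (c 1) / 2) * s = 0" .
    from rat_coeffs_eq_0[OF this] show ?thesis by simp
  next
    case False
    then have "of_rat (of_int (c 0)) + of_rat (of_int (c 1)) * s = 0"
      using eq by (simp add: quadratic_generator_def)
    from rat_coeffs_eq_0[OF this] show ?thesis by simp
  qed
  then show "c i = 0" using i by (auto simp: less_Suc_eq)
qed

lemma discriminant: "field_discriminant K = (if m mod 4 = 1 then m else 4 * m)"
proof -
  have s0: "s \<noteq> 0" using s_sq no_rat_sqrt[of 0] by auto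
  have roots: "set [s, - s] = {r. rat_eval r [:- of_int m, 0, 1:] = 0}"
  proof -
    have "rat_eval r [:- of_int m, 0, 1:] = r\<^sup>2 - s\<^sup>2" for r
      unfolding s_sq by (simp add: power2_eq_square of_rat_minus)
    then show ?thesis by (auto simp: power2_eq_iff)
  qed
  obtain \<sigma>s where \<sigma>s: "distinct \<sigma>s" "set \<sigma>s = embeddings K" "map (\<lambda>\<sigma>. \<sigma> s) \<sigma>s = [s, - s]"
    using embeddings_Q_adjoin[OF irreducible rat_eval_minpoly _ roots] s0 by auto
  then obtain \<sigma> \<tau> where st: "\<sigma>s = [\<sigma>, \<tau>]" "\<sigma> s = s" "\<tau> s = - s" by auto
  then have emb: "\<sigma> \<in> embeddings K" "\<tau> \<in> embeddings K" using \<sigma>s by auto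
  have gen: "f \<rho> = quadratic_generator m (f s)" if f: "f \<in> embeddings K" for f
  proof (cases "m mod 4 = 1")
    case True
    have "f (of_rat (1/2) + of_rat (1/2) * s) = of_rat (1/2) + of_rat (1/2) * f s"
      using s_in_K by (simp del: of_rat_divide add: embeddingsD[OF f] embedding_of_rat[OF f K_subfield] subfield_closed[OF K_subfield])
    moreover have "of_rat (1/2) + of_rat (1/2) * x = (1 + x) / 2" for x :: complex
      by (simp add: of_rat_divide field_simps)
    ultimately show ?thesis using True by (simp add: quadratic_generator_def)
  qed (simp add: quadratic_generator_def)
  have det: "det (embedding_mat \<sigma>s [1, \<rho>]) = quadratic_generator m (- s) - quadratic_generator m s"
    using gen[OF emb(1)] gen[OF emb(2)] st
    by (simp add: embedding_mat_def det_mat_2[unfolded numeral_2_eq_2] embeddingsD(3)[OF emb(1)] embeddingsD(3)[OF emb(2)])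
  have "(det (embedding_mat \<sigma>s [1, \<rho>]))\<^sup>2 = (if m mod 4 = 1 then s\<^sup>2 else 4 * s\<^sup>2)"
    unfolding det by (simp add: quadratic_generator_def power2_eq_square field_simps)
  then show ?thesis
    using s_sq by (intro field_discriminant_eqI[OF K_subfield integral_basis \<sigma>s(1,2)]) (auto simp: st)
qed

text \<open>Since \<open>2 * \<rho>\<close> lies in the order, 0 and \<open>\<rho>\<close> represent
  all cosets. What matters later is that the index is prime to 3.\<close>

lemma conductor_cases: "conductor K (generate_ring CC {s}) \<in> {1, 2}"
proof -
  let ?R = "generate_ring CC {s}"
  have R: "subring ?R CC" by (rule CC.generate_ring_is_subring) simp
  note R = subringE[OF R]
  have R_add: "x + y \<in> ?R" "x - y \<in> ?R" if "x \<in> ?R" "y \<in> ?R" for x y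
    using R(7)[of x y] R(7)[of x "- y"] R(5)[of y] that by simp_all
  have R_nat: "of_nat n \<in> ?R" for n
    by (induction n) (use R(2,3) R_add in auto)
  have R_int: "of_int n \<in> ?R" for n
    by (cases n rule: int_cases2) (use R_nat R(5) in auto)
  have s: "s \<in> ?R" by (rule generate_ring.incl) simp
  define coset where "coset x = (\<lambda>h. h + x) ` ?R" for x
  have coset_eq: "coset x = coset y" if "x - y \<in> ?R" for x y
  proof -
    have "h + x \<in> coset y" if "h \<in> ?R" for h
      using R_add(1)[OF that \<open>x - y \<in> ?R\<close>] unfolding coset_def by (intro image_eqI[of _ _ "h + (x - y)"]) auto
    moreover have "h + y \<in> coset x" if "h \<in> ?R" for h
      using R_add(2)[OF that \<open>x - y \<in> ?R\<close>] unfolding coset_def by (intro image_eqI[of _ _ "h - (x - y)"]) auto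
    ultimately show ?thesis unfolding coset_def by blast
  qed
  have rc: "a_rcosets\<^bsub>\<O> K\<^esub> ?R = coset ` {x \<in> K. algebraic_int x}"
    by (auto simp: A_RCOSETS_def RCOSETS_def r_coset_def coset_def ring_of_integers_def)
  have "coset x \<in> {coset 0, coset \<rho>}" if x: "x \<in> K" "algebraic_int x" for x
  proof -
    obtain i j where ij: "x = of_int i + of_int j * \<rho>" using algebraic_int_iff x by blast
    show ?thesis
    proof (cases "m mod 4 = 1")
      case False
      have "x - 0 \<in> ?R"
        using ij False R_add(1) R_int R(6)[of "of_int j" s] s by (simp add: quadratic_generator_def)
      then show ?thesis using coset_eq by blast
    next
      case True
      have two: "2 * \<rho> = 1 + s" using True by (simp add: quadratic_generator_def)
      obtain k e where j: "j = 2 * k + e" "e = 0 \<or> e = 1" by (metis mod_mult_div_eq mod2_eq_if add.commute mult_div_mod_eq)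
      have "x - of_int e * \<rho> = of_int i + of_int k * (2 * \<rho>)" using ij j by (simp add: algebra_simps)
      also have "\<dots> \<in> ?R"
        unfolding two using R_add(1) R_int R(6)[of "of_int k" "1 + s"] s R(3) by simp
      finally have "coset x = coset (of_int e * \<rho>)" by (rule coset_eq)
      moreover have "of_int e * \<rho> = 0 \<or> of_int e * \<rho> = \<rho>" using j(2) by auto
      ultimately show ?thesis by (metis insertI1 insertI2)
    qed
  qed
  then have sub: "a_rcosets\<^bsub>\<O> K\<^esub> ?R \<subseteq> {coset 0, coset \<rho>}" unfolding rc by auto
  moreover have "coset 0 \<in> a_rcosets\<^bsub>\<O> K\<^esub> ?R"
    unfolding rc using subfield_0[OF K_subfield] by auto
  moreover have "finite (a_rcosets\<^bsub>\<O> K\<^esub> ?R)" by (rule finite_subset[OF sub]) simp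
  ultimately have "card (a_rcosets\<^bsub>\<O> K\<^esub> ?R) \<noteq> 0" by (metis card_0_eq empty_iff)
  moreover have "card (a_rcosets\<^bsub>\<O> K\<^esub> ?R) \<le> card {coset 0, coset \<rho>}"
    using sub by (intro card_mono) auto
  moreover have "card {coset 0, coset \<rho>} \<le> 2" by (simp add: card_insert_if)
  ultimately show ?thesis unfolding conductor_def by auto
qed

end

section \<open>Residues modulo a prime\<close>

interpretation QV: vector_space "\<lambda>(c::rat) (x::complex). of_rat c * x"
  by unfold_locales (auto simp: algebra_simps of_rat_add of_rat_mult)

declare QV.scale_scale [simp del] \<comment> \<open>loops with \<open>of_rat_mult\<close>\<close>

text \<open>Each basis vector \<open>v\<close> over \<open>K\<close> contributes \<open>v\<close>
  and \<open>s * v\<close> over the rationals. A finite spanning set is enough, since its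
  cardinality bounds the ranks considered below.\<close>

lemma (in quadratic_field) finite_dimension_imp_span:
  assumes "CC.finite_dimension K M"
  obtains T where "finite T" "M \<subseteq> QV.span T"
proof -
  obtain n where n: "CC.dimension n K M" using assms by (auto simp: CC.finite_dimension_def)
  have "CC.dimension n F M \<Longrightarrow> F = K \<Longrightarrow> \<exists>T. finite T \<and> M \<subseteq> QV.span T" for F
  proof (induction rule: CC.dimension.induct)
    case (zero_dim F)
    show ?case by (intro exI[of _ "{}"]) simp
  next
    case (Suc_dim v E n F)
    then obtain T where T: "finite T" "E \<subseteq> QV.span T" by blast
    let ?T = "insert v (insert (s * v) T)"
    have "x \<in> QV.span ?T" if x: "x \<in> CC.line_extension F v E" for x
    proof -
      obtain k e where ke: "k \<in> K" "e \<in> E" "x = k * v + e"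
        using x Suc_dim.prems unfolding CC.line_extension_mem_iff by auto
      obtain p q where "k = of_rat p + of_rat q * s" using K_cases[OF ke(1)] .
      then have "x = of_rat p * v + of_rat q * (s * v) + e" using ke by (simp add: algebra_simps)
      moreover have "e \<in> QV.span ?T" using ke(2) T(2) QV.span_mono[of T ?T] by blast
      ultimately show ?thesis
        by (auto intro!: QV.span_add QV.span_scale intro: QV.span_base)
    qed
    then show ?case using T(1) by (intro exI[of _ ?T]) auto
  qed
  then show thesis using that n by blast
qed

text \<open>Clearing denominators and dividing by the gcd of the resulting integers leaves
  coefficients that do not all vanish modulo \<open>p\<close>.\<close>

lemma primitive_integer_relation:
  fixes r :: "nat \<Rightarrow> rat" and p :: int
  assumes p: "Factorial_Ring.prime p" and nz: "i0 < n" "r i0 \<noteq> 0"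
  obtains c :: "nat \<Rightarrow> int" and l where "l \<noteq> 0" "\<And>i. i < n \<Longrightarrow> of_int (c i) = l * r i" "\<exists>i<n. \<not> p dvd c i"
proof -
  define D where "D = (\<Prod>i<n. snd (quotient_of (r i)))"
  have D0: "D \<noteq> 0" unfolding D_def by (simp add: less_imp_neq[OF quotient_of_denom_pos', symmetric])
  have "\<exists>k. of_int k = of_int D * r i" if "i < n" for i
  proof -
    obtain a b where ab: "quotient_of (r i) = (a, b)" by (cases "quotient_of (r i)")
    then have b0: "b \<noteq> 0" and ri: "r i = of_int a / of_int b"
      using quotient_of_denom_pos[OF ab] quotient_of_div[OF ab] by auto
    have "b dvd D" unfolding D_def using that ab by (metis dvd_prodI finite_lessThan lessThan_iff snd_conv)
    then obtain e where "D = b * e" by (elim dvdE)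
    then show ?thesis using b0 ri by (intro exI[of _ "a * e"]) simp
  qed
  then obtain k where k: "\<And>i. i < n \<Longrightarrow> of_int (k i) = of_int D * r i" by metis
  define g where "g = Gcd (k ` {..<n})"
  have k0: "k i0 \<noteq> 0" using k[OF nz(1)] nz(2) D0 by auto
  have g0: "g \<noteq> 0" using k0 nz(1) unfolding g_def by (auto simp: Gcd_0_iff)
  have gk: "g dvd k i" if "i < n" for i unfolding g_def using that by (intro Gcd_dvd) auto
  show thesis
  proof (rule that[of "of_int D / of_int g" "\<lambda>i. k i div g"])
    show "of_int D / of_int g \<noteq> (0 :: rat)" using D0 g0 by simp
    show "of_int (k i div g) = of_int D / of_int g * r i" if "i < n" for i
      using gk[OF that] k[OF that] g0 by (auto simp: field_simps elim!: dvdE)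
    show "\<exists>i<n. \<not> p dvd k i div g"
    proof (rule ccontr)
      assume "\<not> (\<exists>i<n. \<not> p dvd k i div g)"
      then have "g * p dvd k i" if "i < n" for i
        using gk[OF that] that g0 by (metis dvd_div_iff_mult mult.commute dvd_mult_div_cancel mult_dvd_mono dvd_refl)
      then have "g * p dvd g" unfolding g_def[symmetric] by (subst (2) g_def) (auto intro: Gcd_greatest)
      then have "p dvd 1" using g0 by simp
      then show False using p by (meson not_prime_unit)
    qed
  qed
qed

lemma integer_relation_mod_prime:
  fixes x :: "nat \<Rightarrow> complex" and p :: int
  assumes p: "Factorial_Ring.prime p" and T: "finite T" "\<And>i. i \<le> card T \<Longrightarrow> x i \<in> QV.span T"
  obtains c :: "nat \<Rightarrow> int" where "(\<Sum>i\<le>card T. of_int (c i) * x i) = 0" "\<exists>i\<le>card T. \<not> p dvd c i"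
proof (cases "inj_on x {..card T}")
  \<comment> \<open>Linear dependence is a notion for sets, so a repeated value in the family is
    treated apart; it gives the relation with coefficients 1 and -1.\<close>
  case False
  then obtain i j where ij: "i \<le> card T" "j \<le> card T" "i \<noteq> j" "x i = x j" by (auto simp: inj_on_def)
  define c :: "nat \<Rightarrow> int" where "c k = (if k = i then 1 else 0) - (if k = j then 1 else 0)" for k
  have "(\<Sum>k\<le>card T. of_int (c k) * x k) = (\<Sum>k\<le>card T. (if k = i then x k else 0) - (if k = j then x k else 0))"
    by (intro sum.cong) (auto simp: c_def)
  also have "\<dots> = 0" using ij by (simp add: sum_subtractf)
  finally have "(\<Sum>k\<le>card T. of_int (c k) * x k) = 0" .
  moreover have "\<not> p dvd c i" using p ij by (auto simp: c_def dest: not_prime_unit)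
  ultimately show ?thesis using that ij by blast
next
  case True
  let ?S = "x ` {..card T}"
  have card: "card ?S = Suc (card T)" using card_image[OF True] by simp
  have "QV.dependent ?S"
  proof (rule ccontr)
    assume "\<not> QV.dependent ?S"
    then have "card ?S \<le> card T"
      using QV.independent_span_bound[OF T(1), of ?S] T(2) by auto
    then show False using card by simp
  qed
  then obtain u where u: "(\<Sum>v\<in>?S. of_rat (u v) * v) = 0" "\<exists>v\<in>?S. u v \<noteq> 0"
    using QV.dependent_finite[of ?S] by auto
  then obtain i0 where i0: "i0 < Suc (card T)" "u (x i0) \<noteq> 0" by (auto simp: less_Suc_eq_le)
  obtain c l where c: "l \<noteq> 0" "\<And>i. i < Suc (card T) \<Longrightarrow> of_int (c i) = l * u (x i)"
      "\<exists>i<Suc (card T). \<not> p dvd c i"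
    by (rule primitive_integer_relation[OF p i0(1), of "\<lambda>i. u (x i)"]) (use i0(2) in auto)
  have "of_int (c i) = (of_rat l * of_rat (u (x i)) :: complex)" if "i \<le> card T" for i
    using c(2)[of i] that by (metis le_imp_less_Suc of_rat_mult of_rat_of_int_eq)
  then have "(\<Sum>i\<le>card T. of_int (c i) * x i) = (\<Sum>i\<le>card T. of_rat l * (of_rat (u (x i)) * x i))"
    by (intro sum.cong) auto
  also have "\<dots> = of_rat l * (\<Sum>v\<in>?S. of_rat (u v) * v)"
    by (simp add: sum.reindex[OF True] sum_distrib_left)
  finally show ?thesis using that u(1) c(3) by (auto simp: less_Suc_eq_le)
qed

locale number_field =
  fixes M T :: "complex set"
  assumes M: "subfield M CC" and T: "finite T" "M \<subseteq> QV.span T"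
begin

abbreviation "OM \<equiv> {x \<in> M. algebraic_int x}"

lemma OM_closed:
  "0 \<in> OM" "1 \<in> OM" "x \<in> OM \<Longrightarrow> y \<in> OM \<Longrightarrow> x + y \<in> OM" "x \<in> OM \<Longrightarrow> y \<in> OM \<Longrightarrow> x * y \<in> OM"
  "x \<in> OM \<Longrightarrow> - x \<in> OM" "x \<in> OM \<Longrightarrow> y \<in> OM \<Longrightarrow> x - y \<in> OM" "of_int n \<in> OM" "x \<in> OM \<Longrightarrow> x ^ k \<in> OM"
  using M by (auto intro: subfield_closed)

lemma OM_sum: "(\<And>i. i \<in> I \<Longrightarrow> f i \<in> OM) \<Longrightarrow> sum f I \<in> OM"
  by (induction I rule: infinite_finite_induct) (auto intro: OM_closed subfield_closed M)

text \<open>The assumption \<open>indep\<close> expresses independence in the quotient of the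
  integers by \<open>p\<close>. More than \<open>card T\<close> elements satisfy a rational
  relation, and its primitive integer form is a nontrivial relation modulo \<open>p\<close>, with
  \<open>y = 0\<close>.\<close>

lemma independent_mod_prime_bound:
  fixes x :: "nat \<Rightarrow> complex" and p :: int
  assumes p: "Factorial_Ring.prime p" and x: "\<And>i. i < k \<Longrightarrow> x i \<in> OM"
    and indep: "\<And>c y. y \<in> OM \<Longrightarrow> (\<Sum>i<k. of_int (c i) * x i) = of_int p * y \<Longrightarrow> \<forall>i<k. p dvd c i"
  shows "k \<le> card T"
proof (rule ccontr)
  assume "\<not> k \<le> card T"
  then have k: "card T < k" by simp
  have mem: "x i \<in> QV.span T" if "i \<le> card T" for i using x[of i] that k T by auto
  obtain c :: "nat \<Rightarrow> int"
    where c: "(\<Sum>i\<le>card T. of_int (c i) * x i) = 0" "\<exists>i\<le>card T. \<not> p dvd c i"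
    using integer_relation_mod_prime[OF p T(1), of x] mem by blast
  define c' where "c' i = (if i \<le> card T then c i else 0)" for i
  have "(\<Sum>i<k. of_int (c' i) * x i) = (\<Sum>i\<le>card T. of_int (c i) * x i)"
    using k by (intro sum.mono_neutral_cong_right) (auto simp: c'_def)
  then have "\<forall>i<k. p dvd c' i" using indep[of 0 c'] c(1) OM_closed(1) by simp
  moreover obtain i where "i \<le> card T" "\<not> p dvd c i" using c(2) by blast
  ultimately show False using k by (auto simp: c'_def dest: spec[of _ i])
qed

text \<open>By the bound \<open>card T\<close> there is a longest family independent modulo
  \<open>p\<close>, and it spans the integers modulo \<open>p\<close>. The set \<open>R\<close>
  collects its combinations with coefficients in \<open>{0..<p}\<close>.\<close>

lemma finite_residues:
  fixes p :: int
  assumes p: "Factorial_Ring.prime p"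
  obtains R where "finite R" "R \<subseteq> OM" "\<And>x. x \<in> OM \<Longrightarrow> \<exists>r\<in>R. \<exists>y\<in>OM. x = r + of_int p * y"
proof -
  define indep where "indep k x \<longleftrightarrow> (\<forall>i<k. x i \<in> OM) \<and>
    (\<forall>c. \<forall>y\<in>OM. (\<Sum>i<k. of_int (c i) * x i) = of_int p * y \<longrightarrow> (\<forall>i<k. p dvd c i))"
    for k and x :: "nat \<Rightarrow> complex"
  have bound: "k \<le> card T" if "indep k x" for k x
    by (rule independent_mod_prime_bound[OF p, of k x]) (use that in \<open>auto simp: indep_def\<close>)
  define k where "k = (GREATEST k. \<exists>x. indep k x)"
  have "\<exists>x. indep 0 x" by (simp add: indep_def)
  then have "\<exists>x. indep k x"
    unfolding k_def using bound by (intro GreatestI_ex_nat[of "\<lambda>k. \<exists>x. indep k x" "card T"]) auto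
  then obtain x where x: "indep k x" by blast
  have "\<not> indep (Suc k) x'" for x'
    using Greatest_le_nat[of "\<lambda>k. \<exists>x. indep k x" "Suc k" "card T"] bound unfolding k_def[symmetric] by force
  then have max: "\<not> indep (Suc k) (x(k := z))" for z by blast
  have xM: "x i \<in> OM" if "i < k" for i using x that by (simp add: indep_def)
  define comb where "comb c = (\<Sum>i<k. of_int (c i) * x i)" for c
  have comb: "comb c \<in> OM" for c
    unfolding comb_def using xM OM_closed(4,7) by (intro OM_sum) simp
  define R where "R = comb ` ({..<k} \<rightarrow>\<^sub>E {0..<p})"
  show thesis
  proof (rule that[of R])
    show "finite R" unfolding R_def by (intro finite_imageI finite_PiE) auto
    show "R \<subseteq> OM" unfolding R_def using comb by blast
    fix z assume z: "z \<in> OM"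
    have zk: "\<forall>i<Suc k. (x(k := z)) i \<in> OM" using xM z by (simp add: less_Suc_eq)
    have sum_upd: "(\<Sum>i<Suc k. of_int (c i) * (x(k := z)) i) = comb c + of_int (c k) * z" for c
    proof -
      have "(\<Sum>i<k. of_int (c i) * (x(k := z)) i) = comb c"
        unfolding comb_def by (intro sum.cong) auto
      then show ?thesis by simp
    qed
    obtain c y where c: "y \<in> OM" "comb c + of_int (c k) * z = of_int p * y" "\<exists>i<Suc k. \<not> p dvd c i"
      using max[of z] zk unfolding indep_def sum_upd by blast
    have "\<not> p dvd c k"
    proof
      assume "p dvd c k"
      then obtain e where "c k = p * e" by (elim dvdE)
      then have "comb c = of_int p * (y - of_int e * z)" using c(2) by (simp add: algebra_simps)
      moreover have "y - of_int e * z \<in> OM" by (intro OM_closed c z)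
      ultimately have "\<forall>i<k. p dvd c i" using x unfolding indep_def comb_def by blast
      then show False using c(3) \<open>p dvd c k\<close> by (auto simp: less_Suc_eq)
    qed
    \<comment> \<open>The coefficient of \<open>z\<close> is invertible modulo \<open>p\<close>;
      multiplying the relation by the inverse \<open>a\<close> solves for \<open>z\<close>. Below,
      \<open>c'\<close> and \<open>e\<close> are the remainders and quotients of the coefficients
      \<open>- a * c i\<close> on division by \<open>p\<close>.\<close>
    then have "Rings.coprime (c k) p" using p prime_imp_coprime coprime_commute by blast
    then obtain a b where ab: "a * c k + b * p = 1" using bezout_int[of "c k" p] by auto
    have ab': "of_int a * of_int (c k) + of_int b * of_int p = (1 :: complex)"
      using arg_cong[OF ab, of "of_int :: int \<Rightarrow> complex"] by simp
    define c' where "c' i = restrict (\<lambda>i. (- a * c i) mod p) {..<k} i" for i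
    define e where "e i = (- a * c i) div p" for i
    have comb1: "comb (\<lambda>i. - a * c i) = comb c' + of_int p * comb e"
      unfolding comb_def sum_distrib_left sum.distrib[symmetric]
    proof (intro sum.cong refl)
      fix i assume "i \<in> {..<k}"
      then have "- a * c i = c' i + p * e i" by (simp add: c'_def e_def)
      then have "of_int (- a * c i) = (of_int (c' i + p * e i) :: complex)" by (rule arg_cong)
      also have "\<dots> = of_int (c' i) + of_int p * of_int (e i)" by simp
      finally have "of_int (- a * c i) = (of_int (c' i) + of_int p * of_int (e i) :: complex)" .
      then show "of_int (- a * c i) * x i = of_int (c' i) * x i + of_int p * (of_int (e i) * x i)"
        by (simp only: ring_distribs mult.assoc)
    qed
    have comb2: "comb (\<lambda>i. - a * c i) = - of_int a * comb c"
      unfolding comb_def sum_distrib_left by (intro sum.cong refl) (simp add: mult.assoc)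
    have comb3: "- of_int a * comb c = comb c' + of_int p * comb e"
      using comb1 unfolding comb2 .
    have "z = (of_int a * of_int (c k) + of_int b * of_int p) * z" using ab' by simp
    then have "z = of_int a * (of_int c_k * z) + of_int b * of_int p * z" if "c_k = c k" for c_k
      using that by (simp only: ring_distribs mult.assoc)
    moreover have "of_int (c k) * z = of_int p * y - comb c"
      using c(2) by (simp add: eq_diff_eq add.commute)
    ultimately have "z = of_int a * (of_int p * y - comb c) + of_int b * of_int p * z" by metis
    also have "\<dots> = - of_int a * comb c + of_int p * (of_int a * y + of_int b * z)"
      by (simp add: ring_distribs mult_ac)
    also have "\<dots> = comb c' + of_int p * (comb e + of_int a * y + of_int b * z)"
      unfolding comb3 by (simp add: ring_distribs mult_ac)
    finally have "z = comb c' + of_int p * (comb e + of_int a * y + of_int b * z)" .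
    moreover have "comb c' \<in> R"
      unfolding R_def using prime_gt_0_int[OF p] by (intro imageI) (auto simp: c'_def)
    moreover have "comb e + of_int a * y + of_int b * z \<in> OM"
      by (intro OM_closed comb c z)
    ultimately show "\<exists>r\<in>R. \<exists>y\<in>OM. z = r + of_int p * y" by blast
  qed
qed

section \<open>Ideals of the ring of integers\<close>

lemma OM_domain: "domain (\<O> M)"
proof -
  have "subring OM CC"
    using OM_closed by (intro CC.subringI) (auto simp: subset_iff)
  moreover have "domain CC"
    using field_from_type_algebra[where 'a = complex] by (simp add: field.axioms(1))
  ultimately show ?thesis unfolding ring_of_integers_def by (intro domain.subring_is_domain)
qed

lemma OM_cring: "cring (\<O> M)" and OM_ring: "ring (\<O> M)"
  using OM_domain by (auto simp: domain_def cring_def)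

lemma OM_simps: "x \<otimes>\<^bsub>\<O> M\<^esub> y = x * y" "x \<oplus>\<^bsub>\<O> M\<^esub> y = x + y" "\<one>\<^bsub>\<O> M\<^esub> = 1" "\<zero>\<^bsub>\<O> M\<^esub> = 0"
  by (simp_all add: ring_of_integers_def)

lemma ideal_OM_D:
  assumes "ideal I (\<O> M)"
  shows "I \<subseteq> OM" "0 \<in> I" "x \<in> I \<Longrightarrow> y \<in> I \<Longrightarrow> x + y \<in> I" "x \<in> I \<Longrightarrow> r \<in> OM \<Longrightarrow> r * x \<in> I"
    "x \<in> I \<Longrightarrow> y \<in> I \<Longrightarrow> x - y \<in> I"
proof -
  interpret ideal I "\<O> M" by fact
  show "I \<subseteq> OM" using a_subset by simp
  show "0 \<in> I" using additive_subgroup.zero_closed[OF is_additive_subgroup] by (simp add: OM_simps)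
  show add: "x + y \<in> I" if "x \<in> I" "y \<in> I" for x y using additive_subgroup.a_closed[OF is_additive_subgroup] that by (simp add: OM_simps)
  show mult: "r * x \<in> I" if "x \<in> I" "r \<in> OM" for r x using I_l_closed that by (simp add: OM_simps)
  show "x - y \<in> I" if "x \<in> I" "y \<in> I" using add[OF that(1) mult[OF that(2), of "- 1"]] OM_closed by simp
qed

lemma ideal_OM_I:
  assumes "I \<subseteq> OM" "0 \<in> I" "\<And>x y. x \<in> I \<Longrightarrow> y \<in> I \<Longrightarrow> x + y \<in> I"
    "\<And>x r. x \<in> I \<Longrightarrow> r \<in> OM \<Longrightarrow> r * x \<in> I"
  shows "ideal I (\<O> M)"
proof (rule idealI[OF OM_ring])
  interpret cring "\<O> M" by (rule OM_cring)
  show "subgroup I (add_monoid (\<O> M))"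
  proof (rule add.subgroupI)
    fix x assume x: "x \<in> I"
    then have "\<ominus>\<^bsub>\<O> M\<^esub> x = - x"
      using assms(1) OM_closed by (intro minus_equality) (auto simp: OM_simps)
    also have "- x \<in> I" using assms(4)[OF x, of "- 1"] OM_closed by simp
    finally show "\<ominus>\<^bsub>\<O> M\<^esub> x \<in> I" .
  qed (use assms in \<open>auto simp: OM_simps\<close>)
qed (use assms in \<open>auto simp: OM_simps mult.commute\<close>)

text \<open>An ideal containing \<open>p\<close> is determined by its intersection with the finite
  set \<open>R\<close> of residues. A proper one whose intersection is largest is therefore
  maximal.\<close>

lemma maximal_ideal_exists:
  fixes p :: int
  assumes p: "Factorial_Ring.prime p"
  obtains Q where "maximalideal Q (\<O> M)" "of_int p \<in> Q"
proof -
  obtain R where R: "finite R" "R \<subseteq> OM" "\<And>x. x \<in> OM \<Longrightarrow> \<exists>r\<in>R. \<exists>y\<in>OM. x = r + of_int p * y"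
    using finite_residues[OF p] by blast
  define good where "good I \<longleftrightarrow> ideal I (\<O> M) \<and> of_int p \<in> I \<and> 1 \<notin> I" for I
  have p0: "(of_int p :: complex) \<noteq> 0" using p by auto
  have "good ((\<lambda>y. of_int p * y) ` OM)"
    unfolding good_def
  proof (intro conjI ideal_OM_I)
    show "of_int p \<in> (\<lambda>y. of_int p * y) ` OM" using OM_closed(2) by (intro image_eqI[of _ _ 1]) auto
    show "1 \<notin> (\<lambda>y. of_int p * y) ` OM"
    proof
      assume "1 \<in> (\<lambda>y. of_int p * y) ` OM"
      then obtain y where y: "algebraic_int y" "of_int p * y = (1 :: complex)" by auto
      then have "y = of_rat (1 / of_int p)" using p0 by (simp add: of_rat_divide field_simps)
      then obtain n where "1 / of_int p = (of_int n :: rat)" using y algebraic_int_rat by blast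
      then have "(of_int (p * n) :: rat) = of_int 1" using p by (auto simp: field_simps)
      then have "p * n = 1" by (simp only: of_int_eq_iff)
      then have "p dvd 1" by (metis dvd_triv_left)
      then show False using p by (meson not_prime_unit)
    qed
    show "0 \<in> (\<lambda>y. of_int p * y) ` OM" using OM_closed(1) by (intro image_eqI[of _ _ 0]) auto
    show "(\<lambda>y. of_int p * y) ` OM \<subseteq> OM" using OM_closed by auto
  next
    fix x y assume "x \<in> (\<lambda>y. of_int p * y) ` OM" "y \<in> (\<lambda>y. of_int p * y) ` OM"
    then obtain a b where "a \<in> OM" "b \<in> OM" "x = of_int p * a" "y = of_int p * b" by blast
    then show "x + y \<in> (\<lambda>y. of_int p * y) ` OM"
      using OM_closed(3)[of a b] by (intro image_eqI[of _ _ "a + b"]) (auto simp: algebra_simps)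
  next
    fix x r assume "x \<in> (\<lambda>y. of_int p * y) ` OM" "r \<in> OM"
    then obtain a where "a \<in> OM" "x = of_int p * a" by blast
    then show "r * x \<in> (\<lambda>y. of_int p * y) ` OM"
      using OM_closed(4)[of r a] \<open>r \<in> OM\<close> by (intro image_eqI[of _ _ "r * a"]) (auto simp: algebra_simps)
  qed
  then have ex: "\<exists>I. good I" by blast
  have "\<forall>I. good I \<longrightarrow> card (I \<inter> R) < Suc (card R)"
    using R(1) by (auto intro!: card_mono le_imp_less_Suc)
  then obtain Q where Q: "good Q" "\<And>I. good I \<Longrightarrow> card (I \<inter> R) \<le> card (Q \<inter> R)"
    using ex_has_greatest_nat[of good _ "\<lambda>I. card (I \<inter> R)" "Suc (card R)"] ex by blast
  have "maximalideal Q (\<O> M)"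
  proof (rule maximalidealI)
    show QI: "ideal Q (\<O> M)" using Q by (simp add: good_def)
    show "carrier (\<O> M) \<noteq> Q" using Q(1) OM_closed(2) by (auto simp: good_def)
    fix J assume J: "ideal J (\<O> M)" "Q \<subseteq> J" "J \<subseteq> carrier (\<O> M)"
    show "J = Q \<or> J = carrier (\<O> M)"
    proof (cases "1 \<in> J")
      case True
      then show ?thesis using ideal.one_imp_carrier[OF J(1)] by (simp add: OM_simps)
    next
      case False
      then have "good J" using J Q(1) by (auto simp: good_def)
      then have "Q \<inter> R = J \<inter> R"
        using Q(2)[of J] J(2) R(1) by (intro card_seteq) auto
      moreover have "x \<in> Q" if "x \<in> J" for x
      proof -
        have "x \<in> OM" using ideal_OM_D(1)[OF J(1)] that by blast
        then obtain r y where ry: "r \<in> R" "y \<in> OM" "x = r + of_int p * y" using R(3) by blast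
        have pQ: "of_int p * y \<in> Q"
          using ideal_OM_D(4)[OF QI _ ry(2), of "of_int p"] Q(1) by (simp add: good_def mult.commute)
        then have "x - of_int p * y \<in> J" using J(2) that ideal_OM_D(5)[OF J(1)] by blast
        then have "r \<in> J" using ry by simp
        then have "r \<in> Q" using \<open>Q \<inter> R = J \<inter> R\<close> ry by blast
        then show ?thesis using ideal_OM_D(3)[OF QI] pQ ry by blast
      qed
      ultimately show ?thesis using J(2) by blast
    qed
  qed
  then show thesis using that Q(1) by (auto simp: good_def)
qed

section \<open>Powers of a prime ideal\<close>

abbreviation ideal_power :: "complex set \<Rightarrow> nat \<Rightarrow> complex set" where
  "ideal_power Q e \<equiv> (ideal_prod (\<O> M) Q ^^ e) OM"

lemma ideal_power_ideal: "ideal Q (\<O> M) \<Longrightarrow> ideal (ideal_power Q e) (\<O> M)"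
  using ring.oneideal[OF OM_ring] by (induction e) (auto intro: ring.ideal_prod_is_ideal[OF OM_ring])

lemma ideal_power_Suc_subset: "ideal Q (\<O> M) \<Longrightarrow> ideal_power Q (Suc e) \<subseteq> ideal_power Q e"
  using ring.ideal_prod_inter[OF OM_ring _ ideal_power_ideal] by auto

lemma ideal_power_antimono: "ideal Q (\<O> M) \<Longrightarrow> e \<le> e' \<Longrightarrow> ideal_power Q e' \<subseteq> ideal_power Q e"
  by (rule lift_Suc_antimono_le[of "ideal_power Q", OF ideal_power_Suc_subset])

text \<open>Nakayama's lemma: a multiplier outside \<open>Q\<close> eliminates one generator of \<open>J\<close> at a time.\<close>

lemma nakayama_step:
  fixes k :: nat
  assumes Q: "primeideal Q (\<O> M)" and J: "J \<subseteq> ideal_prod (\<O> M) Q J"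
    and a: "\<And>i. i \<le> k \<Longrightarrow> a i \<in> J" and s: "s \<in> OM" "s \<notin> Q"
    and gen: "\<And>x. x \<in> J \<Longrightarrow> \<exists>r. (\<forall>i\<le>k. r i \<in> OM) \<and> s * x = (\<Sum>i\<le>k. r i * a i)"
  obtains s' where "s' \<in> OM" "s' \<notin> Q"
    "\<And>x. x \<in> J \<Longrightarrow> \<exists>r. (\<forall>i<k. r i \<in> OM) \<and> s' * x = (\<Sum>i<k. r i * a i)"
proof -
  interpret Q: primeideal Q "\<O> M" by fact
  have QI: "ideal Q (\<O> M)" by (rule Q.is_ideal)
  have QJ: "\<exists>q. (\<forall>i\<le>k. q i \<in> Q) \<and> s * z = (\<Sum>i\<le>k. q i * a i)" if "z \<in> ideal_prod (\<O> M) Q J" for z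
    using that
  proof induction
    case (prod i j)
    then obtain r where r: "\<forall>l\<le>k. r l \<in> OM" "s * j = (\<Sum>l\<le>k. r l * a l)"
      using gen[OF prod(2)] by (elim exE conjE)
    have "s * (i * j) = i * (s * j)" by simp
    also have "\<dots> = (\<Sum>l\<le>k. (r l * i) * a l)" using r by (simp add: sum_distrib_left mult_ac)
    finally show ?case
      using ideal_OM_D(4)[OF QI prod(1)] r(1) by (intro exI[of _ "\<lambda>l. r l * i"]) (auto simp: OM_simps)
  next
    case (sum x y)
    then obtain q q' where "\<forall>i\<le>k. q i \<in> Q" "s * x = (\<Sum>i\<le>k. q i * a i)"
      "\<forall>i\<le>k. q' i \<in> Q" "s * y = (\<Sum>i\<le>k. q' i * a i)" by (elim exE conjE)
    then show ?case
      using ideal_OM_D(3)[OF QI]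
      by (intro exI[of _ "\<lambda>i. q i + q' i"]) (simp add: OM_simps ring_distribs sum.distrib)
  qed
  obtain q where q: "\<forall>i\<le>k. q i \<in> Q" "s * a k = (\<Sum>i\<le>k. q i * a i)"
    using QJ[OF subsetD[OF J a[OF order_refl]]] by (elim exE conjE)
  have sum_le: "(\<Sum>i\<le>k. f i) = (\<Sum>i<k. f i) + f k" for f :: "nat \<Rightarrow> complex"
    by (simp add: lessThan_Suc_atMost[symmetric])
  define s1 where "s1 = s - q k"
  have qO: "q i \<in> OM" if "i \<le> k" for i using q that ideal_OM_D(1)[OF QI] by blast
  have s1: "s1 \<in> OM" "s1 \<notin> Q"
  proof -
    show "s1 \<in> OM" unfolding s1_def by (intro OM_closed s qO order_refl)
    show "s1 \<notin> Q"
    proof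
      assume "s1 \<in> Q"
      then have "s1 + q k \<in> Q" using ideal_OM_D(3)[OF QI] q by blast
      then show False using s(2) by (simp add: s1_def)
    qed
  qed
  have s1_ak: "s1 * a k = (\<Sum>i<k. q i * a i)" using q(2) unfolding sum_le s1_def by (simp add: algebra_simps)
  show thesis
  proof (rule that[of "s1 * s"])
    show "s1 * s \<in> OM" by (intro OM_closed s s1)
    show "s1 * s \<notin> Q" using Q.I_prime[of s1 s] s s1 by (auto simp: OM_simps)
    fix x assume "x \<in> J"
    from gen[OF this] obtain r where r: "\<forall>i\<le>k. r i \<in> OM" "s * x = (\<Sum>i\<le>k. r i * a i)"
      by (elim exE conjE)
    have "s1 * s * x = s1 * (s * x)" by simp
    also have "\<dots> = s1 * (\<Sum>i<k. r i * a i) + r k * (s1 * a k)"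
      unfolding r(2) sum_le by (simp add: algebra_simps)
    also have "\<dots> = (\<Sum>i<k. (s1 * r i + r k * q i) * a i)"
      unfolding s1_ak by (simp add: sum_distrib_left sum.distrib ring_distribs mult_ac)
    finally have "s1 * s * x = (\<Sum>i<k. (s1 * r i + r k * q i) * a i)" .
    moreover have "s1 * r i + r k * q i \<in> OM" if "i < k" for i
      using that r(1) by (intro OM_closed(3,4) s1(1) qO) auto
    ultimately show "\<exists>r. (\<forall>i<k. r i \<in> OM) \<and> s1 * s * x = (\<Sum>i<k. r i * a i)"
      by (intro exI[of _ "\<lambda>i. s1 * r i + r k * q i"] conjI allI impI)
  qed
qed

text \<open>Once all generators are eliminated, the accumulated multiplier annihilates
  \<open>J\<close>; it stays outside \<open>Q\<close> because \<open>Q\<close> is prime.\<close>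

lemma nakayama:
  fixes k :: nat
  assumes Q: "primeideal Q (\<O> M)" and J: "J \<subseteq> ideal_prod (\<O> M) Q J"
    and a: "\<And>i. i < k \<Longrightarrow> a i \<in> J" and s: "s \<in> OM" "s \<notin> Q"
    and gen: "\<And>x. x \<in> J \<Longrightarrow> \<exists>r. (\<forall>i<k. r i \<in> OM) \<and> s * x = (\<Sum>i<k. r i * a i)"
  shows "\<exists>s\<in>OM. s \<notin> Q \<and> (\<forall>x\<in>J. s * x = 0)"
  using a s gen
proof (induction k arbitrary: s)
  case 0
  then show ?case by auto
next
  case (Suc k)
  obtain s' where "s' \<in> OM" "s' \<notin> Q"
    "\<And>x. x \<in> J \<Longrightarrow> \<exists>r. (\<forall>i<k. r i \<in> OM) \<and> s' * x = (\<Sum>i<k. r i * a i)"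
    using nakayama_step[OF Q J, of k a s] Suc.prems unfolding less_Suc_eq_le lessThan_Suc_atMost by blast
  then show ?case using Suc.IH Suc.prems(1) by simp
qed

text \<open>If \<open>p\<close> lay in every power of \<open>Q\<close>, these powers would be
  determined by their residues in the finite set \<open>R\<close>, so the decreasing chain would
  have two equal consecutive terms \<open>J = Q J\<close>. Nakayama's lemma then gives
  \<open>s\<close> outside \<open>Q\<close> with \<open>s * p = 0\<close>, which is absurd.\<close>

lemma prime_not_in_all_powers:
  fixes p :: int
  assumes p: "Factorial_Ring.prime p" and Q: "primeideal Q (\<O> M)" "of_int p \<in> Q"
  obtains e where "of_int p \<notin> ideal_power Q e"
proof (rule ccontr)
  assume "\<not> thesis"
  then have all: "of_int p \<in> ideal_power Q e" for e using that by blast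
  have QI: "ideal Q (\<O> M)" using Q(1) by (simp add: primeideal_def)
  note pow = ideal_power_ideal[OF QI]
  obtain R where R: "finite R" "R \<subseteq> OM" "\<And>x. x \<in> OM \<Longrightarrow> \<exists>r\<in>R. \<exists>y\<in>OM. x = r + of_int p * y"
    using finite_residues[OF p] by blast
  define f where "f e = card (ideal_power Q e \<inter> R)" for e
  have dec: "f (Suc e) \<le> f e" for e
    unfolding f_def using R(1) ideal_power_Suc_subset[OF QI, of e] by (intro card_mono) auto
  have "\<exists>e. f (Suc e) = f e"
  proof (rule ccontr)
    assume "\<nexists>e. f (Suc e) = f e"
    then have lt: "f (Suc e) < f e" for e using dec by (metis le_neq_implies_less)
    have "f e + e \<le> f 0" for e
    proof (induction e)
      case (Suc e)
      then show ?case using lt[of e] by linarith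
    qed simp
    from this[of "Suc (f 0)"] show False by simp
  qed
  then obtain e where e: "f (Suc e) = f e" by blast
  define J where "J = ideal_power Q e"
  have QJ: "ideal_prod (\<O> M) Q J = ideal_power Q (Suc e)" by (simp add: J_def)
  have sub: "ideal_prod (\<O> M) Q J \<subseteq> J" using ideal_power_Suc_subset[OF QI, of e] by (simp add: J_def)
  have JI: "ideal J (\<O> M)" unfolding J_def by (rule pow)
  have QJI: "ideal (ideal_prod (\<O> M) Q J) (\<O> M)" unfolding QJ by (rule pow)
  have eq: "ideal_prod (\<O> M) Q J \<inter> R = J \<inter> R"
    using e R(1) sub by (intro card_seteq) (auto simp: f_def J_def)
  have residue: "\<exists>r\<in>J \<inter> R. \<exists>y\<in>OM. x = r + of_int p * y" if x: "x \<in> J" for x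
  proof -
    obtain r y where ry: "r \<in> R" "y \<in> OM" "x = r + of_int p * y"
      using R(3) x ideal_OM_D(1)[OF JI] by blast
    have "y * of_int p \<in> J" using ideal_OM_D(4)[OF JI _ ry(2)] all by (simp add: J_def)
    then have "x - y * of_int p \<in> J" using ideal_OM_D(5)[OF JI x] by blast
    then show ?thesis using ry by (auto simp: mult.commute)
  qed
  have JQJ: "J \<subseteq> ideal_prod (\<O> M) Q J"
  proof
    fix x assume "x \<in> J"
    then obtain r y where ry: "r \<in> J \<inter> R" "y \<in> OM" "x = r + of_int p * y" using residue by blast
    have "y * of_int p \<in> ideal_prod (\<O> M) Q J"
      using ideal_OM_D(4)[OF QJI _ ry(2)] all unfolding QJ by blast
    then show "x \<in> ideal_prod (\<O> M) Q J"
      using ry eq ideal_OM_D(3)[OF QJI, of r "y * of_int p"] by (auto simp: mult.commute)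
  qed
  \<comment> \<open>Finite generation of \<open>J\<close>: each element is a multiple of
    \<open>p\<close> plus a residue lying in \<open>J\<close>. The generator \<open>p\<close> takes
    index 0, which shifts the residues by one.\<close>
  obtain rs where rs: "set rs = J \<inter> R" using finite_list[of "J \<inter> R"] R(1) by auto
  define as where "as = of_int p # rs"
  have as: "set as \<subseteq> J" using rs all by (auto simp: as_def J_def)
  have "\<exists>s\<in>OM. s \<notin> Q \<and> (\<forall>x\<in>J. s * x = 0)"
  proof (rule nakayama[OF Q(1) JQJ, of "length as" "\<lambda>i. as ! i" 1])
    show "as ! i \<in> J" if "i < length as" for i using as that nth_mem by blast
    show "1 \<in> OM" by (rule OM_closed)
    show "1 \<notin> Q" using ideal.one_imp_carrier[OF QI] primeideal.I_notcarr[OF Q(1)] by (auto simp: OM_simps)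
    fix x assume "x \<in> J"
    then obtain r y where ry: "r \<in> J \<inter> R" "y \<in> OM" "x = r + of_int p * y" using residue by blast
    then obtain l where l: "l < length rs" "rs ! l = r" using rs by (metis in_set_conv_nth)
    have "(\<Sum>i<length rs. (if i = l then 1 else 0) * rs ! i) = (\<Sum>i<length rs. if i = l then rs ! i else 0)"
      by (intro sum.cong) auto
    also have "\<dots> = r" using l by simp
    finally have "(\<Sum>i<length as. (if i = 0 then y else if i = Suc l then 1 else 0) * as ! i)
        = y * of_int p + r"
      unfolding as_def by (simp add: sum.lessThan_Suc_shift del: sum.lessThan_Suc)
    also have "\<dots> = x" using ry by (simp add: mult.commute)
    finally have "1 * x = (\<Sum>i<length as. (if i = 0 then y else if i = Suc l then 1 else 0) * as ! i)" by simp
    moreover have "\<forall>i<length as. (if i = 0 then y else if i = Suc l then 1 else 0) \<in> OM"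
      using ry(2) OM_closed(1,2) by simp
    ultimately show "\<exists>r. (\<forall>i<length as. r i \<in> OM) \<and> 1 * x = (\<Sum>i<length as. r i * as ! i)"
      by (intro exI[of _ "\<lambda>i. if i = 0 then y else if i = Suc l then 1 else 0"]) simp
  qed
  then obtain s where s: "s \<notin> Q" "s * of_int p = 0" using all[of e] by (auto simp: J_def)
  have "(of_int p :: complex) \<noteq> 0" using p by auto
  then have "s = 0" using s(2) by simp
  then show False using s(1) ideal_OM_D(2)[OF QI] by simp
qed

text \<open>The inclusion of \<open>P\<close> provides the exponent 2. As \<open>p\<close> lies in
  the extended ideal but not in every power of \<open>Q\<close>, the exponents are bounded and the
  greatest one exists.\<close>

lemma ramification_index_ge_2:
  fixes p :: int
  assumes p: "Factorial_Ring.prime p" and Q: "primeideal Q (\<O> M)"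
    and P: "of_int p \<in> P" "P \<subseteq> ideal_power Q 2"
  shows "ramification_index M P Q \<ge> 2"
proof -
  have QI: "ideal Q (\<O> M)" using Q by (simp add: primeideal_def)
  note pow = ideal_power_ideal[OF QI]
  have PO: "P \<subseteq> OM" using P(2) ideal_OM_D(1)[OF pow] by blast
  have "of_int p \<in> ideal_power Q 1"
    using P ideal_power_Suc_subset[OF QI, of 1] by (auto simp: numeral_2_eq_2)
  then have pQ: "of_int p \<in> Q"
    using ring.ideal_prod_inter[OF OM_ring QI ring.oneideal[OF OM_ring]] by auto
  obtain e0 where e0: "of_int p \<notin> ideal_power Q e0" using prime_not_in_all_powers[OF p Q pQ] by blast
  have gen: "genideal (\<O> M) P \<subseteq> ideal_power Q 2"
    by (rule ring.genideal_minimal[OF OM_ring pow P(2)])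
  have "of_int p \<in> genideal (\<O> M) P"
    using ring.genideal_self[OF OM_ring, of P] PO P(1) by auto
  then have "e \<le> e0" if "genideal (\<O> M) P \<subseteq> ideal_power Q e" for e
    using that e0 ideal_power_antimono[OF QI, of e0 e] by (meson in_mono nat_le_linear)
  then show ?thesis
    unfolding ramification_index_def using gen by (intro Greatest_le_nat[of _ _ e0]) auto
qed

end

section \<open>Total ramification above 3\<close>

lemma int_sq_mod_3:
  fixes x :: int
  assumes "\<not> 3 dvd x"
  obtains y where "x\<^sup>2 = 3 * y + 1"
proof -
  define q where "q = x div 3"
  have "x = 3 * q + 1 \<or> x = 3 * q + 2" using assms unfolding q_def by presburger
  then have "x\<^sup>2 = 3 * (3 * q\<^sup>2 + 2 * q) + 1 \<or> x\<^sup>2 = 3 * (3 * q\<^sup>2 + 4 * q + 1) + 1"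
    by (auto simp: power2_eq_square algebra_simps)
  then show thesis using that by blast
qed

lemma prime_3_int: "Factorial_Ring.prime (3::int)"
  by simp

text \<open>An Eisenstein argument without valuations. The equation puts \<open>y\<close> into
  \<open>Q\<close>; since \<open>(c * d) ^ 2\<close> is 1 modulo 3, it then expresses
  \<open>s\<close> by products of two elements of \<open>Q\<close>, and
  \<open>s ^ 2 = - 3 * d\<close> does the same for 3. Hence the prime \<open>P\<close> below
  \<open>Q\<close> is contained in the square of \<open>Q\<close>, against unramifiedness at a prime
  that does not divide \<open>f\<close>.\<close>

lemma (in quadratic_field) ramified_at_3:
  fixes d c :: int
  assumes m: "m = - 3 * d" and d: "\<not> 3 dvd d" and c: "\<not> 3 dvd c"
    and ext: "abelian_extension K M"
    and unram: "\<And>P. P \<in> primes_of K \<Longrightarrow> of_nat f \<notin> P \<Longrightarrow> unramified_at K M P" and f: "f \<in> {1, 2}"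
    and y: "y \<in> M" "y ^ 3 + s * y\<^sup>2 = s * of_int (c\<^sup>2 * d\<^sup>2)"
  shows False
proof -
  have M: "subfield M CC" "K \<subseteq> M" "CC.finite_dimension K M" using ext by (auto simp: abelian_extension_def)
  obtain T where T: "finite T" "M \<subseteq> QV.span T" using finite_dimension_imp_span[OF M(3)] by blast
  interpret M: number_field M T by (rule number_field.intro[OF M(1) T])
  interpret F: number_field K T by (rule number_field.intro[OF K_subfield T(1) order_trans[OF M(2) T(2)]])
  obtain Q where Q: "maximalideal Q (\<O> M)" "of_int 3 \<in> Q" using M.maximal_ideal_exists[OF prime_3_int] by blast
  have prime: "primeideal Q (\<O> M)" using cring.maximalideal_prime[OF M.OM_cring Q(1)] .
  have QI: "ideal Q (\<O> M)" using prime by (simp add: primeideal_def)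
  note Q_D = M.ideal_OM_D[OF QI]
  have Q_prime: "x \<in> Q \<or> z \<in> Q" if "x \<in> M.OM" "z \<in> M.OM" "x * z \<in> Q" for x z
    using primeideal.I_prime[OF prime] that by (simp add: M.OM_simps)
  have one: "1 \<notin> Q"
    using ideal.one_imp_carrier[OF QI] primeideal.I_notcarr[OF prime] by (auto simp: M.OM_simps)
  have three: "3 \<in> Q" using Q(2) by simp
  have int_Q: "3 dvd n" if "of_int n \<in> Q" for n
  proof (rule ccontr)
    assume "\<not> 3 dvd n"
    then have "Rings.coprime 3 n" using prime_imp_coprime[OF prime_3_int] by blast
    then obtain i j where "i * 3 + j * n = 1" using bezout_int[of 3 n] by auto
    then have "of_int i * 3 + of_int j * of_int n = (1 :: complex)"
      by (metis of_int_1 of_int_add of_int_mult of_int_numeral)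
    moreover have "of_int i * 3 + of_int j * of_int n \<in> Q"
      by (intro Q_D(3) Q_D(4)[OF three] Q_D(4)[OF that] M.OM_closed)
    ultimately show False using one by simp
  qed
  have sM: "s \<in> M.OM" using s_in_K M(2) algebraic_int_s by auto
  \<comment> \<open>The sextic is the product of the cubic equation of \<open>y\<close> with its
    conjugate for \<open>- s\<close>; its coefficients are integers, so \<open>y\<close> is an
    algebraic integer.\<close>
  have poly: "poly (map_poly of_int [:- m * (c\<^sup>2 * d\<^sup>2)\<^sup>2, 0, 2 * m * (c\<^sup>2 * d\<^sup>2), 0, - m, 0, 1:]) y
    = (y ^ 3)\<^sup>2 - of_int m * (of_int (c\<^sup>2 * d\<^sup>2) - y\<^sup>2)\<^sup>2"
    by (simp add: power2_eq_square power3_eq_cube algebra_simps)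
  have "y ^ 3 = s * (of_int (c\<^sup>2 * d\<^sup>2) - y\<^sup>2)" using y(2) by (simp add: algebra_simps)
  then have "(y ^ 3)\<^sup>2 = of_int m * (of_int (c\<^sup>2 * d\<^sup>2) - y\<^sup>2)\<^sup>2" by (simp only: power_mult_distrib s_sq)
  then have "poly (map_poly of_int [:- m * (c\<^sup>2 * d\<^sup>2)\<^sup>2, 0, 2 * m * (c\<^sup>2 * d\<^sup>2), 0, - m, 0, 1:]) y = 0"
    unfolding poly by simp
  then have "algebraic_int y" by (rule algebraic_int_poly) simp
  then have yM: "y \<in> M.OM" using y(1) by simp
  have "s * s = of_int (- d) * 3" using s_sq m by (simp add: power2_eq_square)
  also have "\<dots> \<in> Q" by (intro Q_D(4)[OF three] M.OM_closed)
  finally have "s * s \<in> Q" .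
  then have sQ: "s \<in> Q" using Q_prime[OF sM sM] by blast
  have yQ: "y \<in> Q"
  proof -
    have "y * (y * y) = (of_int (c\<^sup>2 * d\<^sup>2) - y\<^sup>2) * s"
      using y(2) by (simp add: power2_eq_square power3_eq_cube algebra_simps)
    also have "\<dots> \<in> Q" by (intro Q_D(4) sQ M.OM_closed yM)
    finally have "y * (y * y) \<in> Q" .
    then show ?thesis using Q_prime[OF yM] M.OM_closed(4)[OF yM yM] yM by blast
  qed
  define J where "J = M.ideal_power Q 2"
  have "ideal J (\<O> M)" unfolding J_def by (rule M.ideal_power_ideal[OF QI])
  note J_D = M.ideal_OM_D[OF this]
  have J_mult: "x * z \<in> J" if "x \<in> Q" "z \<in> Q" for x z
  proof -
    have "z * 1 \<in> ideal_prod (\<O> M) Q M.OM"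
      using ideal_prod.prod[of z Q 1 M.OM "\<O> M"] that M.OM_closed(2) by (simp add: M.OM_simps)
    then show ?thesis
      using ideal_prod.prod[of x Q z _ "\<O> M"] that by (simp add: J_def numeral_2_eq_2 M.OM_simps)
  qed
  have sJ: "s \<in> J"
  proof -
    have "\<not> 3 dvd c * d" using c d prime_dvd_mult_iff[OF prime_3_int] by blast
    then obtain k where k: "(c * d)\<^sup>2 = 3 * k + 1" by (rule int_sq_mod_3)
    then have "of_int (c\<^sup>2 * d\<^sup>2) = (3 * of_int k + 1 :: complex)"
      by (metis of_int_1 of_int_add of_int_mult of_int_numeral power_mult_distrib)
    then have "s = y * (y * y) + y * (y * s) - of_int k * (3 * s)"
      using y(2) by (simp add: power2_eq_square power3_eq_cube algebra_simps)
    also have "\<dots> \<in> J"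
    proof (intro J_D(5) J_D(3))
      show "y * (y * y) \<in> J" by (intro J_mult yQ Q_D(4) yM)
      show "y * (y * s) \<in> J" by (intro J_mult yQ Q_D(4)[OF sQ] yM)
      show "of_int k * (3 * s) \<in> J" by (intro J_D(4) J_mult three sQ M.OM_closed)
    qed
    finally show ?thesis .
  qed
  have threeJ: "3 \<in> J"
  proof -
    \<comment> \<open>A Bezout identity for 3 and \<open>d\<close>, multiplied by 3, writes 3 as a
      combination of \<open>3 * 3\<close> and \<open>3 * d = - s ^ 2\<close>.\<close>
    have "Rings.coprime 3 d" using d prime_imp_coprime[OF prime_3_int] by blast
    then obtain i j where "i * 3 + j * d = 1" using bezout_int[of 3 d] by auto
    then have "(of_int (i * 3 + j * d) :: complex) = 1" by simp
    then have "3 * (of_int i * 3 + of_int j * of_int d) = (3 :: complex)" by simp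
    then have "of_int i * (3 * 3) + of_int j * (3 * of_int d) = (3 :: complex)" by (simp only: ring_distribs mult_ac)
    moreover have "3 * of_int d = of_int (- 1) * (s * s)" using s_sq m by (simp add: power2_eq_square)
    ultimately have eq: "of_int i * (3 * 3) + of_int j * (of_int (- 1) * (s * s)) = 3" by simp
    have "of_int i * (3 * 3) + of_int j * (of_int (- 1) * (s * s)) \<in> J"
      by (intro J_D(3) J_D(4) J_mult three sQ M.OM_closed)
    then show ?thesis unfolding eq .
  qed
  define P where "P = Q \<inter> K"
  have P_J: "P \<subseteq> J"
  proof
    fix x assume "x \<in> P"
    then have x: "x \<in> Q" "x \<in> K" "algebraic_int x" using Q_D(1) by (auto simp: P_def)
    obtain p q where pq: "x = of_rat p + of_rat q * s" using K_cases[OF x(2)] .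
    obtain A B n :: int where AB: "2 * p = of_int A" "2 * q = of_int B"
      using algebraic_int_half_coeffs x(3) unfolding pq by blast
    have "2 * x = of_rat (2 * p) + of_rat (2 * q) * s" unfolding pq of_rat_mult by simp
    then have x2: "2 * x = of_int A + of_int B * s" unfolding AB by simp
    have "of_int A = of_int 2 * x - of_int B * s" using x2 by simp
    also have "\<dots> \<in> Q" by (intro Q_D(5) Q_D(4) x sQ M.OM_closed)
    finally have "3 dvd A" by (rule int_Q)
    then obtain A' where "A = 3 * A'" by (elim dvdE)
    \<comment> \<open>Writing \<open>x\<close> as \<open>3 * x - 2 * x\<close> keeps the
      half-integral coordinates from entering.\<close>
    then have "x = x * 3 - (of_int A' * 3 + of_int B * s)" using x2 by (simp add: algebra_simps)
    also have "\<dots> \<in> J" using x Q_D(1) by (intro J_D(5) J_D(3) J_D(4) threeJ sJ M.OM_closed) auto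
    finally show "x \<in> J" .
  qed
  have three_P: "3 \<in> P" using three subfield_numeral[OF K_subfield] by (simp add: P_def)
  have "ideal P (\<O> K)"
    using Q_D K_subfield M(2)
    by (intro F.ideal_OM_I) (auto simp: P_def subfield_closed)
  then have "primeideal P (\<O> K)"
  proof (rule primeidealI[OF _ F.OM_cring])
    show "carrier (\<O> K) \<noteq> P" using one F.OM_closed(2) by (auto simp: P_def)
    fix x z assume "x \<in> carrier (\<O> K)" "z \<in> carrier (\<O> K)" "x \<otimes>\<^bsub>\<O> K\<^esub> z \<in> P"
    then show "x \<in> P \<or> z \<in> P" using Q_prime[of x z] M(2) by (auto simp: P_def F.OM_simps)
  qed
  then have P: "P \<in> primes_of K" using three_P by (auto simp: primes_of_def)
  have "of_nat f \<notin> P"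
  proof
    assume "of_nat f \<in> P"
    then have "of_int (int f) \<in> Q" by (simp add: P_def)
    then have "3 dvd int f" by (rule int_Q)
    then show False using f by auto
  qed
  then have "unramified_at K M P" using unram P by blast
  moreover have "Q \<in> primes_above K M P" using prime three by (auto simp: primes_above_def primes_of_def P_def)
  ultimately have "ramification_index M P Q = 1" by (auto simp: unramified_at_def)
  moreover have "ramification_index M P Q \<ge> 2"
    using M.ramification_index_ge_2[OF prime_3_int prime] three_P P_J by (auto simp: J_def)
  ultimately show False by simp
qed

section \<open>The cubic field generated by a cube root of a unit\<close>

text \<open>The assumption \<open>not_cube\<close> is what fundamentality of the unit contributes;
  it makes \<open>v + v'\<close> cubic over the rationals. The root of unity \<open>\<omega>\<close>
  serves to write down the conjugates. The norm \<open>N\<close> may be -1.\<close>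

locale unit_cube_root = quadratic_field d s for d s +
  fixes a b :: rat and N :: int and v v' \<omega> :: complex
  assumes d_not_dvd: "\<not> 3 dvd d"
    and alg_u: "algebraic_int (of_rat a + of_rat b * s)"
    and v: "v ^ 3 = of_rat a + of_rat b * s" and v': "v' ^ 3 = of_rat a - of_rat b * s"
    and vv': "v * v' = of_int N" and N: "N * N = 1"
    and not_cube: "\<And>z. z \<in> K \<Longrightarrow> z ^ 3 \<noteq> of_rat a + of_rat b * s"
    and \<omega>: "\<omega>\<^sup>2 + \<omega> + 1 = 0"
begin

definition "u = of_rat a + of_rat b * s"
definition "u' = of_rat a - of_rat b * s"

text \<open>The pairs \<open>(\<omega>\<^sup>k v, \<omega>\<^sup>-\<^sup>k v')\<close>, one for each embedding of the cubic field.\<close>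

definition root_pair :: "complex \<Rightarrow> complex \<Rightarrow> bool" where
  "root_pair x x' \<longleftrightarrow> x ^ 3 = u \<and> x' ^ 3 = u' \<and> x * x' = of_int N"

lemma \<omega>3: "\<omega> ^ 3 = 1"
proof -
  have "\<omega> ^ 3 - 1 = (\<omega> - 1) * (\<omega>\<^sup>2 + \<omega> + 1)" by (simp add: power2_eq_square power3_eq_cube algebra_simps)
  then show ?thesis using \<omega> by simp
qed

lemma \<omega>_sq: "\<omega>\<^sup>2 = - 1 - \<omega>"
  using \<omega> by (simp add: eq_neg_iff_add_eq_0 algebra_simps)

lemma algebraic_int_\<omega>: "algebraic_int \<omega>"
  by (rule algebraic_int_of_power[of _ 3]) (simp_all add: \<omega>3)

lemma root_pair_v: "root_pair v v'"
  using v v' vv' by (simp add: root_pair_def u_def u'_def)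

lemma root_pair_twist:
  assumes "root_pair x x'"
  shows "root_pair (\<omega> * x) (\<omega>\<^sup>2 * x')" "root_pair (\<omega>\<^sup>2 * x) (\<omega> * x')"
proof -
  have w6: "(\<omega>\<^sup>2) ^ 3 = 1" using \<omega>3 by (metis power_mult power_one mult.commute)
  have "(\<omega> * x) * (\<omega>\<^sup>2 * x') = \<omega> ^ 3 * (x * x')" "(\<omega>\<^sup>2 * x) * (\<omega> * x') = \<omega> ^ 3 * (x * x')"
    by (simp_all only: power2_eq_square power3_eq_cube mult_ac)
  then have "(\<omega> * x) * (\<omega>\<^sup>2 * x') = of_int N" "(\<omega>\<^sup>2 * x) * (\<omega> * x') = of_int N"
    using assms by (simp_all only: \<omega>3 root_pair_def mult_1)
  moreover have "(\<omega> * y) ^ 3 = y ^ 3" "(\<omega>\<^sup>2 * y) ^ 3 = y ^ 3" for y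
    unfolding power_mult_distrib w6 \<omega>3 by simp_all
  ultimately show "root_pair (\<omega> * x) (\<omega>\<^sup>2 * x')" "root_pair (\<omega>\<^sup>2 * x) (\<omega> * x')"
    using assms unfolding root_pair_def by simp_all
qed

lemma NN: "of_int N * of_int N = (1 :: complex)"
  using N by (metis of_int_1 of_int_mult)

lemma uu': "u * u' = of_int N"
proof -
  have "u * u' = (v * v') ^ 3" using root_pair_v unfolding root_pair_def power_mult_distrib by simp
  also have "\<dots> = of_int N" unfolding vv' using NN by (simp add: power3_eq_cube)
  finally show ?thesis .
qed

lemma norm_u: "a\<^sup>2 - b\<^sup>2 * of_int d = of_int N"
proof -
  have "(of_rat (a\<^sup>2 - b\<^sup>2 * of_int d) :: complex) = of_rat a ^ 2 - of_rat b ^ 2 * s\<^sup>2"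
    by (simp add: s_sq of_rat_diff of_rat_mult of_rat_power)
  also have "\<dots> = u * u'" by (simp add: u_def u'_def power2_eq_square algebra_simps)
  also have "\<dots> = of_rat (of_int N)" by (simp add: uu')
  finally show ?thesis by (simp only: of_rat_eq_iff)
qed

text \<open>Otherwise \<open>a\<close> would be 1 or -1 and therefore its own cube, against
  \<open>not_cube\<close>.\<close>

lemma b_nonzero: "b \<noteq> 0"
proof
  assume "b = 0"
  then have "a\<^sup>2 = of_int N" using norm_u by simp
  moreover have "N = 1 \<or> N = - 1" using N zmult_eq_1_iff by blast
  ultimately have "a\<^sup>2 = 1" using zero_le_power2[of a] by (auto simp del: zero_le_power2)
  then have "of_rat a ^ 3 = (of_rat a :: complex)"
    by (metis mult.right_neutral of_rat_power power2_eq_square power3_eq_cube mult.assoc)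
  then show False using not_cube[of "of_rat a"] \<open>b = 0\<close> subfield_of_rat[OF K_subfield] by simp
qed

lemma s_nonzero: "s \<noteq> 0"
  using s_sq no_rat_sqrt[of 0] by auto

lemma u_neq: "u \<noteq> u'"
  using b_nonzero s_nonzero by (simp add: u_def u'_def)

lemma algebraic_int_u: "algebraic_int u" "algebraic_int u'"
  using alg_u algebraic_int_conj by (auto simp: u_def u'_def)

lemma root_pair_nonzero:
  assumes "root_pair x x'"
  shows "x \<noteq> 0" "x' \<noteq> 0"
  using assms NN by (auto simp: root_pair_def)

lemma root_pair_algebraic_int:
  assumes "root_pair x x'"
  shows "algebraic_int x" "algebraic_int x'"
  using assms algebraic_int_u by (auto simp: root_pair_def intro: algebraic_int_of_power[of _ 3])

text \<open>Products of \<open>x\<close> and \<open>x'\<close> thus stay linear in them over the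
  quadratic field; this is the multiplication table behind the coordinates
  \<open>lin\<close>.\<close>

lemma root_pair_sq:
  assumes "root_pair x x'"
  shows "x\<^sup>2 = of_int N * u * x'" "x'\<^sup>2 = of_int N * u' * x"
proof -
  have xx: "x * x' = of_int N" and x3: "x ^ 3 = u" "x' ^ 3 = u'" using assms by (auto simp: root_pair_def)
  have "of_int N * u * x' = of_int N * x\<^sup>2 * (x * x')"
    unfolding x3(1)[symmetric] by (simp add: power2_eq_square power3_eq_cube)
  also have "\<dots> = (of_int N * of_int N) * x\<^sup>2" unfolding xx by (simp only: mult_ac)
  finally show "x\<^sup>2 = of_int N * u * x'" using NN by simp
  have "of_int N * u' * x = of_int N * x'\<^sup>2 * (x * x')"
    unfolding x3(2)[symmetric] by (simp add: power2_eq_square power3_eq_cube)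
  also have "\<dots> = (of_int N * of_int N) * x'\<^sup>2" unfolding xx by (simp only: mult_ac)
  finally show "x'\<^sup>2 = of_int N * u' * x" using NN by simp
qed

text \<open>Cardano's cubic, from
  \<open>(v + v') ^ 3 = 3 * v * v' * (v + v') + v ^ 3 + v' ^ 3\<close>.\<close>

definition minpoly :: "rat poly" where
  "minpoly = [:- 2 * a, - 3 * of_int N, 0, 1:]"

lemma rat_eval_minpoly': "rat_eval z minpoly = z ^ 3 - 3 * of_int N * z - 2 * of_rat a"
  by (simp add: minpoly_def power3_eq_cube algebra_simps of_rat_minus of_rat_mult)

lemma rat_eval_minpoly_factor:
  "rat_eval z minpoly = (z - (v + v')) * (z - (\<omega> * v + \<omega>\<^sup>2 * v')) * (z - (\<omega>\<^sup>2 * v + \<omega> * v'))"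
proof -
  have cardano: "(z - (p + q)) * (z - (\<omega> * p + \<omega>\<^sup>2 * q)) * (z - (\<omega>\<^sup>2 * p + \<omega> * q))
      = z ^ 3 - 3 * (p * q) * z - (p ^ 3 + q ^ 3)" for p q
  proof -
    have 1: "(z - (\<omega> * p + \<omega>\<^sup>2 * q)) * (z - (\<omega>\<^sup>2 * p + \<omega> * q))
      = z\<^sup>2 - (\<omega>\<^sup>2 + \<omega>) * (p + q) * z + \<omega> ^ 3 * (p\<^sup>2 + q\<^sup>2) + (\<omega>\<^sup>2 + \<omega> * \<omega> ^ 3) * (p * q)"
      by (simp add: power2_eq_square power3_eq_cube algebra_simps)
    have 2: "\<omega>\<^sup>2 + \<omega> = - 1" by (simp add: \<omega>_sq)
    have "(z - (\<omega> * p + \<omega>\<^sup>2 * q)) * (z - (\<omega>\<^sup>2 * p + \<omega> * q)) = z\<^sup>2 + (p + q) * z + (p\<^sup>2 + q\<^sup>2) - p * q"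
      unfolding 1 \<omega>3 mult_1_right 2 by (simp add: algebra_simps)
    then show ?thesis by (simp add: mult.assoc) (simp add: power2_eq_square power3_eq_cube algebra_simps)
  qed
  have "v ^ 3 + v' ^ 3 = 2 * of_rat a" by (simp add: v v')
  then show ?thesis unfolding cardano rat_eval_minpoly' vv' by simp
qed

text \<open>A rational sum \<open>q\<close> gives \<open>(x - x') * (q ^ 2 - N) = u - u'\<close>, so
  that \<open>x - x'\<close> and then \<open>x\<close> lie in \<open>K\<close>, making
  \<open>u\<close> a cube there.\<close>

lemma sum_root_pair_not_rat:
  assumes x: "root_pair x x'"
  shows "x + x' \<noteq> of_rat q"
proof
  assume eq: "x + x' = of_rat q"
  have xx: "x * x' = of_int N" and x3: "x ^ 3 = u" "x' ^ 3 = u'" using x by (auto simp: root_pair_def)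
  have "(x - x') * ((x + x')\<^sup>2 - x * x') = x ^ 3 - x' ^ 3"
    by (simp add: power2_eq_square power3_eq_cube algebra_simps)
  also have "\<dots> = 2 * of_rat b * s" unfolding x3 by (simp add: u_def u'_def)
  finally have diff: "(x - x') * of_rat (q\<^sup>2 - of_int N) = 2 * of_rat b * s"
    unfolding eq xx by (simp add: of_rat_diff of_rat_power)
  have nz: "(of_rat (q\<^sup>2 - of_int N) :: complex) \<noteq> 0"
    using diff b_nonzero s_nonzero by auto
  have "x = (of_rat q + (x - x')) / 2" using eq[symmetric] by simp
  also have "x - x' = 2 * of_rat b * s / of_rat (q\<^sup>2 - of_int N)"
    using diff nz by (simp add: eq_divide_eq)
  also have "(of_rat q + 2 * of_rat b * s / of_rat (q\<^sup>2 - of_int N)) / 2 \<in> K"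
    by (intro subfield_closed K_subfield s_in_K)
  finally have "x \<in> K" .
  then show False using not_cube x3(1) by (simp add: u_def)
qed

lemma irreducible_minpoly: "Factorial_Ring.irreducible minpoly"
proof (rule irreducible_if_no_root)
  have "rat_eval (of_rat x) minpoly \<noteq> 0" for x
    using sum_root_pair_not_rat[OF root_pair_v, of x] sum_root_pair_not_rat[OF root_pair_twist(1)[OF root_pair_v], of x]
      sum_root_pair_not_rat[OF root_pair_twist(2)[OF root_pair_v], of x]
    unfolding rat_eval_minpoly_factor by auto
  moreover have "rat_eval (of_rat x) q = of_rat (poly q x)" for x q
    by (induction q) (auto simp: of_rat_add of_rat_mult)
  ultimately show "\<forall>x. poly minpoly x \<noteq> 0" by (metis of_rat_0)
qed (simp_all add: minpoly_def)

abbreviation "E \<equiv> Q_adjoin (v + v')"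

lemma E_subfield: "subfield E CC"
  by (rule subfield_Q_adjoin)

lemma minpoly_root: "rat_eval (v + v') minpoly = 0"
  unfolding rat_eval_minpoly_factor by simp

text \<open>The three roots are distinct because the difference of two of them is a nonzero multiple
  of \<open>y - y'\<close> for some root pair, and the cubes \<open>u\<close> and \<open>u'\<close>
  of a pair differ.\<close>

lemma embedding_list:
  obtains \<sigma>0 \<sigma>1 \<sigma>2 where "distinct [\<sigma>0, \<sigma>1, \<sigma>2]" "set [\<sigma>0, \<sigma>1, \<sigma>2] = embeddings E"
    "\<sigma>0 (v + v') = v + v'" "\<sigma>1 (v + v') = \<omega> * v + \<omega>\<^sup>2 * v'" "\<sigma>2 (v + v') = \<omega>\<^sup>2 * v + \<omega> * v'"
proof -
  let ?rs = "[v + v', \<omega> * v + \<omega>\<^sup>2 * v', \<omega>\<^sup>2 * v + \<omega> * v']"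
  have v_neq: "x \<noteq> x'" if "root_pair x x'" for x x'
    using that u_neq by (auto simp: root_pair_def)
  have w1: "1 - \<omega> \<noteq> 0"
  proof
    assume "1 - \<omega> = 0"
    then have "\<omega> = 1" by simp
    then show False using \<omega> by simp
  qed
  have fac: "(x + x') - (\<omega> * x + \<omega>\<^sup>2 * x') = (1 - \<omega>) * \<omega> * (\<omega>\<^sup>2 * x - \<omega> * x')" for x x'
  proof -
    have "(1 - \<omega>) * \<omega> * (\<omega>\<^sup>2 * x - \<omega> * x') = (\<omega> ^ 3 - \<omega> ^ 3 * \<omega>) * x - (\<omega>\<^sup>2 - \<omega> ^ 3) * x'"
      by (simp add: power2_eq_square power3_eq_cube algebra_simps)
    also have "\<dots> = (1 - \<omega>) * x + (1 - \<omega>\<^sup>2) * x'" unfolding \<omega>3 by (simp add: algebra_simps)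
    finally show ?thesis by (simp add: algebra_simps)
  qed
  have w0: "\<omega> \<noteq> 0" using \<omega> by auto
  have neq: "x + x' \<noteq> \<omega> * x + \<omega>\<^sup>2 * x'" if "root_pair x x'" for x x'
    using v_neq[OF root_pair_twist(2)[OF that]] w0 w1 fac[of x x'] by auto
  have w22: "\<omega>\<^sup>2 * (\<omega>\<^sup>2 * z) = \<omega> * z" "\<omega> * (\<omega>\<^sup>2 * z) = z" "\<omega>\<^sup>2 * (\<omega> * z) = z" for z
  proof -
    have "\<omega>\<^sup>2 * (\<omega>\<^sup>2 * z) = \<omega> ^ 3 * (\<omega> * z)" "\<omega> * (\<omega>\<^sup>2 * z) = \<omega> ^ 3 * z" "\<omega>\<^sup>2 * (\<omega> * z) = \<omega> ^ 3 * z"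
      by (simp_all only: power2_eq_square power3_eq_cube mult_ac)
    then show "\<omega>\<^sup>2 * (\<omega>\<^sup>2 * z) = \<omega> * z" "\<omega> * (\<omega>\<^sup>2 * z) = z" "\<omega>\<^sup>2 * (\<omega> * z) = z"
      unfolding \<omega>3 by simp_all
  qed
  have w11: "\<omega> * (\<omega> * z) = \<omega>\<^sup>2 * z" for z by (simp add: power2_eq_square)
  have "v + v' \<noteq> \<omega> * v + \<omega>\<^sup>2 * v'" by (rule neq[OF root_pair_v])
  moreover have "\<omega> * v + \<omega>\<^sup>2 * v' \<noteq> \<omega>\<^sup>2 * v + \<omega> * v'"
    using neq[OF root_pair_twist(1)[OF root_pair_v]] unfolding w22 w11 .
  moreover have "\<omega>\<^sup>2 * v + \<omega> * v' \<noteq> v + v'"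
    using neq[OF root_pair_twist(2)[OF root_pair_v]] unfolding w22 .
  ultimately have "distinct ?rs" by auto
  moreover have "set ?rs = {r. rat_eval r minpoly = 0}" unfolding rat_eval_minpoly_factor by auto
  ultimately obtain \<sigma>s where \<sigma>s: "distinct \<sigma>s" "set \<sigma>s = embeddings E" "map (\<lambda>\<sigma>. \<sigma> (v + v')) \<sigma>s = ?rs"
    by (rule embeddings_Q_adjoin[OF irreducible_minpoly minpoly_root])
  from \<sigma>s(3) obtain \<sigma>0 \<sigma>1 \<sigma>2 where "\<sigma>s = [\<sigma>0, \<sigma>1, \<sigma>2]" "\<sigma>0 (v + v') = v + v'"
    "\<sigma>1 (v + v') = \<omega> * v + \<omega>\<^sup>2 * v'" "\<sigma>2 (v + v') = \<omega>\<^sup>2 * v + \<omega> * v'" by auto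
  then show thesis using that \<sigma>s by blast
qed

text \<open>A rational number plus \<open>f * y\<close> and its conjugate, with \<open>f\<close> in
  \<open>K\<close>. The coordinates are separated from the pair because an embedding of
  \<open>E\<close> fixes them and only moves \<open>(v, v')\<close> to another root pair.\<close>

definition lin :: "rat \<Rightarrow> rat \<Rightarrow> rat \<Rightarrow> complex \<Rightarrow> complex \<Rightarrow> complex" where
  "lin x p r y y' = of_rat x + (of_rat p + of_rat r * s) * y + (of_rat p - of_rat r * s) * y'"

text \<open>The induction multiplies \<open>lin x p r\<close> by \<open>y + y'\<close> and reduces
  squares by \<open>y ^ 2 = N * u * y'\<close>. The resulting coordinates are the same for every
  root pair, which is what makes embeddings act on the pair alone.\<close>

lemma rat_eval_eq_lin:
  "\<exists>x p r. \<forall>y y'. root_pair y y' \<longrightarrow> rat_eval (y + y') q = lin x p r y y'"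
proof (induction q)
  case 0
  show ?case by (intro exI[of _ 0]) (simp add: lin_def)
next
  case (pCons c q)
  then obtain x p r where IH: "\<And>y y'. root_pair y y' \<Longrightarrow> rat_eval (y + y') q = lin x p r y y'" by blast
  have "rat_eval (y + y') (pCons c q) =
    lin (c + 2 * p * of_int N) (x + of_int N * (a * p + b * r * of_int d)) (- of_int N * (a * r + b * p)) y y'"
    if y: "root_pair y y'" for y y'
  proof -
    have yy': "y * y' = of_int N" using y by (simp add: root_pair_def)
    let ?f = "of_rat p + of_rat r * s" and ?g = "of_rat p - of_rat r * s"
    have "rat_eval (y + y') (pCons c q) = of_rat c + (y + y') * (of_rat x + ?f * y + ?g * y')"
      using IH[OF y] by (simp add: lin_def)
    also have "\<dots> = of_rat c + of_rat x * (y + y') + (?f + ?g) * (y * y') + ?f * y\<^sup>2 + ?g * y'\<^sup>2"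
      by (simp add: power2_eq_square algebra_simps)
    also have "\<dots> = (of_rat c + 2 * of_rat p * of_int N) + (of_rat x + of_int N * (?g * u')) * y
        + (of_rat x + of_int N * (?f * u)) * y'"
      unfolding root_pair_sq[OF y] yy' by (simp add: algebra_simps)
    also have "?g * u' = of_rat a * of_rat p + of_rat b * of_rat r * s\<^sup>2 - (of_rat a * of_rat r + of_rat b * of_rat p) * s"
      by (simp add: u'_def power2_eq_square algebra_simps)
    also have "?f * u = of_rat a * of_rat p + of_rat b * of_rat r * s\<^sup>2 + (of_rat a * of_rat r + of_rat b * of_rat p) * s"
      by (simp add: u_def power2_eq_square algebra_simps)
    finally have eq: "rat_eval (y + y') (pCons c q) = (of_rat c + 2 * of_rat p * of_int N)
        + (of_rat x + of_int N * (of_rat a * of_rat p + of_rat b * of_rat r * s\<^sup>2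
            - (of_rat a * of_rat r + of_rat b * of_rat p) * s)) * y
        + (of_rat x + of_int N * (of_rat a * of_rat p + of_rat b * of_rat r * s\<^sup>2
            + (of_rat a * of_rat r + of_rat b * of_rat p) * s)) * y'" .
    show ?thesis
      unfolding eq s_sq lin_def by (simp add: of_rat_add of_rat_mult of_rat_minus of_rat_diff algebra_simps)
  qed
  then show ?case by blast
qed

text \<open>It is enough to express \<open>s * (y - y')\<close> by \<open>t = y + y'\<close>.
  Comparing \<open>y ^ 2 + y' ^ 2 = t ^ 2 - 2 * N\<close> with the reduction of the two squares does
  this, at the price of dividing by \<open>b\<close>.\<close>

lemma lin_eq_rat_eval:
  "\<exists>q. \<forall>y y'. root_pair y y' \<longrightarrow> rat_eval (y + y') q = lin x p r y y'"
proof (intro exI allI impI)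
  fix y y' assume y: "root_pair y y'"
  have yy': "y * y' = of_int N" using y by (simp add: root_pair_def)
  have b0: "(of_rat b :: complex) \<noteq> 0" using b_nonzero by simp
  have "y\<^sup>2 + y'\<^sup>2 = of_int N * (of_rat a * (y + y') - of_rat b * (s * (y - y')))"
    unfolding root_pair_sq[OF y] by (simp add: u_def u'_def algebra_simps)
  then have "of_int N * (y\<^sup>2 + y'\<^sup>2) = (of_int N * of_int N) * (of_rat a * (y + y') - of_rat b * (s * (y - y')))"
    by (simp only: mult.assoc)
  then have "of_rat b * (s * (y - y')) = of_rat a * (y + y') - of_int N * (y\<^sup>2 + y'\<^sup>2)"
    unfolding NN by simp
  also have "y\<^sup>2 + y'\<^sup>2 = (y + y')\<^sup>2 - 2 * of_int N"
    unfolding yy'[symmetric] by (simp add: power2_eq_square algebra_simps)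
  also have "of_int N * ((y + y')\<^sup>2 - 2 * of_int N) = of_int N * (y + y')\<^sup>2 - 2 * (of_int N * of_int N)"
    by (simp add: algebra_simps)
  finally have "of_rat b * (s * (y - y')) = of_rat a * (y + y') - of_int N * (y + y')\<^sup>2 + 2" unfolding NN by simp
  then have key: "s * (y - y') = (of_rat a * (y + y') - of_int N * (y + y')\<^sup>2 + 2) / of_rat b"
    using b0 by (simp add: eq_divide_eq mult.commute)
  define t where "t = y + y'"
  have "lin x p r y y' = of_rat x + of_rat p * t + of_rat r * (s * (y - y'))"
    by (simp add: lin_def t_def algebra_simps)
  also have "\<dots> = of_rat x + of_rat p * t + of_rat r / of_rat b * (2 + of_rat a * t - of_int N * t\<^sup>2)"
    unfolding key t_def[symmetric] by (simp add: add_divide_distrib diff_divide_distrib algebra_simps)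
  also have "2 + of_rat a * t - of_int N * t\<^sup>2 = rat_eval t [:2, a, - of_int N:]"
    by (simp add: of_rat_minus power2_eq_square algebra_simps)
  also have "of_rat x + of_rat p * t + of_rat r / of_rat b * rat_eval t [:2, a, - of_int N:]
      = rat_eval t ([:x, p:] + smult (r / b) [:2, a, - of_int N:])"
    by (simp only: rat_eval_add rat_eval_smult of_rat_divide) (simp add: mult.commute)
  finally show "rat_eval (y + y') ([:x, p:] + smult (r / b) [:2, a, - of_int N:]) = lin x p r y y'"
    unfolding t_def by (rule sym)
qed

lemma E_cases:
  assumes "z \<in> E"
  obtains x p r where "z = lin x p r v v'"
  using assms rat_eval_eq_lin root_pair_v unfolding Q_adjoin_eq[OF irreducible_minpoly minpoly_root] by (metis rangeE)

lemma lin_in_E: "lin x p r v v' \<in> E"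
  using lin_eq_rat_eval[of x p r] root_pair_v subfield_rat_eval[OF E_subfield Q_adjoin_self] by metis

lemma embedding_lin:
  assumes "\<sigma> \<in> embeddings E" "\<sigma> (v + v') = y + y'" "root_pair y y'"
  shows "\<sigma> (lin x p r v v') = lin x p r y y'"
proof -
  obtain q where "\<forall>y y'. root_pair y y' \<longrightarrow> rat_eval (y + y') q = lin x p r y y'"
    using lin_eq_rat_eval by blast
  then show ?thesis
    using embedding_rat_eval[OF assms(1) E_subfield Q_adjoin_self, of q] assms(2,3) root_pair_v by metis
qed

lemma root_pair_embedding:
  assumes y: "root_pair y y'"
  obtains \<sigma> where "\<sigma> \<in> embeddings E" "\<And>x p r. \<sigma> (lin x p r v v') = lin x p r y y'"
proof -
  have "(y + y') ^ 3 = y ^ 3 + y' ^ 3 + 3 * (y * y') * (y + y')"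
    by (simp add: power3_eq_cube algebra_simps)
  then have "rat_eval (y + y') minpoly = 0"
    using y unfolding rat_eval_minpoly' by (simp add: root_pair_def u_def u'_def)
  then obtain \<sigma> where \<sigma>: "\<sigma> \<in> embeddings E" "\<sigma> (v + v') = y + y'"
    by (rule embedding_exists[OF irreducible_minpoly minpoly_root])
  show thesis by (rule that[OF \<sigma>(1) embedding_lin[OF \<sigma> y]])
qed

lemma algebraic_int_lin_root_pair:
  assumes "root_pair y y'" "algebraic_int (lin x p r v v')"
  shows "algebraic_int (lin x p r y y')"
  by (rule root_pair_embedding[OF assms(1)]) (metis algebraic_int_embedding E_subfield lin_in_E assms(2))

text \<open>Sums over the conjugates, weighted by cube roots of unity, isolate the rational
  coordinate and the coefficient of \<open>v\<close>, each multiplied by 3. Applied to an integral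
  element they bound the denominators.\<close>

lemma sum_lin_twists:
  "lin x p r v v' + lin x p r (\<omega> * v) (\<omega>\<^sup>2 * v') + lin x p r (\<omega>\<^sup>2 * v) (\<omega> * v') = of_rat (3 * x)"
  "lin x p r v v' + \<omega>\<^sup>2 * lin x p r (\<omega> * v) (\<omega>\<^sup>2 * v') + \<omega> * lin x p r (\<omega>\<^sup>2 * v) (\<omega> * v')
    = of_rat 3 * (of_rat p + of_rat r * s) * v"
proof -
  define f g where "f = (of_rat p + of_rat r * s) * v" and "g = (of_rat p - of_rat r * s) * v'"
  have "lin x p r v v' + lin x p r (\<omega> * v) (\<omega>\<^sup>2 * v') + lin x p r (\<omega>\<^sup>2 * v) (\<omega> * v')
      = of_rat (3 * x) + (\<omega>\<^sup>2 + \<omega> + 1) * (f + g)"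
    by (simp add: lin_def f_def g_def of_rat_mult algebra_simps)
  then show "lin x p r v v' + lin x p r (\<omega> * v) (\<omega>\<^sup>2 * v') + lin x p r (\<omega>\<^sup>2 * v) (\<omega> * v') = of_rat (3 * x)"
    using \<omega> by simp
  have "lin x p r v v' + \<omega>\<^sup>2 * lin x p r (\<omega> * v) (\<omega>\<^sup>2 * v') + \<omega> * lin x p r (\<omega>\<^sup>2 * v) (\<omega> * v')
      = of_rat x * (\<omega>\<^sup>2 + \<omega> + 1) + f * (1 + 2 * \<omega> ^ 3) + g * (1 + \<omega> ^ 3 * \<omega> + \<omega>\<^sup>2)"
    by (simp add: lin_def f_def g_def algebra_simps power2_eq_square power3_eq_cube)
  also have "\<dots> = f * 3 + g * (\<omega>\<^sup>2 + \<omega> + 1)" unfolding \<omega>3 \<omega> by (simp add: \<omega>_sq)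
  finally show "lin x p r v v' + \<omega>\<^sup>2 * lin x p r (\<omega> * v) (\<omega>\<^sup>2 * v') + \<omega> * lin x p r (\<omega>\<^sup>2 * v) (\<omega> * v')
    = of_rat 3 * (of_rat p + of_rat r * s) * v"
    unfolding \<omega> by (simp add: f_def)
qed

text \<open>The number \<open>v\<close> is a unit with inverse
  \<open>v ^ 2 * u' * N\<close>.\<close>

lemma algebraic_int_cancel_v:
  assumes "algebraic_int (z * v)"
  shows "algebraic_int z"
proof -
  have "z = z * (u * u') * of_int N" using NN uu' by simp
  also have "\<dots> = z * v * (v\<^sup>2 * u' * of_int N)"
    using root_pair_v by (simp add: root_pair_def power2_eq_square power3_eq_cube mult_ac)
  finally show ?thesis using assms algebraic_int_u root_pair_algebraic_int[OF root_pair_v]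
    by (metis algebraic_int_mult algebraic_int_of_int algebraic_int_power)
qed

text \<open>Embeddings carry the vanishing to the twisted pairs, so the weighted sums vanish as
  well.\<close>

lemma lin_eq_0:
  assumes "lin x p r v v' = 0"
  shows "x = 0" "p = 0" "r = 0"
proof -
  have "lin x p r y y' = 0" if "root_pair y y'" for y y'
    by (rule root_pair_embedding[OF that]) (metis embedding_0 E_subfield assms)
  then have tw: "lin x p r (\<omega> * v) (\<omega>\<^sup>2 * v') = 0" "lin x p r (\<omega>\<^sup>2 * v) (\<omega> * v') = 0"
    using root_pair_twist[OF root_pair_v] by auto
  have "(of_rat (3 * x) :: complex) = 0" using sum_lin_twists(1)[of x p r] assms tw by simp
  then show "x = 0" by simp
  have "of_rat 3 * (of_rat p + of_rat r * s) * v = 0"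
    using sum_lin_twists(2)[of x p r, unfolded assms tw] by (metis add_0 mult_zero_right)
  moreover have "of_rat 3 \<noteq> (0 :: complex)" by simp
  ultimately have "of_rat p + of_rat r * s = 0"
    using root_pair_nonzero[OF root_pair_v] by (metis mult_eq_0_iff)
  then show "p = 0" "r = 0" by (rule rat_coeffs_eq_0)+
qed

section \<open>The element \<theta> and its cubic equation\<close>

definition "\<theta> = (1 + v ^ 8 + v' ^ 8) / 3"

lemma half_coeffs:
  obtains A B :: int where "2 * a = of_int A" "2 * b = of_int B" "A\<^sup>2 - d * B\<^sup>2 = 4 * N"
proof -
  obtain A B n :: int where AB: "2 * a = of_int A" "2 * b = of_int B" "A\<^sup>2 - d * B\<^sup>2 = 4 * n"
    using algebraic_int_half_coeffs[OF alg_u] by blast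
  have "(of_int (A\<^sup>2 - d * B\<^sup>2) :: rat) = (2 * a)\<^sup>2 - of_int d * (2 * b)\<^sup>2" unfolding AB(1,2) by simp
  also have "\<dots> = 4 * (a\<^sup>2 - b\<^sup>2 * of_int d)" by (simp add: power2_eq_square algebra_simps)
  also have "\<dots> = of_int (4 * N)" unfolding norm_u by simp
  finally have "A\<^sup>2 - d * B\<^sup>2 = 4 * N" by (simp only: of_int_eq_iff)
  then show thesis using that AB by blast
qed

text \<open>The product is the number \<open>e\<close> below, with
  \<open>u ^ 8 - 1 = u ^ 4 * e * s\<close>. If 3 divides neither \<open>A\<close> nor
  \<open>B\<close>, their squares are 1 modulo 3; then \<open>N = 1\<close> would make 3 divide
  \<open>d\<close>, and for \<open>N = - 1\<close> the last factor is
  \<open>A ^ 2 + 2\<close>.\<close>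

lemma three_dvd_trace_product:
  fixes A B :: int
  assumes AB: "A\<^sup>2 - d * B\<^sup>2 = 4 * N"
  shows "3 dvd A * B * (A\<^sup>2 - 2 * N)"
proof (cases "3 dvd A \<or> 3 dvd B")
  case False
  then obtain x y where x: "A\<^sup>2 = 3 * x + 1" and y: "B\<^sup>2 = 3 * y + 1" using int_sq_mod_3 by metis
  have eq: "3 * x + 1 - d - 3 * (d * y) = 4 * N" using AB unfolding x y by (simp add: algebra_simps)
  have "N \<noteq> 1"
  proof
    assume "N = 1"
    then have "d = 3 * (x - 1 - d * y)" using eq by simp
    then show False using d_not_dvd by (metis dvd_triv_left)
  qed
  then have "N = - 1" using N zmult_eq_1_iff by blast
  then have "A\<^sup>2 - 2 * N = 3 * (x + 1)" using x by simp
  then show ?thesis by simp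
qed auto

text \<open>
  This is the equation \<open>\<tau>\<^sup>3 - 3 \<tau> = u\<^sup>8 + u'\<^sup>8\<close> of \<open>\<tau> = v\<^sup>8 + v'\<^sup>8 = 3 \<theta> - 1\<close>; the number \<open>e\<close> is
  \<open>(u\<^sup>4 - u'\<^sup>4) / \<surd>d\<close>.
\<close>

lemma cubic_defect:
  obtains e :: int where "3 dvd e" "(3 * \<theta>) ^ 3 - 3 * (3 * \<theta>)\<^sup>2 = of_int d * (of_int e)\<^sup>2"
proof -
  obtain A B :: int where AB: "2 * a = of_int A" "2 * b = of_int B" "A\<^sup>2 - d * B\<^sup>2 = 4 * N"
    by (rule half_coeffs)
  have sum: "u + u' = of_int A"
  proof -
    have "u + u' = of_rat (2 * a)" by (simp add: u_def u'_def of_rat_mult)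
    then show ?thesis unfolding AB by simp
  qed
  have diff: "u - u' = of_int B * s"
  proof -
    have "u - u' = of_rat (2 * b) * s" by (simp add: u_def u'_def of_rat_mult)
    then show ?thesis unfolding AB by simp
  qed
  define e where "e = A * B * (A\<^sup>2 - 2 * N)"
  have p8: "x ^ 8 = (x ^ 4)\<^sup>2" for x :: complex by (simp flip: power_mult)
  have "u ^ 4 - u' ^ 4 = (u + u') * (u - u') * ((u + u')\<^sup>2 - 2 * (u * u'))"
    by (simp add: power2_eq_square power4_eq_xxxx algebra_simps)
  also have "\<dots> = of_int e * s" unfolding sum diff uu' by (simp add: e_def)
  finally have "(u ^ 4 - u' ^ 4)\<^sup>2 = (of_int e)\<^sup>2 * of_int d" by (simp add: power_mult_distrib s_sq)
  moreover have "(u ^ 4 - u' ^ 4)\<^sup>2 = u ^ 8 + u' ^ 8 - 2 * (u * u') ^ 4"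
    unfolding p8 power_mult_distrib by (simp add: power2_eq_square algebra_simps)
  moreover have N2: "(of_int N)\<^sup>2 = (1 :: complex)" using NN by (simp add: power2_eq_square)
  then have N4: "(of_int N) ^ 4 = (1 :: complex)" using power_mult[of "of_int N :: complex" 2 2] by simp
  have N8: "(of_int N) ^ 8 = (1 :: complex)" using power_mult[of "of_int N :: complex" 2 4] N2 by simp
  ultimately have u8: "u ^ 8 + u' ^ 8 - 2 = of_int d * (of_int e)\<^sup>2"
    unfolding uu' N4 by (metis mult.commute mult_1_right)
  define x y where "x = v ^ 8" and "y = v' ^ 8"
  have "x ^ 3 = (v ^ 3) ^ 8" "y ^ 3 = (v' ^ 3) ^ 8" by (simp_all add: x_def y_def flip: power_mult)
  then have "x ^ 3 = u ^ 8" "y ^ 3 = u' ^ 8" using root_pair_v unfolding root_pair_def by metis+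
  moreover have "x * y = 1" unfolding x_def y_def power_mult_distrib[symmetric] vv' N8 ..
  moreover have "(3 * \<theta>) ^ 3 - 3 * (3 * \<theta>)\<^sup>2 = x ^ 3 + y ^ 3 - 2 + 3 * (x * y - 1) * (x + y)"
    by (simp add: \<theta>_def x_def[symmetric] y_def[symmetric] power2_eq_square power3_eq_cube algebra_simps)
  ultimately have "(3 * \<theta>) ^ 3 - 3 * (3 * \<theta>)\<^sup>2 = of_int d * (of_int e)\<^sup>2" using u8 by simp
  moreover have "3 dvd e" unfolding e_def by (rule three_dvd_trace_product[OF AB(3)])
  ultimately show thesis using that by blast
qed

lemma lin_add: "lin x p r y y' + lin x2 p2 r2 y y' = lin (x + x2) (p + p2) (r + r2) y y'"
  by (simp add: lin_def of_rat_add algebra_simps)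

lemma lin_scale: "of_rat k * lin x p r y y' = lin (k * x) (k * p) (k * r) y y'"
  by (simp add: lin_def of_rat_mult algebra_simps)

text \<open>From \<open>v' ^ 8 = N * u' ^ 3 * v\<close>, the coefficient of \<open>v\<close> in
  \<open>3 * \<theta>\<close> is the algebraic integer \<open>N * u' ^ 3\<close>. The rational
  coordinate 1/3 lets multiples of \<open>\<theta>\<close> absorb the rational parts of the integers
  of \<open>E\<close>.\<close>

lemma theta_eq_lin:
  obtains p r where "\<theta> = lin (1 / 3) (p / 3) (r / 3) v v'" "algebraic_int (of_rat p + of_rat r * s)"
proof -
  have "u ^ 3 \<in> K" unfolding u_def by (intro subfield_closed K_subfield s_in_K)
  then obtain p r where pr: "u ^ 3 = of_rat p + of_rat r * s" by (rule K_cases)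
  obtain \<sigma> where \<sigma>: "\<sigma> \<in> embeddings K" "\<And>p q. \<sigma> (of_rat p + of_rat q * s) = of_rat p - of_rat q * s"
    using conj_embedding by blast
  have uK: "u \<in> K" unfolding u_def by (intro subfield_closed K_subfield s_in_K)
  have "\<sigma> (u ^ 3) = \<sigma> u ^ 3"
    using uK by (simp add: power3_eq_cube embeddingsD(2)[OF \<sigma>(1)] subfield_mult[OF K_subfield])
  then have pr': "u' ^ 3 = of_rat p - of_rat r * s" unfolding pr \<sigma>(2) by (simp add: u_def u'_def \<sigma>(2))
  have "v ^ 8 = (v ^ 3)\<^sup>2 * v\<^sup>2" "v' ^ 8 = (v' ^ 3)\<^sup>2 * v'\<^sup>2" by (simp_all flip: power_mult power_add)
  then have "v ^ 8 = of_int N * u ^ 3 * v'" "v' ^ 8 = of_int N * u' ^ 3 * v"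
    using root_pair_v unfolding root_pair_sq[OF root_pair_v]
    by (simp_all add: root_pair_def power2_eq_square power3_eq_cube mult_ac)
  then have "\<theta> = lin (1 / 3) (of_int N * p / 3) (- (of_int N * r) / 3) v v'"
    by (simp add: \<theta>_def pr pr' lin_def of_rat_divide of_rat_mult of_rat_minus add_divide_distrib diff_divide_distrib
        algebra_simps)
  moreover have "of_rat (of_int N * p) + of_rat (- (of_int N * r)) * s = of_int N * u' ^ 3"
    by (simp add: pr' of_rat_mult of_rat_minus algebra_simps)
  then have "algebraic_int (of_rat (of_int N * p) + of_rat (- (of_int N * r)) * s)"
    using algebraic_int_u by auto
  ultimately show thesis using that by blast
qed

section \<open>The discriminant of the cubic field\<close>

text \<open>Put \<open>f = p + r s\<close>, \<open>g = f v / 3\<close> and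
  \<open>h = f' v' / 3\<close>. Symmetric functions of the conjugates of \<open>g + h\<close> show
  that \<open>3 g h\<close> and \<open>g ^ 3 + h ^ 3\<close> are integral, which makes
  \<open>f ^ 2 / 3\<close> integral. As 3 does not divide \<open>d\<close>, it is unramified in
  \<open>K\<close>, so 3 divides \<open>f\<close> itself.\<close>

lemma third_integral:
  assumes y: "algebraic_int (of_rat p + of_rat r * s)" and z: "algebraic_int (lin 0 (p / 3) (r / 3) v v')"
  shows "algebraic_int ((of_rat p + of_rat r * s) / 3)"
proof -
  obtain A B n :: int where AB: "2 * p = of_int A" "2 * r = of_int B" "A\<^sup>2 - d * B\<^sup>2 = 4 * n"
    using algebraic_int_half_coeffs[OF y] by blast
  define f f' where "f = of_rat p + of_rat r * s" and "f' = of_rat p - of_rat r * s"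
  have f2: "2 * f = of_int A + of_int B * s" "2 * f' = of_int A - of_int B * s"
  proof -
    have "2 * f = of_rat (2 * p) + of_rat (2 * r) * s" "2 * f' = of_rat (2 * p) - of_rat (2 * r) * s"
      by (simp_all add: f_def f'_def of_rat_mult algebra_simps)
    then show "2 * f = of_int A + of_int B * s" "2 * f' = of_int A - of_int B * s" unfolding AB by simp_all
  qed
  have "4 * (f * f') = (2 * f) * (2 * f')" by simp
  also have "\<dots> = of_int (A\<^sup>2) - of_int (B\<^sup>2) * s\<^sup>2" unfolding f2 by (simp add: power2_eq_square algebra_simps)
  also have "\<dots> = of_int (A\<^sup>2 - d * B\<^sup>2)" by (simp add: s_sq)
  also have "\<dots> = 4 * of_int n" unfolding AB by simp
  finally have ff': "f * f' = of_int n" by simp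
  define g h where "g = f * v / 3" and "h = f' * v' / 3"
  have lin_gh: "lin 0 (p / 3) (r / 3) v v' = g + h"
    "lin 0 (p / 3) (r / 3) (\<omega> * v) (\<omega>\<^sup>2 * v') = \<omega> * g + \<omega>\<^sup>2 * h"
    "lin 0 (p / 3) (r / 3) (\<omega>\<^sup>2 * v) (\<omega> * v') = \<omega>\<^sup>2 * g + \<omega> * h"
    by (simp_all add: lin_def g_def h_def f_def f'_def of_rat_divide add_divide_distrib diff_divide_distrib algebra_simps)
  have alg: "algebraic_int (g + h)" "algebraic_int (\<omega> * g + \<omega>\<^sup>2 * h)" "algebraic_int (\<omega>\<^sup>2 * g + \<omega> * h)"
    using z algebraic_int_lin_root_pair[OF root_pair_twist(1)[OF root_pair_v] z]
      algebraic_int_lin_root_pair[OF root_pair_twist(2)[OF root_pair_v] z] unfolding lin_gh by auto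
  have prod12: "(\<omega> * g + \<omega>\<^sup>2 * h) * (\<omega>\<^sup>2 * g + \<omega> * h) = g\<^sup>2 + h\<^sup>2 - g * h"
  proof -
    have "(\<omega> * g + \<omega>\<^sup>2 * h) * (\<omega>\<^sup>2 * g + \<omega> * h)
        = \<omega> ^ 3 * (g\<^sup>2 + h\<^sup>2) + (\<omega>\<^sup>2 + \<omega> ^ 3 * \<omega>) * (g * h)"
      by (simp add: power2_eq_square power3_eq_cube algebra_simps)
    then show ?thesis unfolding \<omega>3 by (simp add: \<omega>_sq algebra_simps)
  qed
  have sum12: "(\<omega> * g + \<omega>\<^sup>2 * h) + (\<omega>\<^sup>2 * g + \<omega> * h) = - (g + h)"
    by (simp add: \<omega>_sq algebra_simps)
  have gh: "g * h = of_int (n * N) / 9"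
  proof -
    have "g * h = (f * f') * (v * v') / 9" by (simp add: g_def h_def)
    then show ?thesis unfolding ff' vv' by simp
  qed
  \<comment> \<open>Up to sign this is the second elementary symmetric function of the three
    conjugates. Its value \<open>3 * (g * h)\<close> being integral forces 3 to divide the norm
    \<open>n\<close> of \<open>f\<close>.\<close>
  have "algebraic_int ((g + h)\<^sup>2 - (g\<^sup>2 + h\<^sup>2 - g * h))"
    unfolding prod12[symmetric] using alg by auto
  also have "(g + h)\<^sup>2 - (g\<^sup>2 + h\<^sup>2 - g * h) = 3 * (g * h)" by (simp add: power2_eq_square algebra_simps)
  also have "\<dots> = of_rat (of_int (n * N) / 3)" unfolding gh by (simp add: of_rat_divide of_rat_mult)
  finally obtain k where "(of_int (n * N) / 3 :: rat) = of_int k" by (rule algebraic_int_rat)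
  then have "(of_int (n * N) :: rat) = of_int (3 * k)" by simp
  then have "n * N = 3 * k" by (simp only: of_int_eq_iff)
  then have "n = 3 * (k * N)" using N by (metis mult.assoc mult.right_neutral)
  then obtain n2 where n2: "n = 3 * n2" by blast
  have "algebraic_int ((g + h) * (g\<^sup>2 + h\<^sup>2 - g * h))" unfolding prod12[symmetric] using alg by auto
  also have "(g + h) * (g\<^sup>2 + h\<^sup>2 - g * h) = g ^ 3 + h ^ 3" by (simp add: power2_eq_square power3_eq_cube algebra_simps)
  finally have sum3: "algebraic_int (g ^ 3 + h ^ 3)" .
  have g3: "27 * g ^ 3 = f ^ 3 * u"
    using root_pair_v by (simp add: g_def root_pair_def power_divide power_mult_distrib)
  have gh3: "27 * (g ^ 3 * h ^ 3) = of_int (n2 ^ 3 * N)"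
  proof -
    have "27 * (g ^ 3 * h ^ 3) = (3 * (g * h)) ^ 3" by (simp add: power_mult_distrib)
    also have "3 * (g * h) = of_int (n2 * N)" unfolding gh n2 by simp
    also have "(of_int (n2 * N) :: complex) ^ 3 = of_int (n2 ^ 3) * of_int N * (of_int N * of_int N)"
      by (simp add: power_mult_distrib power3_eq_cube)
    finally show ?thesis unfolding NN by simp
  qed
  \<comment> \<open>The numbers \<open>g ^ 3\<close> and \<open>h ^ 3\<close> are the roots of a
    quadratic polynomial; multiplied by 27, its relation for \<open>g ^ 3\<close> has integral terms
    on the right.\<close>
  have "(f\<^sup>2 / 3 * v * v) ^ 3 = 27 * (g ^ 3)\<^sup>2"
    by (simp add: g_def power2_eq_square power3_eq_cube)
  also have "\<dots> = (g ^ 3 + h ^ 3) * (27 * g ^ 3) - 27 * (g ^ 3 * h ^ 3)" by (simp add: power2_eq_square algebra_simps)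
  also have "algebraic_int \<dots>"
    unfolding g3 gh3
    by (intro algebraic_int_diff algebraic_int_mult algebraic_int_power algebraic_int_of_int sum3
        algebraic_int_u y[folded f_def])
  finally have "algebraic_int ((f\<^sup>2 / 3 * v * v) ^ 3)" .
  then have "algebraic_int (f\<^sup>2 / 3 * v * v)" by (rule algebraic_int_of_power) simp
  then have f_sq: "algebraic_int (f\<^sup>2 / 3)" by (rule algebraic_int_cancel_v[OF algebraic_int_cancel_v])
  have f_sq_eq: "f\<^sup>2 / 3 = of_rat ((p\<^sup>2 + r\<^sup>2 * of_int d) / 3) + of_rat (2 * p * r / 3) * s"
  proof -
    have "f\<^sup>2 = of_rat p ^ 2 + of_rat r ^ 2 * s\<^sup>2 + 2 * of_rat p * of_rat r * s"
      by (simp add: f_def power2_eq_square algebra_simps)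
    then show ?thesis unfolding s_sq by (simp add: of_rat_divide of_rat_add of_rat_mult of_rat_power add_divide_distrib)
  qed
  \<comment> \<open>The trace of \<open>f ^ 2 / 3\<close> is an integer. Together with 3 dividing
    the norm of \<open>f\<close>, it makes 3 divide \<open>A ^ 2\<close> and
    \<open>d * B ^ 2\<close>, hence \<open>A\<close> and \<open>B\<close>.\<close>
  have "algebraic_int (of_rat (2 * ((p\<^sup>2 + r\<^sup>2 * of_int d) / 3)) :: complex)"
    using algebraic_int_add[OF f_sq[unfolded f_sq_eq] algebraic_int_conj[OF f_sq[unfolded f_sq_eq]]]
    unfolding of_rat_mult[of 2 "(p\<^sup>2 + r\<^sup>2 * of_int d) / 3"] by simp
  then obtain k where "2 * ((p\<^sup>2 + r\<^sup>2 * of_int d) / 3) = of_int k" by (rule algebraic_int_rat)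
  then have "of_int k * 3 = 2 * (p\<^sup>2 + r\<^sup>2 * of_int d)" by simp
  then have "of_int (6 * k) = (2 * p)\<^sup>2 + of_int d * (2 * r)\<^sup>2" by (simp add: power_mult_distrib algebra_simps)
  also have "\<dots> = of_int (A\<^sup>2 + d * B\<^sup>2)" unfolding AB by simp
  finally have k: "6 * k = A\<^sup>2 + d * B\<^sup>2" by (simp only: of_int_eq_iff)
  have halves: "x = 3 * (i + 2 * j) \<and> y = 3 * (i - 2 * j)" if "6 * i = x + y" "x - y = 4 * (3 * j)"
    for x y i j :: int using that by presburger
  have A2: "A\<^sup>2 = 3 * (k + 2 * n2)" and B2: "d * B\<^sup>2 = 3 * (k - 2 * n2)"
    using halves[OF k AB(3)[unfolded n2]] by auto
  have "3 dvd A" using A2 prime_dvd_power[OF prime_3_int, of A 2] by (metis dvd_triv_left)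
  then obtain A1 where A1: "A = 3 * A1" by (elim dvdE)
  have "3 dvd d * B\<^sup>2" unfolding B2 by simp
  then have "3 dvd B" using d_not_dvd prime_dvd_mult_iff[OF prime_3_int] prime_dvd_power[OF prime_3_int] by blast
  then obtain B1 where B1: "B = 3 * B1" by (elim dvdE)
  have "3 * (A1\<^sup>2 - d * B1\<^sup>2) = 4 * n2" using AB(3) unfolding A1 B1 n2 by (simp add: power_mult_distrib)
  then have "4 dvd A1\<^sup>2 - d * B1\<^sup>2" by presburger
  then obtain k1 where k1: "A1\<^sup>2 - d * B1\<^sup>2 = 4 * k1" by (elim dvdE)
  have f3: "f / 3 = (of_int A1 + of_int B1 * s) / 2" using f2(1) unfolding A1 B1 by (simp add: field_simps)
  \<comment> \<open>The polynomial \<open>X ^ 2 - A1 * X + k1\<close> has the trace and norm of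
    \<open>f / 3\<close> as coefficients.\<close>
  have "4 * (of_int k1 + f / 3 * (f / 3 - of_int A1)) = of_int (4 * k1) - (of_int A1)\<^sup>2 + (of_int B1)\<^sup>2 * s\<^sup>2"
    unfolding f3 by (simp add: power2_eq_square field_simps)
  also have "\<dots> = 0" unfolding k1[symmetric] s_sq by simp
  finally have "of_int k1 + f / 3 * (f / 3 - of_int A1) = 0"
    by (simp only: mult_eq_0_iff) simp
  then have "poly (map_poly of_int [:k1, - A1, 1:]) (f / 3) = 0" by simp
  then have "algebraic_int (f / 3)" by (rule algebraic_int_poly) simp
  then show ?thesis by (simp add: f_def)
qed

lemma generator_coeffs:
  obtains g h :: rat where "\<rho> = of_rat g + of_rat h * s" "h = (if d mod 4 = 1 then 1 / 2 else 1)"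
proof (cases "d mod 4 = 1")
  case True
  have "\<rho> = of_rat (1 / 2) + of_rat (1 / 2) * s"
    using True by (simp add: quadratic_generator_def of_rat_divide add_divide_distrib)
  then show ?thesis using that[of "1 / 2" "1 / 2"] True by simp
next
  case False
  then have "\<rho> = of_rat 0 + of_rat 1 * s" by (simp add: quadratic_generator_def)
  then show ?thesis using that[of 0 1] False by simp
qed

text \<open>For an integral \<open>z = lin x p r v v'\<close> the weighted sums make
  \<open>n = 3 * x\<close> an integer and \<open>3 * (p + r s)\<close> integral. Subtracting
  \<open>n * \<theta>\<close> removes the rational coordinate, and the remainder is of the form
  treated in \<open>third_integral\<close>.\<close>

lemma integral_basis_E:
  assumes \<theta>: "algebraic_int \<theta>" and gh: "\<rho> = of_rat g + of_rat h * s" "h \<noteq> 0"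
  shows "integral_basis E [\<theta>, lin 0 1 0 v v', lin 0 g h v v']" (is "Defs.integral_basis E ?ws")
proof -
  obtain p0 r0 where theta: "\<theta> = lin (1 / 3) (p0 / 3) (r0 / 3) v v'"
    and alg0: "algebraic_int (of_rat p0 + of_rat r0 * s)" by (rule theta_eq_lin)
  have sum_ws: "(\<Sum>i<length ?ws. of_int (c i) * ?ws ! i) =
    lin (of_int (c 0) / 3) (of_int (c 0) * p0 / 3 + of_int (c 1) + of_int (c 2) * g)
      (of_int (c 0) * r0 / 3 + of_int (c 2) * h) v v'" for c :: "nat \<Rightarrow> int"
  proof -
    have "(\<Sum>i<length ?ws. of_int (c i) * ?ws ! i) = of_rat (of_int (c 0)) * lin (1 / 3) (p0 / 3) (r0 / 3) v v'
      + of_rat (of_int (c 1)) * lin 0 1 0 v v' + of_rat (of_int (c 2)) * lin 0 g h v v'"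
      unfolding theta by (simp add: numeral_2_eq_2)
    then show ?thesis unfolding lin_scale lin_add by simp
  qed
  show ?thesis
  proof (rule integral_basisI[OF E_subfield])
    fix i assume i: "i < length ?ws"
    have "algebraic_int (lin 0 g h v v')"
    proof -
      have "algebraic_int (of_rat g - of_rat h * s)"
        using algebraic_int_conj algebraic_int_generator unfolding gh(1) by blast
      then show ?thesis
        using algebraic_int_generator root_pair_algebraic_int[OF root_pair_v]
        unfolding gh(1) lin_def by auto
    qed
    moreover have "algebraic_int (lin 0 1 0 v v')"
      using root_pair_algebraic_int[OF root_pair_v] by (auto simp: lin_def)
    ultimately show "?ws ! i \<in> E \<and> algebraic_int (?ws ! i)"
      using i \<theta> lin_in_E by (auto simp: less_Suc_eq theta)
  next
    fix z assume z: "z \<in> E" "algebraic_int z"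
    obtain x p r where xpr: "z = lin x p r v v'" using E_cases[OF z(1)] .
    note tw = z(2)[unfolded xpr] algebraic_int_lin_root_pair[OF root_pair_twist(1)[OF root_pair_v] z(2)[unfolded xpr]]
      algebraic_int_lin_root_pair[OF root_pair_twist(2)[OF root_pair_v] z(2)[unfolded xpr]]
    have "algebraic_int (of_rat (3 * x) :: complex)"
      unfolding sum_lin_twists(1)[of x p r, symmetric] by (intro algebraic_int_add tw)
    then obtain n where n: "3 * x = of_int n" by (rule algebraic_int_rat)
    have "algebraic_int (of_rat 3 * (of_rat p + of_rat r * s) * v)"
      unfolding sum_lin_twists(2)[of x p r, symmetric]
      by (intro algebraic_int_add algebraic_int_mult algebraic_int_power algebraic_int_\<omega> tw)
    then have "algebraic_int (of_rat 3 * (of_rat p + of_rat r * s))" by (rule algebraic_int_cancel_v)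
    then have "algebraic_int (of_rat 3 * (of_rat p + of_rat r * s) - of_int n * (of_rat p0 + of_rat r0 * s))"
      using alg0 by auto
    also have "of_rat 3 * (of_rat p + of_rat r * s) - of_int n * (of_rat p0 + of_rat r0 * s)
        = of_rat (3 * p - of_int n * p0) + of_rat (3 * r - of_int n * r0) * s"
      by (simp add: of_rat_diff of_rat_mult algebra_simps)
    finally have alg1: "algebraic_int (of_rat (3 * p - of_int n * p0) + of_rat (3 * r - of_int n * r0) * s)" .
    have x: "x = of_int n / 3" using n by simp
    have z_eq: "z = of_rat (of_int n) * \<theta> + lin 0 ((3 * p - of_int n * p0) / 3) ((3 * r - of_int n * r0) / 3) v v'"
      unfolding theta lin_scale lin_add xpr x by (simp add: diff_divide_distrib)
    then have "lin 0 ((3 * p - of_int n * p0) / 3) ((3 * r - of_int n * r0) / 3) v v' = z - of_int n * \<theta>" by simp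
    then have "algebraic_int (lin 0 ((3 * p - of_int n * p0) / 3) ((3 * r - of_int n * r0) / 3) v v')"
      using z(2) \<theta> by auto
    from third_integral[OF alg1 this]
    have "algebraic_int ((of_rat (3 * p - of_int n * p0) + of_rat (3 * r - of_int n * r0) * s) / 3)" .
    moreover have "(of_rat (3 * p - of_int n * p0) + of_rat (3 * r - of_int n * r0) * s) / 3 \<in> K"
      by (intro subfield_closed K_subfield s_in_K)
    ultimately obtain i j where ij:
      "(of_rat (3 * p - of_int n * p0) + of_rat (3 * r - of_int n * r0) * s) / 3 = of_int i + of_int j * \<rho>"
      using algebraic_int_iff by blast
    have "of_rat ((3 * p - of_int n * p0) / 3 - (of_int i + of_int j * g))
        + of_rat ((3 * r - of_int n * r0) / 3 - of_int j * h) * s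
        = (of_rat (3 * p - of_int n * p0) + of_rat (3 * r - of_int n * r0) * s) / 3
          - (of_int i + of_int j * (of_rat g + of_rat h * s))"
      by (simp add: of_rat_diff of_rat_divide of_rat_add of_rat_mult add_divide_distrib diff_divide_distrib algebra_simps)
    also have "\<dots> = 0" using ij unfolding gh(1) by simp
    finally have eq0: "of_rat ((3 * p - of_int n * p0) / 3 - (of_int i + of_int j * g))
        + of_rat ((3 * r - of_int n * r0) / 3 - of_int j * h) * s = 0" .
    have "(3 * p - of_int n * p0) / 3 = of_int i + of_int j * g" "(3 * r - of_int n * r0) / 3 = of_int j * h"
      using rat_coeffs_eq_0[OF eq0] by simp_all
    then have "z = lin (of_int n / 3) (of_int n * p0 / 3 + of_int i + of_int j * g) (of_int n * r0 / 3 + of_int j * h) v v'"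
      unfolding z_eq theta lin_scale lin_add by (simp add: add.assoc)
    then show "\<exists>c::nat \<Rightarrow> int. z = (\<Sum>i<length ?ws. of_int (c i) * ?ws ! i)"
      unfolding sum_ws by (intro exI[of _ "\<lambda>l. if l = 0 then n else if l = 1 then i else j"]) simp
  next
    fix c :: "nat \<Rightarrow> int" and i
    assume "(\<Sum>i<length ?ws. of_int (c i) * ?ws ! i) = 0" and i: "i < length ?ws"
    note zero = lin_eq_0[OF this(1)[unfolded sum_ws]]
    have "c 0 = 0" using zero(1) by simp
    moreover have "c 2 = 0" using zero(3) gh(2) \<open>c 0 = 0\<close> by simp
    moreover have "c 1 = 0" using zero(2) \<open>c 0 = 0\<close> \<open>c 2 = 0\<close> by simp
    ultimately show "c i = 0" using i by (auto simp: less_Suc_eq numeral_2_eq_2)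
  qed
qed

text \<open>The left side is the determinant with rows
  \<open>(1 + A x + A' y, x + y, q x + q' y)\<close>. Its matrix is the one with rows
  \<open>(1, x, y)\<close> times a coefficient matrix of determinant \<open>q' - q\<close>, so
  \<open>A\<close> and \<open>A'\<close>, which come from the coordinates of
  \<open>\<theta>\<close>, drop out.\<close>

lemma det_embedding_identity:
  fixes A A' q q' x0 y0 x1 y1 x2 y2 :: complex
  shows "(1 + A * x0 + A' * y0) * ((x1 + y1) * (q * x2 + q' * y2) - (q * x1 + q' * y1) * (x2 + y2))
     - (x0 + y0) * ((1 + A * x1 + A' * y1) * (q * x2 + q' * y2) - (q * x1 + q' * y1) * (1 + A * x2 + A' * y2))
     + (q * x0 + q' * y0) * ((1 + A * x1 + A' * y1) * (x2 + y2) - (x1 + y1) * (1 + A * x2 + A' * y2))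
   = (q' - q) * ((x1 * y2 - y1 * x2) - (x0 * y2 - y0 * x2) + (x0 * y1 - y0 * x1))"
  by (simp add: algebra_simps)

lemma discriminant_E:
  assumes \<theta>: "algebraic_int \<theta>"
  shows "field_discriminant E = (if d mod 4 = 1 then - 3 * d else 4 * (- 3 * d))"
proof -
  obtain g h where gh: "\<rho> = of_rat g + of_rat h * s" "h = (if d mod 4 = 1 then 1 / 2 else 1)"
    by (rule generator_coeffs)
  have h0: "h \<noteq> 0" using gh(2) by (simp split: if_splits)
  let ?ws = "[\<theta>, lin 0 1 0 v v', lin 0 g h v v']"
  obtain p0 r0 where theta: "\<theta> = lin (1 / 3) (p0 / 3) (r0 / 3) v v'" using theta_eq_lin by blast
  obtain \<sigma>0 \<sigma>1 \<sigma>2 where \<sigma>: "distinct [\<sigma>0, \<sigma>1, \<sigma>2]" "set [\<sigma>0, \<sigma>1, \<sigma>2] = embeddings E"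
    "\<sigma>0 (v + v') = v + v'" "\<sigma>1 (v + v') = \<omega> * v + \<omega>\<^sup>2 * v'" "\<sigma>2 (v + v') = \<omega>\<^sup>2 * v + \<omega> * v'"
    by (rule embedding_list)
  let ?\<sigma>s = "[\<sigma>0, \<sigma>1, \<sigma>2]"
  have emb: "\<sigma>0 \<in> embeddings E" "\<sigma>1 \<in> embeddings E" "\<sigma>2 \<in> embeddings E" using \<sigma>(2) by auto
  note lin\<sigma> = embedding_lin[OF emb(1) \<sigma>(3) root_pair_v] embedding_lin[OF emb(2) \<sigma>(4) root_pair_twist(1)[OF root_pair_v]]
    embedding_lin[OF emb(3) \<sigma>(5) root_pair_twist(2)[OF root_pair_v]]
  define A A' where "A = of_rat p0 + of_rat r0 * s" and "A' = of_rat p0 - of_rat r0 * s"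
  define q q' where "q = of_rat g + of_rat h * s" and "q' = of_rat g - of_rat h * s"
  have lins: "lin (1 / 3) (p0 / 3) (r0 / 3) y y' = (1 + A * y + A' * y') / 3" "lin 0 1 0 y y' = y + y'"
    "lin 0 g h y y' = q * y + q' * y'" for y y'
    by (simp_all add: lin_def A_def A'_def q_def q'_def of_rat_divide add_divide_distrib diff_divide_distrib algebra_simps)
  define y1 where "y1 = lin 0 1 0 v v'"
  define y2 where "y2 = lin 0 g h v v'"
  have "embedding_mat ?\<sigma>s [\<theta>, y1, y2] = mat 3 3 (\<lambda>(i, j). (?\<sigma>s ! i) ([\<theta>, y1, y2] ! j))"
    by (simp add: embedding_mat_def numeral_3_eq_3)
  then have det: "det (embedding_mat ?\<sigma>s [\<theta>, y1, y2]) = \<sigma>0 \<theta> * (\<sigma>1 y1 * \<sigma>2 y2 - \<sigma>1 y2 * \<sigma>2 y1)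
      - \<sigma>0 y1 * (\<sigma>1 \<theta> * \<sigma>2 y2 - \<sigma>1 y2 * \<sigma>2 \<theta>) + \<sigma>0 y2 * (\<sigma>1 \<theta> * \<sigma>2 y1 - \<sigma>1 y1 * \<sigma>2 \<theta>)"
    by (simp add: det_mat_3)
  \<comment> \<open>Takes the common denominator 3 out of the column of
    \<open>\<theta>\<close>.\<close>
  have scale: "3 * (x / 3 * k1 - k2 * (y / 3 * k3 - k4 * (z / 3)) + k5 * (y / 3 * k6 - k7 * (z / 3)))
      = x * k1 - k2 * (y * k3 - k4 * z) + k5 * (y * k6 - k7 * z)" for x y z k1 k2 k3 k4 k5 k6 k7 :: complex
    by (simp add: algebra_simps)
  have "3 * det (embedding_mat ?\<sigma>s ?ws) =
      (q' - q) * (((\<omega> * v) * (\<omega> * v') - (\<omega>\<^sup>2 * v') * (\<omega>\<^sup>2 * v)) - (v * (\<omega> * v') - v' * (\<omega>\<^sup>2 * v))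
        + (v * (\<omega>\<^sup>2 * v') - v' * (\<omega> * v)))"
    unfolding det[unfolded y1_def y2_def] unfolding theta lin\<sigma> unfolding lins scale det_embedding_identity ..
  also have "\<dots> = (q' - q) * (3 * \<omega>\<^sup>2 - 2 * \<omega> - \<omega> * \<omega> ^ 3) * (v * v')"
    by (simp add: power2_eq_square power3_eq_cube algebra_simps)
  also have "\<dots> = - (2 * of_rat h * s) * (- 3 - 6 * \<omega>) * of_int N"
    unfolding \<omega>3 vv' q_def q'_def by (simp add: \<omega>_sq algebra_simps)
  finally have "(3 * det (embedding_mat ?\<sigma>s ?ws))\<^sup>2
      = (- (2 * of_rat h * s) * (- 3 - 6 * \<omega>) * of_int N)\<^sup>2" by simp
  \<comment> \<open>The number \<open>1 + 2 * \<omega>\<close> is a square root of -3, so the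
    bracket is -27; dividing by the 9 from the scaling leaves the factor -3 of the
    discriminant.\<close>
  also have "\<dots> = 4 * of_rat h ^ 2 * s\<^sup>2 * (9 * (1 + 4 * \<omega> + 4 * \<omega>\<^sup>2)) * (of_int N * of_int N)"
    by (simp add: power2_eq_square algebra_simps)
  also have "\<dots> = - 27 * (4 * of_rat h ^ 2 * of_int d)" unfolding NN s_sq \<omega>_sq by simp
  also have "4 * of_rat h ^ 2 * of_int d = (of_int (if d mod 4 = 1 then d else 4 * d) :: complex)"
    by (simp add: gh(2) of_rat_divide power_divide)
  finally have "9 * (det (embedding_mat ?\<sigma>s ?ws))\<^sup>2 = 9 * of_int (- 3 * (if d mod 4 = 1 then d else 4 * d))"
    by (simp only: power_mult_distrib) simp
  then have det_sq: "(det (embedding_mat ?\<sigma>s ?ws))\<^sup>2 = of_int (- 3 * (if d mod 4 = 1 then d else 4 * d))"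
    by (simp only: mult_cancel_left) simp
  have "field_discriminant E = - 3 * (if d mod 4 = 1 then d else 4 * d)"
    by (rule field_discriminant_eqI[OF E_subfield integral_basis_E[OF \<theta> gh(1) h0] \<sigma>(1,2) _ det_sq[symmetric]]) simp
  then show ?thesis by simp
qed

text \<open>For \<open>e = 9 * g\<close> the factor 27 cancels, and \<open>\<theta>\<close> is a
  root of \<open>X ^ 3 - X ^ 2 - 3 * d * g ^ 2\<close>.\<close>

lemma algebraic_int_theta:
  assumes "(3 * \<theta>) ^ 3 - 3 * (3 * \<theta>)\<^sup>2 = of_int d * (of_int e)\<^sup>2" "9 dvd e"
  shows "algebraic_int \<theta>"
proof -
  obtain g where g: "e = 9 * g" using assms(2) by (elim dvdE)
  have "27 * (\<theta> ^ 3 - \<theta>\<^sup>2) = 81 * (of_int d * (of_int g)\<^sup>2)"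
    using assms(1) unfolding g by (simp add: power_mult_distrib)
  then have "27 * (\<theta> ^ 3 - \<theta>\<^sup>2) = 27 * (3 * (of_int d * (of_int g)\<^sup>2))" by simp
  then have "\<theta> ^ 3 - \<theta>\<^sup>2 = 3 * (of_int d * (of_int g)\<^sup>2)" by (simp only: mult_cancel_left) simp
  then have "poly (map_poly of_int [:- 3 * (d * g\<^sup>2), 0, - 1, 1:]) \<theta> = 0"
    by (simp add: power2_eq_square power3_eq_cube algebra_simps)
  then show ?thesis by (rule algebraic_int_poly) simp
qed

end

section \<open>Units of quadratic fields and the equality of discriminants\<close>

lemma (in quadratic_field) unit_norm:
  assumes "of_rat a + of_rat b * s \<in> Units (\<O> K)"
  obtains N :: int where "N * N = 1" "(of_rat a + of_rat b * s) * (of_rat a - of_rat b * s) = of_int N"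
proof -
  let ?z = "of_rat a + of_rat b * s"
  obtain w where w: "w \<in> K" "algebraic_int w" "?z * w = 1" and z: "?z \<in> K" "algebraic_int ?z"
    using assms by (auto simp: Units_def ring_of_integers_def)
  obtain p q where pq: "w = of_rat p + of_rat q * s" using K_cases[OF w(1)] .
  have norm: "(of_rat x + of_rat y * s) * (of_rat x - of_rat y * s) = of_rat (x\<^sup>2 - y\<^sup>2 * of_int m)" for x y
  proof -
    have "(of_rat x + of_rat y * s) * (of_rat x - of_rat y * s) = of_rat x ^ 2 - of_rat y ^ 2 * s\<^sup>2"
      by (simp add: power2_eq_square algebra_simps)
    then show ?thesis unfolding s_sq by (simp add: of_rat_diff of_rat_mult of_rat_power)
  qed
  have "algebraic_int (of_rat (a\<^sup>2 - b\<^sup>2 * of_int m) :: complex)"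
    unfolding norm[symmetric] by (intro algebraic_int_mult z algebraic_int_conj)
  then obtain N where N: "a\<^sup>2 - b\<^sup>2 * of_int m = of_int N" by (rule algebraic_int_rat)
  have "algebraic_int (of_rat (p\<^sup>2 - q\<^sup>2 * of_int m) :: complex)"
    unfolding norm[symmetric] using w(2) algebraic_int_conj unfolding pq by (intro algebraic_int_mult) auto
  then obtain k where k: "p\<^sup>2 - q\<^sup>2 * of_int m = of_int k" by (rule algebraic_int_rat)
  obtain \<sigma> where \<sigma>: "\<sigma> \<in> embeddings K" "\<And>p q. \<sigma> (of_rat p + of_rat q * s) = of_rat p - of_rat q * s"
    using conj_embedding by blast
  have "(of_rat a - of_rat b * s) * (of_rat p - of_rat q * s) = \<sigma> (?z * w)"
    using embeddingsD(2)[OF \<sigma>(1) z(1) w(1)] unfolding \<sigma>(2) pq by simp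
  also have "\<dots> = 1" unfolding w(3) by (rule embeddingsD(3)[OF \<sigma>(1)])
  finally have "(?z * w) * ((of_rat a - of_rat b * s) * (of_rat p - of_rat q * s)) = 1" unfolding w(3) by simp
  then have "(?z * (of_rat a - of_rat b * s)) * ((of_rat p + of_rat q * s) * (of_rat p - of_rat q * s)) = 1"
    unfolding pq by (simp only: mult_ac)
  then have "of_int (N * k) = (of_int 1 :: complex)" unfolding norm N k by simp
  then have "N * k = 1" by (simp only: of_int_eq_iff)
  then have "N * N = 1" using zmult_eq_1_iff by auto
  then show thesis using that norm[of a b] N by simp
qed

text \<open>A cube root of \<open>U\<close> in the field would be a unit, hence a power of
  \<open>U\<close> up to sign. Since \<open>U\<close> is positive, \<open>U\<close> would equal its
  power with exponent \<open>n * 3\<close>, and \<open>U > 1\<close> forces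
  \<open>n * 3 = 1\<close>.\<close>

lemma fundamental_unit_not_cube:
  fixes d :: int
  assumes "is_fundamental_unit d U" and z: "z \<in> Q_adjoin (complex_of_real (sqrt (of_int d)))"
  shows "z ^ 3 \<noteq> complex_of_real U"
proof
  let ?K = "Q_adjoin (complex_of_real (sqrt (of_int d)))"
  note K = subfield_Q_adjoin[of "complex_of_real (sqrt (of_int d))"]
  assume z3: "z ^ 3 = complex_of_real U"
  have U: "U > 1" "complex_of_real U \<in> Units (\<O> ?K)"
    "\<And>w. w \<in> Units (\<O> ?K) \<Longrightarrow> \<exists>n :: int. w = complex_of_real (U powi n) \<or> w = - complex_of_real (U powi n)"
    using assms(1) unfolding is_fundamental_unit_def Let_def by auto
  obtain w where w: "w \<in> ?K" "algebraic_int w" "complex_of_real U * w = 1"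
    and "algebraic_int (complex_of_real U)"
    using U(2) by (auto simp: Units_def ring_of_integers_def)
  then have "algebraic_int z" using algebraic_int_of_power[of z 3] z3 by simp
  moreover have "z * (z\<^sup>2 * w) = z ^ 3 * w" by (simp add: power2_eq_square power3_eq_cube)
  then have "z * (z\<^sup>2 * w) = 1" unfolding z3 w(3) .
  moreover have "z\<^sup>2 * w \<in> ?K" by (intro subfield_closed K z w)
  moreover have "algebraic_int (z\<^sup>2 * w)" using \<open>algebraic_int z\<close> w(2) by auto
  ultimately have "z \<in> Units (\<O> ?K)"
    using z by (auto simp: Units_def ring_of_integers_def mult.commute intro!: bexI[of _ "z\<^sup>2 * w"])
  then obtain n :: int where n: "z = complex_of_real (U powi n) \<or> z = - complex_of_real (U powi n)" using U(3) by blast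
  have "complex_of_real U = complex_of_real ((U powi n) ^ 3) \<or> complex_of_real U = complex_of_real (- ((U powi n) ^ 3))"
    using n z3 by auto
  then have "U = (U powi n) ^ 3 \<or> U = - ((U powi n) ^ 3)" by (simp only: of_real_eq_iff)
  moreover have "(U powi n) ^ 3 > 0" using U(1) by simp
  ultimately have "U = (U powi n) ^ 3" using U(1) by linarith
  also have "\<dots> = U powi (n * 3)" by (simp add: power_int_mult)
  finally have eq: "U powi 1 = U powi (n * 3)" by simp
  have "n * 3 < 1 \<or> 1 < n * 3" by presburger
  then show False using eq power_int_strict_increasing[of _ _ U] U(1) by (metis less_irrefl)
qed

lemma squarefree_minus_3_times:
  fixes d :: int
  assumes "squarefree d" "\<not> 3 dvd d"
  shows "squarefree (- 3 * d)"
proof -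
  have "Rings.coprime 3 d" using prime_imp_coprime[OF prime_3_int assms(2)] .
  moreover have "squarefree (3 :: int)" by (rule squarefree_prime) (rule prime_3_int)
  ultimately have "squarefree (3 * d)" using assms(1) by (intro squarefree_mult_coprime)
  then show ?thesis unfolding squarefree_def by simp
qed

theorem theorem1p1:
  fixes d :: int and a b :: rat and v v' t :: real and E F M :: "complex set"
  assumes "d > 1" and "squarefree d"
    and "is_fundamental_unit d (of_rat a + of_rat b * sqrt (of_int d))"
    and "v = root 3 (of_rat a + of_rat b * sqrt (of_int d))"
    and "v' = root 3 (of_rat a - of_rat b * sqrt (of_int d))"
    and "t = v + v'"
    and "F = Q_adjoin (csqrt (of_int (- 3 * d)))"
    and "is_ring_class_field F (generate_ring CC {csqrt (of_int (- 3 * d))}) M"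
    and "\<not> 3 dvd d"
    and "complex_of_real v \<in> M"
    and "E = Q_adjoin (complex_of_real t)"
  shows "field_discriminant E = field_discriminant F"
proof -
  define s where "s = complex_of_real (sqrt (of_int d))"
  define \<kappa> where "\<kappa> = csqrt (of_int (- 3 * d))"
  define U where "U = of_rat a + of_rat b * sqrt (of_int d)"
  define U' where "U' = of_rat a - of_rat b * sqrt (of_int d)"
  have rat_real: "complex_of_real (of_rat q) = of_rat q" for q
    by (cases q) (simp add: of_rat_rat)
  have U_eq: "complex_of_real U = of_rat a + of_rat b * s" "complex_of_real U' = of_rat a - of_rat b * s"
    by (simp_all add: U_def U'_def s_def rat_real)
  have s_sq: "s\<^sup>2 = of_int d"
    using assms(1) by (simp add: s_def flip: of_real_power)
  interpret Qd: quadratic_field d s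
    by unfold_locales (use assms s_sq in auto)
  have kappa_sq: "\<kappa>\<^sup>2 = of_int (- 3 * d)" unfolding \<kappa>_def by (rule power2_csqrt)
  interpret F: quadratic_field "- 3 * d" \<kappa>
    by unfold_locales (use assms squarefree_minus_3_times kappa_sq in auto)
  have unit: "of_rat a + of_rat b * s \<in> Units (\<O> Qd.K)"
    using assms(3) unfolding is_fundamental_unit_def Let_def U_def[symmetric] U_eq s_def[symmetric] by auto
  obtain N :: int where N: "N * N = 1" "(of_rat a + of_rat b * s) * (of_rat a - of_rat b * s) = of_int N"
    using Qd.unit_norm[OF unit] .
  have "complex_of_real (U * U') = complex_of_real (of_int N)"
    using N(2) unfolding U_eq[symmetric] by simp
  then have UU': "U * U' = of_int N" by (simp only: of_real_eq_iff)
  have v3: "v ^ 3 = U" "v' ^ 3 = U'" unfolding assms U_def U'_def by (simp_all add: odd_real_root_pow)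
  have "v * v' = root 3 (of_int N)" unfolding assms(4,5) real_root_mult[symmetric] UU'[symmetric] U_def U'_def ..
  also have "\<dots> = of_int N"
  proof -
    have "N = 1 \<or> N = - 1" using N(1) zmult_eq_1_iff by blast
    then show ?thesis by (auto simp: real_root_minus)
  qed
  finally have vv': "v * v' = of_int N" .
  define \<omega> where "\<omega> = (csqrt (- 3) - 1) / 2"
  have "(csqrt (- 3))\<^sup>2 = - 3" by (rule power2_csqrt)
  then have omega: "\<omega>\<^sup>2 + \<omega> + 1 = 0" by (simp add: \<omega>_def power2_eq_square field_simps)
  interpret unit_cube_root d s a b N "complex_of_real v" "complex_of_real v'" \<omega>
  proof unfold_locales
    show "algebraic_int (of_rat a + of_rat b * s)" using unit by (auto simp: Units_def)
    show "complex_of_real v ^ 3 = of_rat a + of_rat b * s" "complex_of_real v' ^ 3 = of_rat a - of_rat b * s"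
      unfolding U_eq[symmetric] v3[symmetric] by simp_all
    show "complex_of_real v * complex_of_real v' = of_int N" using vv' by (metis of_real_mult of_real_of_int_eq)
    show "z ^ 3 \<noteq> of_rat a + of_rat b * s" if "z \<in> Q_adjoin s" for z
      using fundamental_unit_not_cube[OF assms(3)[folded U_def], folded s_def, OF that] unfolding U_eq .
  qed (use assms N omega in auto)
  obtain e :: int where e: "3 dvd e" "(3 * \<theta>) ^ 3 - 3 * (3 * \<theta>)\<^sup>2 = of_int d * (of_int e)\<^sup>2"
    by (rule cubic_defect)
  obtain c where c: "e = 3 * c" using e(1) by (elim dvdE)
  have "3 dvd c"
  proof (rule ccontr)
    assume c3: "\<not> 3 dvd c"
    define f where "f = conductor F (generate_ring CC {csqrt (of_int (- 3 * d))})"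
    have f: "f \<in> {1, 2}" unfolding f_def assms(7) \<kappa>_def[symmetric] by (rule F.conductor_cases)
    have ext: "abelian_extension F M" and unram: "\<And>P. P \<in> primes_of F \<Longrightarrow> of_nat f \<notin> P \<Longrightarrow> unramified_at F M P"
      using assms(8) unfolding is_ring_class_field_def Let_def f_def by auto
    have F: "F = F.K" unfolding assms(7) \<kappa>_def ..
    have M: "subfield M CC" "F \<subseteq> M" using ext by (auto simp: abelian_extension_def)
    have kM: "\<kappa> \<in> M" using F.s_in_K M(2) F by blast
    \<comment> \<open>The element \<open>\<theta>\<close> involves \<open>v'\<close> too, which lies
      in \<open>M\<close> as the quotient of \<open>N\<close> by \<open>v\<close>.\<close>
    have "complex_of_real v' = of_int N / complex_of_real v"
      using vv' root_pair_nonzero[OF root_pair_v] by (simp add: eq_divide_eq mult.commute)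
    also have "\<dots> \<in> M" by (intro subfield_closed M assms(10))
    finally have v'M: "complex_of_real v' \<in> M" .
    have k0: "\<kappa> \<noteq> 0" using F.s_sq F.no_rat_sqrt[of 0] by auto
    define y where "y = of_int d * (3 * \<theta>) / \<kappa>"
    have yM: "y \<in> M" unfolding y_def \<theta>_def by (intro subfield_closed M kM v'M assms(10))
    have yk: "y * \<kappa> = of_int d * (3 * \<theta>)" using k0 by (simp add: y_def)
    \<comment> \<open>Multiplying by \<open>\<kappa> ^ 3\<close> turns the equation into that of
      \<open>3 * \<theta>\<close> scaled by \<open>d ^ 3\<close>, because
      \<open>\<kappa> ^ 2 = - 3 * d\<close> and \<open>e = 3 * c\<close>.\<close>
    have "\<kappa> ^ 3 * (y ^ 3 + \<kappa> * y\<^sup>2) = (y * \<kappa>) ^ 3 + \<kappa>\<^sup>2 * (y * \<kappa>)\<^sup>2"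
      by (simp add: power2_eq_square power3_eq_cube algebra_simps)
    also have "\<dots> = (of_int d) ^ 3 * ((3 * \<theta>) ^ 3 - 3 * (3 * \<theta>)\<^sup>2)"
      unfolding yk kappa_sq by (simp add: power2_eq_square power3_eq_cube algebra_simps)
    also have "\<dots> = (of_int (- 3 * d))\<^sup>2 * of_int (c\<^sup>2 * d\<^sup>2)"
      unfolding e(2) c by (simp add: power2_eq_square power3_eq_cube)
    also have "\<dots> = \<kappa> ^ 3 * (\<kappa> * of_int (c\<^sup>2 * d\<^sup>2))"
      unfolding kappa_sq[symmetric] by (simp add: power2_eq_square power3_eq_cube)
    finally have y_eq: "y ^ 3 + \<kappa> * y\<^sup>2 = \<kappa> * of_int (c\<^sup>2 * d\<^sup>2)" using k0 by simp
    show False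
      by (rule F.ramified_at_3[OF refl assms(9) c3 ext[unfolded F] unram[unfolded F] f yM y_eq])
  qed
  then have "algebraic_int \<theta>" using algebraic_int_theta[OF e(2)] c by auto
  then have "field_discriminant E = (if d mod 4 = 1 then - 3 * d else 4 * (- 3 * d))"
    using discriminant_E unfolding assms(11,6) by simp
  moreover have "field_discriminant F = (if (- 3 * d) mod 4 = 1 then - 3 * d else 4 * (- 3 * d))"
    using F.discriminant unfolding assms(7) \<kappa>_def by simp
  \<comment> \<open>The factor -3 is 1 modulo 4, so \<open>F\<close> and \<open>Q(sqrt d)\<close>
    fall into the same case.\<close>
  moreover have "(- 3 * d) mod 4 = 1 \<longleftrightarrow> d mod 4 = 1" by presburger
  ultimately show ?thesis by simp
qed

end
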